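(* Let $(M,g)$ be a Riemannian manifold of dimension $n>1$ with positive constant sectional curvature $c$, let $A>0$ be a real constant, and let $\lambda:(0,\infty)\to\mathbf{R}$ be a smooth function satisfying $$\lambda(t)>0,\qquad 2c-A^2t\lambda(t)^2>0,\qquad \lambda(t)+2t\lambda'(t)>0\qquad\text{for all } t>0 .$$ Let $(G,J)$ be the K\"ahler structure on the nonzero cotangent bundle $T^*_0M$ given by $$J\frac{\delta}{\delta q^i}=J^{(1)}_{ij}\frac{\partial}{\partial p_j},\qquad J\frac{\partial}{\partial p_i}=-J_{(2)}^{ij}\frac{\delta}{\delta q^j},\qquad G=G^{(1)}_{ij}dq^idq^j+G_{(2)}^{ij}Dp_iDp_j,$$ $$J^{(1)}_{ij}=At\lambda\, g_{ij}+\frac{c-A^2t\lambda(\lambda+t\lambda')}{At(\lambda+2t\lambda')}\,p_ip_j,\qquad J_{(2)}^{ij}=\frac{1}{At\lambda}\,g^{ij}-\frac{c-A^2t\lambda(\lambda+t\lambda')}{At^2\lambda(2c-A^2t\lambda^2)}\,g^{0i}g^{0j},$$ $$G^{(1)}_{ij}=At\lambda^2 g_{ij}+\frac{c-A^2t\lambda^2}{At}\,p_ip_j,\qquad G_{(2)}^{ij}=\frac{1}{At}\,g^{ij}-\frac{c-A^2t[\lambda^2+2t\lambda'(\lambda+t\lambda')]}{At^2(2c-A^2t\lambda^2)}\,g^{0i}g^{0j}.$$ Then $(T^*_0M,G,J)$ does not have constant holomorphic sectional curvature.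
   Context: Everything is smooth; repeated indices are summed over $1,\dots,n$. $(M,g)$ is a smooth $n$-dimensional Riemannian manifold, $\pi:T^*M\to M$ its cotangent bundle, $T^*_0M$ is $T^*M$ minus the zero section. A chart $(U,x^1,\dots,x^n)$ of $M$ induces the chart $(\pi^{-1}(U),q^1,\dots,q^n,p_1,\dots,p_n)$ of $T^*M$, where $q^i=x^i\circ\pi$ and $p=p_i\,dx^i_{\pi(p)}$. With $\Gamma^k_{ih}$ the Christoffel symbols of $g$, put $\Gamma^0_{ih}=p_k\Gamma^k_{ih}$, $\frac{\delta}{\delta q^i}=\frac{\partial}{\partial q^i}+\Gamma^0_{ih}\frac{\partial}{\partial p_h}$, $Dp_i=dp_i-\Gamma^0_{ij}dq^j$. The vector fields $\frac{\delta}{\delta q^i},\frac{\partial}{\partial p_i}$ form a local frame adapted to the splitting $TT^*M=HT^*M\oplus VT^*M$ into horizontal and vertical distributions, with dual coframe $dq^i,Dp_i$. Further, $(g^{ij})$ is the inverse of $(g_{ij})$, $g^{0i}=p_hg^{hi}$, and $t=\frac12 g^{ij}p_ip_j>0$ on $T^*_0M$ is the energy density. The functions of $t$ (such as $\lambda$, $\lambda'=d\lambda/dt$) are evaluated at the energy density. *)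

theory Defs
  imports "HOL-Analysis.Analysis"
begin

section \<open>Smooth maps between open subsets of normed spaces\<close>

primrec Ck_on ::
    "nat \<Rightarrow> ('a::real_normed_vector \<Rightarrow> 'b::real_normed_vector) \<Rightarrow> 'a set \<Rightarrow> bool" where
  "Ck_on 0 f S \<longleftrightarrow> continuous_on S f"
| "Ck_on (Suc k) f S \<longleftrightarrow>
     (\<forall>x\<in>S. f differentiable (at x)) \<and> (\<forall>v. Ck_on k (\<lambda>x. frechet_derivative f (at x) v) S)"

text \<open>Only meant for open sets, since derivatives are taken in full neighbourhoods.\<close>

definition smooth_on ::
    "'a::real_normed_vector set \<Rightarrow> ('a \<Rightarrow> 'b::real_normed_vector) \<Rightarrow> bool" where
  "smooth_on S f \<longleftrightarrow> (\<forall>k. Ck_on k f S)"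

definition partial :: "'n::finite \<Rightarrow> (real^'n \<Rightarrow> real) \<Rightarrow> real^'n \<Rightarrow> real" where
  "partial i f y = frechet_derivative f (at y) (axis i 1)"


section \<open>Smooth manifolds\<close>

text \<open>A chart is a pair of a domain and a map; the values of the map outside the domain are
  irrelevant. The dimension of the manifold is the cardinality of the index type.\<close>

type_synonym ('m, 'n) chart = "'m set \<times> ('m \<Rightarrow> real^'n)"

definition chart_inv :: "('m, 'n::finite) chart \<Rightarrow> real^'n \<Rightarrow> 'm" where
  "chart_inv \<phi> = inv_into (fst \<phi>) (snd \<phi>)"

definition transition :: "('m, 'n::finite) chart \<Rightarrow> ('m, 'n) chart \<Rightarrow> real^'n \<Rightarrow> real^'n" where
  "transition \<phi> \<psi> y = snd \<psi> (chart_inv \<phi> y)"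

definition is_chart :: "'m topology \<Rightarrow> ('m, 'n::finite) chart \<Rightarrow> bool" where
  "is_chart X \<phi> \<longleftrightarrow> openin X (fst \<phi>) \<and> open (snd \<phi> ` fst \<phi>) \<and>
     homeomorphic_map (subtopology X (fst \<phi>)) (top_of_set (snd \<phi> ` fst \<phi>)) (snd \<phi>)"

definition smoothly_compatible :: "('m, 'n::finite) chart \<Rightarrow> ('m, 'n) chart \<Rightarrow> bool" where
  "smoothly_compatible \<phi> \<psi> \<longleftrightarrow>
     smooth_on (snd \<phi> ` (fst \<phi> \<inter> fst \<psi>)) (transition \<phi> \<psi>) \<and>
     smooth_on (snd \<psi> ` (fst \<phi> \<inter> fst \<psi>)) (transition \<psi> \<phi>)"

definition smooth_manifold :: "'m topology \<Rightarrow> ('m, 'n::finite) chart set \<Rightarrow> bool" where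
  "smooth_manifold X \<A> \<longleftrightarrow>
     Hausdorff_space X \<and> second_countable X \<and> topspace X \<noteq> {} \<and>
     (\<forall>\<phi>\<in>\<A>. is_chart X \<phi>) \<and> (\<Union>\<phi>\<in>\<A>. fst \<phi>) = topspace X \<and>
     (\<forall>\<phi>\<in>\<A>. \<forall>\<psi>\<in>\<A>. smoothly_compatible \<phi> \<psi>) \<and>
     (\<forall>\<phi>. is_chart X \<phi> \<and> (\<forall>\<psi>\<in>\<A>. smoothly_compatible \<phi> \<psi>) \<longrightarrow> \<phi> \<in> \<A>)"

text \<open>The notions below depend only on an atlas, which need not be maximal.\<close>

definition points :: "('m, 'n::finite) chart set \<Rightarrow> 'm set" where
  "points \<A> = (\<Union>\<phi>\<in>\<A>. fst \<phi>)"


section \<open>Tangent and cotangent vectors\<close>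

text \<open>A tangent vector at \<open>x\<close> is the family of its coordinate vectors in all the charts around
  \<open>x\<close>, related by the differentials of the transition maps; it is 0 at the other charts.
  \<open>tvec \<A> \<phi> x e\<close> is the vector at \<open>x\<close> whose coordinates in \<open>\<phi>\<close> are \<open>e\<close>.\<close>

type_synonym ('m, 'n) tangent = "('m, 'n) chart \<Rightarrow> real^'n"

definition tvec ::
    "('m, 'n::finite) chart set \<Rightarrow> ('m, 'n) chart \<Rightarrow> 'm \<Rightarrow> real^'n \<Rightarrow> ('m, 'n) tangent" where
  "tvec \<A> \<phi> x e = (\<lambda>\<psi>. if \<psi> \<in> \<A> \<and> x \<in> fst \<psi>
     then frechet_derivative (transition \<phi> \<psi>) (at (snd \<phi> x)) e else 0)"

definition tangent_space :: "('m, 'n::finite) chart set \<Rightarrow> 'm \<Rightarrow> ('m, 'n) tangent set" where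
  "tangent_space \<A> x = {u. \<forall>\<phi>\<in>\<A>. x \<in> fst \<phi> \<longrightarrow> u = tvec \<A> \<phi> x (u \<phi>)}"

definition lincomb ::
    "real \<Rightarrow> ('m, 'n::finite) tangent \<Rightarrow> real \<Rightarrow> ('m, 'n) tangent \<Rightarrow> ('m, 'n) tangent" where
  "lincomb a u b v = (\<lambda>\<phi>. a *\<^sub>R u \<phi> + b *\<^sub>R v \<phi>)"

definition zero_vec :: "('m, 'n::finite) tangent" where
  "zero_vec = (\<lambda>\<phi>. 0)"

definition lin_indep :: "('m, 'n::finite) tangent \<Rightarrow> ('m, 'n) tangent \<Rightarrow> bool" where
  "lin_indep u v \<longleftrightarrow> (\<forall>a b. lincomb a u b v = zero_vec \<longrightarrow> a = 0 \<and> b = 0)"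

definition coord_vec ::
    "('m, 'n::finite) chart set \<Rightarrow> ('m, 'n) chart \<Rightarrow> 'm \<Rightarrow> 'n \<Rightarrow> ('m, 'n) tangent" where
  "coord_vec \<A> \<phi> x i = tvec \<A> \<phi> x (axis i 1)"

text \<open>Cotangent vectors are linear forms on the tangent space, extended by 0 outside it.\<close>

definition cotangent_space ::
    "('m, 'n::finite) chart set \<Rightarrow> 'm \<Rightarrow> (('m, 'n) tangent \<Rightarrow> real) set" where
  "cotangent_space \<A> x = {p.
     (\<forall>u\<in>tangent_space \<A> x. \<forall>v\<in>tangent_space \<A> x. \<forall>a b.
        p (lincomb a u b v) = a * p u + b * p v) \<and>
     (\<forall>u. u \<notin> tangent_space \<A> x \<longrightarrow> p u = 0)}"


section \<open>Riemannian metrics and sectional curvature\<close>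

type_synonym ('m, 'n) metric = "'m \<Rightarrow> ('m, 'n) tangent \<Rightarrow> ('m, 'n) tangent \<Rightarrow> real"

definition metric_coords ::
    "('m, 'n::finite) chart set \<Rightarrow> ('m, 'n) metric \<Rightarrow> ('m, 'n) chart \<Rightarrow> real^'n \<Rightarrow> real^'n^'n" where
  "metric_coords \<A> g \<phi> y = (\<chi> i j. g (chart_inv \<phi> y)
     (coord_vec \<A> \<phi> (chart_inv \<phi> y) i) (coord_vec \<A> \<phi> (chart_inv \<phi> y) j))"

definition riemannian_metric :: "('m, 'n::finite) chart set \<Rightarrow> ('m, 'n) metric \<Rightarrow> bool" where
  "riemannian_metric \<A> g \<longleftrightarrow>
     (\<forall>x\<in>points \<A>. \<forall>u\<in>tangent_space \<A> x. \<forall>v\<in>tangent_space \<A> x.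
        g x u v = g x v u \<and> (u \<noteq> zero_vec \<longrightarrow> g x u u > 0) \<and>
        (\<forall>w\<in>tangent_space \<A> x. \<forall>a b. g x (lincomb a u b v) w = a * g x u w + b * g x v w)) \<and>
     (\<forall>\<phi>\<in>\<A>. \<forall>i j. smooth_on (snd \<phi> ` fst \<phi>) (\<lambda>y. metric_coords \<A> g \<phi> y $ i $ j))"

text \<open>In the next three definitions \<open>h\<close> is the matrix of a metric in a chart. \<open>christoffel h y k i j\<close>
  is \<open>\<Gamma>\<^sup>k\<^sub>i\<^sub>j\<close>, and \<open>riemann h y l k i j\<close> is \<open>R\<^sup>l\<^sub>k\<^sub>i\<^sub>j\<close>, where
  \<open>R(\<partial>\<^sub>i, \<partial>\<^sub>j) \<partial>\<^sub>k = R\<^sup>l\<^sub>k\<^sub>i\<^sub>j \<partial>\<^sub>l\<close> and \<open>R(X, Y) = [\<nabla>\<^sub>X, \<nabla>\<^sub>Y] - \<nabla>\<^sub>[\<^sub>X\<^sub>,\<^sub>Y\<^sub>]\<close>.\<close>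

definition christoffel ::
    "(real^'n::finite \<Rightarrow> real^'n^'n) \<Rightarrow> real^'n \<Rightarrow> 'n \<Rightarrow> 'n \<Rightarrow> 'n \<Rightarrow> real" where
  "christoffel h y k i j = (1/2) * (\<Sum>l\<in>UNIV. matrix_inv (h y) $ k $ l *
     (partial i (\<lambda>z. h z $ j $ l) y + partial j (\<lambda>z. h z $ i $ l) y
      - partial l (\<lambda>z. h z $ i $ j) y))"

definition riemann ::
    "(real^'n::finite \<Rightarrow> real^'n^'n) \<Rightarrow> real^'n \<Rightarrow> 'n \<Rightarrow> 'n \<Rightarrow> 'n \<Rightarrow> 'n \<Rightarrow> real" where
  "riemann h y l k i j =
     partial i (\<lambda>z. christoffel h z l j k) y - partial j (\<lambda>z. christoffel h z l i k) y
     + (\<Sum>m\<in>UNIV. christoffel h y l i m * christoffel h y m j k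
                 - christoffel h y l j m * christoffel h y m i k)"

text \<open>\<open>riemann_form h y u v w z\<close> is \<open>h(R(u, v) w, z)\<close>.\<close>

definition riemann_form ::
    "(real^'n::finite \<Rightarrow> real^'n^'n) \<Rightarrow> real^'n \<Rightarrow> real^'n \<Rightarrow> real^'n \<Rightarrow> real^'n \<Rightarrow> real^'n \<Rightarrow> real" where
  "riemann_form h y u v w z = (\<Sum>i\<in>UNIV. \<Sum>j\<in>UNIV. \<Sum>k\<in>UNIV. \<Sum>l\<in>UNIV. \<Sum>m\<in>UNIV.
     h y $ l $ m * riemann h y l k i j * u $ i * v $ j * w $ k * z $ m)"

text \<open>Sectional curvature of the plane spanned by \<open>u\<close> and \<open>v\<close>, computed in the chart \<open>\<phi>\<close>
  around \<open>x\<close>; its value is the same for all charts.\<close>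

definition sectional_curvature ::
    "('m, 'n::finite) chart set \<Rightarrow> ('m, 'n) metric \<Rightarrow> ('m, 'n) chart \<Rightarrow> 'm \<Rightarrow>
     ('m, 'n) tangent \<Rightarrow> ('m, 'n) tangent \<Rightarrow> real" where
  "sectional_curvature \<A> g \<phi> x u v =
     riemann_form (metric_coords \<A> g \<phi>) (snd \<phi> x) (u \<phi>) (v \<phi>) (v \<phi>) (u \<phi>)
     / (g x u u * g x v v - (g x u v)\<^sup>2)"

definition constant_sectional_curvature ::
    "('m, 'n::finite) chart set \<Rightarrow> ('m, 'n) metric \<Rightarrow> real \<Rightarrow> bool" where
  "constant_sectional_curvature \<A> g c \<longleftrightarrow>
     (\<forall>\<phi>\<in>\<A>. \<forall>x\<in>fst \<phi>. \<forall>u\<in>tangent_space \<A> x. \<forall>v\<in>tangent_space \<A> x.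
        lin_indep u v \<longrightarrow> sectional_curvature \<A> g \<phi> x u v = c)"


section \<open>Kaehler structures and holomorphic sectional curvature\<close>

type_synonym ('m, 'n) endo_field = "'m \<Rightarrow> ('m, 'n) tangent \<Rightarrow> ('m, 'n) tangent"

text \<open>\<open>endo_coords \<A> J \<phi> y $ k $ i\<close> is \<open>J\<^sup>k\<^sub>i\<close>, where \<open>J \<partial>\<^sub>i = J\<^sup>k\<^sub>i \<partial>\<^sub>k\<close>.\<close>

definition endo_coords ::
    "('m, 'n::finite) chart set \<Rightarrow> ('m, 'n) endo_field \<Rightarrow> ('m, 'n) chart \<Rightarrow> real^'n \<Rightarrow> real^'n^'n" where
  "endo_coords \<A> J \<phi> y = (\<chi> k i. J (chart_inv \<phi> y) (coord_vec \<A> \<phi> (chart_inv \<phi> y) i) \<phi> $ k)"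

definition almost_complex :: "('m, 'n::finite) chart set \<Rightarrow> ('m, 'n) endo_field \<Rightarrow> bool" where
  "almost_complex \<A> J \<longleftrightarrow>
     (\<forall>x\<in>points \<A>. \<forall>u\<in>tangent_space \<A> x.
        J x u \<in> tangent_space \<A> x \<and> J x (J x u) = lincomb (-1) u 0 u \<and>
        (\<forall>v\<in>tangent_space \<A> x. \<forall>a b. J x (lincomb a u b v) = lincomb a (J x u) b (J x v))) \<and>
     (\<forall>\<phi>\<in>\<A>. \<forall>k i. smooth_on (snd \<phi> ` fst \<phi>) (\<lambda>y. endo_coords \<A> J \<phi> y $ k $ i))"

text \<open>\<open>nijenhuis F y k i j\<close> is the \<open>k\<close>-th component of
  \<open>[J\<partial>\<^sub>i, J\<partial>\<^sub>j] - J[J\<partial>\<^sub>i, \<partial>\<^sub>j] - J[\<partial>\<^sub>i, J\<partial>\<^sub>j] - [\<partial>\<^sub>i, \<partial>\<^sub>j]\<close>, where \<open>F\<close> is the matrix of \<open>J\<close>.\<close>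

definition nijenhuis ::
    "(real^'n::finite \<Rightarrow> real^'n^'n) \<Rightarrow> real^'n \<Rightarrow> 'n \<Rightarrow> 'n \<Rightarrow> 'n \<Rightarrow> real" where
  "nijenhuis F y k i j = (\<Sum>l\<in>UNIV.
     F y $ l $ i * partial l (\<lambda>z. F z $ k $ j) y - F y $ l $ j * partial l (\<lambda>z. F z $ k $ i) y
     - F y $ k $ l * (partial i (\<lambda>z. F z $ l $ j) y - partial j (\<lambda>z. F z $ l $ i) y))"

definition integrable_structure :: "('m, 'n::finite) chart set \<Rightarrow> ('m, 'n) endo_field \<Rightarrow> bool" where
  "integrable_structure \<A> J \<longleftrightarrow>
     (\<forall>\<phi>\<in>\<A>. \<forall>y\<in>snd \<phi> ` fst \<phi>. \<forall>k i j. nijenhuis (endo_coords \<A> J \<phi>) y k i j = 0)"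

text \<open>Components of the fundamental 2-form \<open>(X, Y) \<mapsto> g(X, J Y)\<close>.\<close>

definition fundamental_coords ::
    "('m, 'n::finite) chart set \<Rightarrow> ('m, 'n) metric \<Rightarrow> ('m, 'n) endo_field \<Rightarrow> ('m, 'n) chart \<Rightarrow>
     real^'n \<Rightarrow> 'n \<Rightarrow> 'n \<Rightarrow> real" where
  "fundamental_coords \<A> g J \<phi> y i j = g (chart_inv \<phi> y)
     (coord_vec \<A> \<phi> (chart_inv \<phi> y) i)
     (J (chart_inv \<phi> y) (coord_vec \<A> \<phi> (chart_inv \<phi> y) j))"

definition closed_fundamental_form ::
    "('m, 'n::finite) chart set \<Rightarrow> ('m, 'n) metric \<Rightarrow> ('m, 'n) endo_field \<Rightarrow> bool" where
  "closed_fundamental_form \<A> g J \<longleftrightarrow>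
     (\<forall>\<phi>\<in>\<A>. \<forall>y\<in>snd \<phi> ` fst \<phi>. \<forall>i j k.
        partial i (\<lambda>z. fundamental_coords \<A> g J \<phi> z j k) y
        + partial j (\<lambda>z. fundamental_coords \<A> g J \<phi> z k i) y
        + partial k (\<lambda>z. fundamental_coords \<A> g J \<phi> z i j) y = 0)"

definition kaehler_structure ::
    "('m, 'n::finite) chart set \<Rightarrow> ('m, 'n) metric \<Rightarrow> ('m, 'n) endo_field \<Rightarrow> bool" where
  "kaehler_structure \<A> g J \<longleftrightarrow>
     riemannian_metric \<A> g \<and> almost_complex \<A> J \<and>
     (\<forall>x\<in>points \<A>. \<forall>u\<in>tangent_space \<A> x. \<forall>v\<in>tangent_space \<A> x. g x (J x u) (J x v) = g x u v) \<and>
     integrable_structure \<A> J \<and> closed_fundamental_form \<A> g J"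

definition constant_holomorphic_sectional_curvature ::
    "('m, 'n::finite) chart set \<Rightarrow> ('m, 'n) metric \<Rightarrow> ('m, 'n) endo_field \<Rightarrow> bool" where
  "constant_holomorphic_sectional_curvature \<A> g J \<longleftrightarrow>
     (\<exists>k. \<forall>\<phi>\<in>\<A>. \<forall>x\<in>fst \<phi>. \<forall>u\<in>tangent_space \<A> x.
        u \<noteq> zero_vec \<longrightarrow> sectional_curvature \<A> g \<phi> x u (J x u) = k)"


section \<open>The nonzero cotangent bundle\<close>

text \<open>A point of the cotangent bundle is a pair \<open>(x, p)\<close> with \<open>p\<close> in the cotangent space at \<open>x\<close>.
  The coordinates \<open>q\<^sup>i\<close> are indexed by \<open>Inl i\<close> and the coordinates \<open>p\<^sub>i\<close> by \<open>Inr i\<close>.\<close>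

type_synonym ('m, 'n) cotangent = "'m \<times> (('m, 'n) tangent \<Rightarrow> real)"

definition fibre_coords ::
    "('m, 'n::finite) chart set \<Rightarrow> ('m, 'n) chart \<Rightarrow> ('m, 'n) cotangent \<Rightarrow> real^'n" where
  "fibre_coords \<A> \<phi> P = (\<chi> i. snd P (coord_vec \<A> \<phi> (fst P) i))"

definition cotangent0_chart ::
    "('m, 'n::finite) chart set \<Rightarrow> ('m, 'n) chart \<Rightarrow> (('m, 'n) cotangent, 'n + 'n) chart" where
  "cotangent0_chart \<A> \<phi> =
     ({(x, p). x \<in> fst \<phi> \<and> p \<in> cotangent_space \<A> x \<and> p \<noteq> (\<lambda>u. 0)},
      \<lambda>P. \<chi> s. case s of Inl i \<Rightarrow> snd \<phi> (fst P) $ i | Inr i \<Rightarrow> fibre_coords \<A> \<phi> P $ i)"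

definition cotangent0_atlas ::
    "('m, 'n::finite) chart set \<Rightarrow> (('m, 'n) cotangent, 'n + 'n) chart set" where
  "cotangent0_atlas \<A> = cotangent0_chart \<A> ` \<A>"

definition base_metric ::
    "('m, 'n::finite) chart set \<Rightarrow> ('m, 'n) metric \<Rightarrow> ('m, 'n) chart \<Rightarrow> ('m, 'n) cotangent \<Rightarrow>
     real^'n^'n" where
  "base_metric \<A> g \<phi> P = metric_coords \<A> g \<phi> (snd \<phi> (fst P))"

definition energy_density ::
    "('m, 'n::finite) chart set \<Rightarrow> ('m, 'n) metric \<Rightarrow> ('m, 'n) chart \<Rightarrow> ('m, 'n) cotangent \<Rightarrow>
     real" where
  "energy_density \<A> g \<phi> P = (1/2) * (\<Sum>i\<in>UNIV. \<Sum>j\<in>UNIV.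
     matrix_inv (base_metric \<A> g \<phi> P) $ i $ j
     * fibre_coords \<A> \<phi> P $ i * fibre_coords \<A> \<phi> P $ j)"

text \<open>\<open>\<Gamma>\<^sup>0\<^sub>i\<^sub>h = p\<^sub>k \<Gamma>\<^sup>k\<^sub>i\<^sub>h\<close>.\<close>

definition christoffel0 ::
    "('m, 'n::finite) chart set \<Rightarrow> ('m, 'n) metric \<Rightarrow> ('m, 'n) chart \<Rightarrow> ('m, 'n) cotangent \<Rightarrow>
     'n \<Rightarrow> 'n \<Rightarrow> real" where
  "christoffel0 \<A> g \<phi> P i h = (\<Sum>k\<in>UNIV. fibre_coords \<A> \<phi> P $ k *
     christoffel (metric_coords \<A> g \<phi>) (snd \<phi> (fst P)) k i h)"

text \<open>\<open>adapted_vec \<A> g \<phi> P a b\<close> is the tangent vector \<open>a\<^sup>i \<delta>/\<delta>q\<^sup>i + b\<^sub>i \<partial>/\<partial>p\<^sub>i\<close> at \<open>P\<close>.\<close>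

definition adapted_vec ::
    "('m, 'n::finite) chart set \<Rightarrow> ('m, 'n) metric \<Rightarrow> ('m, 'n) chart \<Rightarrow> ('m, 'n) cotangent \<Rightarrow>
     real^'n \<Rightarrow> real^'n \<Rightarrow> (('m, 'n) cotangent, 'n + 'n) tangent" where
  "adapted_vec \<A> g \<phi> P a b = tvec (cotangent0_atlas \<A>) (cotangent0_chart \<A> \<phi>) P
     ((\<Sum>i\<in>UNIV. a $ i *\<^sub>R
        (axis (Inl i) 1 + (\<Sum>h\<in>UNIV. christoffel0 \<A> g \<phi> P i h *\<^sub>R axis (Inr h) 1)))
      + (\<Sum>i\<in>UNIV. b $ i *\<^sub>R axis (Inr i) 1))"

definition hor_frame ::
    "('m, 'n::finite) chart set \<Rightarrow> ('m, 'n) metric \<Rightarrow> ('m, 'n) chart \<Rightarrow> ('m, 'n) cotangent \<Rightarrow>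
     'n \<Rightarrow> (('m, 'n) cotangent, 'n + 'n) tangent" where
  "hor_frame \<A> g \<phi> P i = adapted_vec \<A> g \<phi> P (axis i 1) 0"

definition ver_frame ::
    "('m, 'n::finite) chart set \<Rightarrow> ('m, 'n) metric \<Rightarrow> ('m, 'n) chart \<Rightarrow> ('m, 'n) cotangent \<Rightarrow>
     'n \<Rightarrow> (('m, 'n) cotangent, 'n + 'n) tangent" where
  "ver_frame \<A> g \<phi> P i = adapted_vec \<A> g \<phi> P 0 (axis i 1)"

text \<open>The coframe \<open>dq\<^sup>i\<close>, \<open>Dp\<^sub>i = dp\<^sub>i - \<Gamma>\<^sup>0\<^sub>i\<^sub>j dq\<^sup>j\<close>.\<close>

definition dq ::
    "('m, 'n::finite) chart set \<Rightarrow> ('m, 'n) chart \<Rightarrow> 'n \<Rightarrow>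
     (('m, 'n) cotangent, 'n + 'n) tangent \<Rightarrow> real" where
  "dq \<A> \<phi> i u = u (cotangent0_chart \<A> \<phi>) $ Inl i"

definition Dp ::
    "('m, 'n::finite) chart set \<Rightarrow> ('m, 'n) metric \<Rightarrow> ('m, 'n) chart \<Rightarrow> ('m, 'n) cotangent \<Rightarrow>
     'n \<Rightarrow> (('m, 'n) cotangent, 'n + 'n) tangent \<Rightarrow> real" where
  "Dp \<A> g \<phi> P i u = u (cotangent0_chart \<A> \<phi>) $ Inr i
     - (\<Sum>j\<in>UNIV. christoffel0 \<A> g \<phi> P i j * dq \<A> \<phi> j u)"


section \<open>Coefficients of the structure\<close>

text \<open>Here \<open>h\<close> is the matrix \<open>(g\<^sub>i\<^sub>j)\<close>, \<open>p\<close> the vector \<open>(p\<^sub>i)\<close> and \<open>l\<close> the function \<open>\<lambda>\<close>;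
  \<open>raise h p $ i\<close> is \<open>g\<^sup>0\<^sup>i\<close>.\<close>

definition raise :: "real^'n::finite^'n \<Rightarrow> real^'n \<Rightarrow> real^'n" where
  "raise h p = (\<chi> i. \<Sum>k\<in>UNIV. p $ k * matrix_inv h $ k $ i)"

definition J1_coeff ::
    "real \<Rightarrow> real \<Rightarrow> (real \<Rightarrow> real) \<Rightarrow> real \<Rightarrow> real^'n::finite^'n \<Rightarrow> real^'n \<Rightarrow> 'n \<Rightarrow> 'n \<Rightarrow> real" where
  "J1_coeff A c l t h p i j =
     A * t * l t * h $ i $ j
     + (c - A\<^sup>2 * t * l t * (l t + t * deriv l t)) / (A * t * (l t + 2 * t * deriv l t))
       * (p $ i * p $ j)"

definition J2_coeff ::
    "real \<Rightarrow> real \<Rightarrow> (real \<Rightarrow> real) \<Rightarrow> real \<Rightarrow> real^'n::finite^'n \<Rightarrow> real^'n \<Rightarrow> 'n \<Rightarrow> 'n \<Rightarrow> real" where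
  "J2_coeff A c l t h p i j =
     1 / (A * t * l t) * matrix_inv h $ i $ j
     - (c - A\<^sup>2 * t * l t * (l t + t * deriv l t)) / (A * t\<^sup>2 * l t * (2 * c - A\<^sup>2 * t * (l t)\<^sup>2))
       * (raise h p $ i * raise h p $ j)"

definition G1_coeff ::
    "real \<Rightarrow> real \<Rightarrow> (real \<Rightarrow> real) \<Rightarrow> real \<Rightarrow> real^'n::finite^'n \<Rightarrow> real^'n \<Rightarrow> 'n \<Rightarrow> 'n \<Rightarrow> real" where
  "G1_coeff A c l t h p i j =
     A * t * (l t)\<^sup>2 * h $ i $ j
     + (c - A\<^sup>2 * t * (l t)\<^sup>2) / (A * t) * (p $ i * p $ j)"

definition G2_coeff ::
    "real \<Rightarrow> real \<Rightarrow> (real \<Rightarrow> real) \<Rightarrow> real \<Rightarrow> real^'n::finite^'n \<Rightarrow> real^'n \<Rightarrow> 'n \<Rightarrow> 'n \<Rightarrow> real" where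
  "G2_coeff A c l t h p i j =
     1 / (A * t) * matrix_inv h $ i $ j
     - (c - A\<^sup>2 * t * ((l t)\<^sup>2 + 2 * t * deriv l t * (l t + t * deriv l t)))
       / (A * t\<^sup>2 * (2 * c - A\<^sup>2 * t * (l t)\<^sup>2))
       * (raise h p $ i * raise h p $ j)"

definition given_J ::
    "real \<Rightarrow> real \<Rightarrow> (real \<Rightarrow> real) \<Rightarrow> ('m, 'n::finite) chart set \<Rightarrow> ('m, 'n) metric \<Rightarrow>
     (('m, 'n) cotangent, 'n + 'n) endo_field \<Rightarrow> bool" where
  "given_J A c l \<A> g J \<longleftrightarrow>
     (\<forall>\<phi>\<in>\<A>. \<forall>P\<in>fst (cotangent0_chart \<A> \<phi>).
        let t = energy_density \<A> g \<phi> P; h = base_metric \<A> g \<phi> P; p = fibre_coords \<A> \<phi> P in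
        (\<forall>i. J P (hor_frame \<A> g \<phi> P i) =
               adapted_vec \<A> g \<phi> P 0 (\<chi> j. J1_coeff A c l t h p i j)) \<and>
        (\<forall>i. J P (ver_frame \<A> g \<phi> P i) =
               adapted_vec \<A> g \<phi> P (\<chi> j. - J2_coeff A c l t h p i j) 0))"

definition given_G ::
    "real \<Rightarrow> real \<Rightarrow> (real \<Rightarrow> real) \<Rightarrow> ('m, 'n::finite) chart set \<Rightarrow> ('m, 'n) metric \<Rightarrow>
     (('m, 'n) cotangent, 'n + 'n) metric \<Rightarrow> bool" where
  "given_G A c l \<A> g G \<longleftrightarrow>
     (\<forall>\<phi>\<in>\<A>. \<forall>P\<in>fst (cotangent0_chart \<A> \<phi>).
        let t = energy_density \<A> g \<phi> P; h = base_metric \<A> g \<phi> P; p = fibre_coords \<A> \<phi> P in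
        \<forall>u\<in>tangent_space (cotangent0_atlas \<A>) P. \<forall>v\<in>tangent_space (cotangent0_atlas \<A>) P.
          G P u v = (\<Sum>i\<in>UNIV. \<Sum>j\<in>UNIV.
              G1_coeff A c l t h p i j * dq \<A> \<phi> i u * dq \<A> \<phi> j v
            + G2_coeff A c l t h p i j * Dp \<A> g \<phi> P i u * Dp \<A> g \<phi> P j v))"

end

theory Submission
  imports Defs
begin

text \<open>Curvature is compared in two planes that contain the radial vector field
  \<open>E = p\<^sub>i \<partial>/\<partial>p\<^sub>i\<close>. Let \<open>\<eta>\<close> be a nonzero vertical vector annihilated by \<open>g\<^sup>0\<^sup>i\<close>, that is, tangent to a
  sphere in the fibre; it exists because \<open>n > 1\<close>. Then \<open>J \<eta>\<close> is the horizontal lift of a vector annihilated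
  by the covector \<open>p\<close>. The sectional curvature of the plane of \<open>E\<close> and \<open>\<eta>\<close> is 0, while that of the plane
  of \<open>E\<close> and \<open>J \<eta>\<close> is positive. On a Kaehler manifold of constant holomorphic sectional curvature the two
  would be equal.

  Why they would be equal: vanishing of the Nijenhuis tensor and of the differential of the
  fundamental form make \<open>J\<close> parallel (\<open>J_parallel\<close>), so the curvature tensor is \<open>J\<close>-invariant
  (\<open>R_J_J\<close>). Polarizing the holomorphic sectional curvature at \<open>E \<plusminus> \<eta>\<close> and at
  \<open>E \<plusminus> J \<eta>\<close>, four vectors of the same length, yields the equality
  (\<open>constant_holomorphic_curvature\<close>).

  Why the two curvatures are as stated: \<open>E\<close> is orthogonal to the level sets of the energy density
  \<open>t\<close>, and its length is a function of \<open>t\<close>; hence it is a gradient field whose integral curves are geodesics up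
  to parametrization. The covariant derivative \<open>B\<close> of such a field is half the Lie derivative of
  the metric, and the curvature operator \<open>u \<mapsto> R(u, E)E\<close> is determined by \<open>B\<close> through a Riccati equation
  (\<open>riccati\<close>). Along a ray of the fibre only \<open>t\<close> and the length of \<open>p\<close> vary, so the eigenvalues of \<open>B\<close> can be
  read off from the coefficients of \<open>G\<close>: 0 on \<open>\<eta>\<close> and \<open>(\<lambda> + 2t\<lambda>') / \<lambda>\<close> on \<open>J \<eta>\<close>. This gives the
  curvatures 0 and, up to positive factors, \<open>A\<^sup>2 t (\<lambda> + 2t\<lambda>')\<^sup>2 / (2c - A\<^sup>2 t \<lambda>\<^sup>2)\<close>
  (\<open>curvature_vertical\<close>, \<open>curvature_horizontal\<close>).

  Geometrically, with \<open>A \<sqroot>t \<lambda> = \<sqroot>(2c) sin \<theta>\<close> and up to a constant factor, \<open>G\<close> is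
  \<open>d\<theta>\<^sup>2 + cos\<^sup>2 \<theta> \<omega>\<^sub>0\<^sup>2 + sin\<^sup>2 \<theta> \<Sigma> \<omega>\<^sub>i\<^sup>2 + \<Sigma> \<eta>\<^sub>i\<^sup>2\<close> on the unit sphere bundle times an interval. This is the metric of
  the complex quadric, which is not a complex space form for \<open>n > 1\<close>.

  All computations are made in one chart of the base and the induced chart of the cotangent
  bundle. The points in between are that the induced charts have differentiable transition
  maps (\<open>cotangent0_atlas_differentiable\<close>), so that the tangent spaces are given by coordinate
  vectors, and that the metric and the complex structure are then given by matrix functions on
  an open set (\<open>local_kaehler_coords\<close>).\<close>


section \<open>Calculus on open sets\<close>

abbreviation ddir :: "('a::real_normed_vector \<Rightarrow> 'b::real_normed_vector) \<Rightarrow> 'a \<Rightarrow> 'a \<Rightarrow> 'b" where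
  "ddir f y u \<equiv> frechet_derivative f (at y) u"

lemma ddir_eqI: "(f has_derivative f') (at y) \<Longrightarrow> ddir f y u = f' u"
  by (metis frechet_derivative_at)

lemma ddir_has: "f differentiable (at y) \<Longrightarrow> (f has_derivative ddir f y) (at y)"
  by (simp add: frechet_derivative_works)

lemma differentiable_cong_open:
  assumes "open S" "y \<in> S" "\<And>x. x \<in> S \<Longrightarrow> f x = g x" "f differentiable (at y)"
  shows "g differentiable (at y)"
  using assms by (meson differentiable_def has_derivative_transform_within_open)

lemma ddir_cong_open:
  assumes "open S" "y \<in> S" "\<And>x. x \<in> S \<Longrightarrow> f x = g x" "f differentiable (at y)"
  shows "ddir f y u = ddir g y u"
  using assms by (metis frechet_derivative_transform_within_open)

text \<open>Derivatives at the points of an open set only see the function there, so the linear operations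
  on smooth functions can be handled by rewriting their derivatives.\<close>

lemma Ck_on_cong:
  assumes "open S"
  shows "Ck_on k f S \<Longrightarrow> (\<And>x. x \<in> S \<Longrightarrow> f x = g x) \<Longrightarrow> Ck_on k g S"
proof (induction k arbitrary: f g)
  case 0
  then show ?case by (simp cong: continuous_on_cong)
next
  case (Suc k)
  have d: "f differentiable at x" if "x \<in> S" for x using Suc.prems that by simp
  have "g differentiable at x" if "x \<in> S" for x
    using differentiable_cong_open[OF assms that Suc.prems(2) d[OF that]] by simp
  moreover have "Ck_on k (\<lambda>x. ddir g x v) S" for v
    by (rule Suc.IH[of "\<lambda>x. ddir f x v"])
      (use Suc.prems ddir_cong_open[OF assms _ Suc.prems(2) d] in auto)
  ultimately show ?case by simp
qed

lemma Ck_on_add: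
  assumes "open S"
  shows "Ck_on k f S \<Longrightarrow> Ck_on k g S \<Longrightarrow> Ck_on k (\<lambda>x. f x + g x) S"
proof (induction k arbitrary: f g)
  case 0
  then show ?case by (simp add: continuous_on_add)
next
  case (Suc k)
  have "Ck_on k (\<lambda>x. ddir (\<lambda>x. f x + g x) x v) S" for v
  proof (rule Ck_on_cong[OF assms])
    show "Ck_on k (\<lambda>x. ddir f x v + ddir g x v) S" using Suc by simp
    show "ddir f x v + ddir g x v = ddir (\<lambda>x. f x + g x) x v" if "x \<in> S" for x
      using Suc.prems that by (intro ddir_eqI[symmetric] has_derivative_add ddir_has) auto
  qed
  then show ?case using Suc.prems by auto
qed

lemma Ck_on_scaleR:
  assumes "open S"
  shows "Ck_on k f S \<Longrightarrow> Ck_on k (\<lambda>x. r *\<^sub>R f x) S"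
proof (induction k arbitrary: f)
  case 0
  then show ?case by (simp add: continuous_on_scaleR)
next
  case (Suc k)
  have "Ck_on k (\<lambda>x. ddir (\<lambda>x. r *\<^sub>R f x) x v) S" for v
  proof (rule Ck_on_cong[OF assms])
    show "Ck_on k (\<lambda>x. r *\<^sub>R ddir f x v) S" using Suc by simp
    show "r *\<^sub>R ddir f x v = ddir (\<lambda>x. r *\<^sub>R f x) x v" if "x \<in> S" for x
      using Suc.prems that by (intro ddir_eqI[symmetric] has_derivative_scaleR_right ddir_has) auto
  qed
  then show ?case using Suc.prems by (auto intro: differentiable_scaleR)
qed

lemma Ck_on_zero: "Ck_on k (\<lambda>x. 0) S"
  by (induction k) auto

lemma smooth_on_zero: "smooth_on S (\<lambda>x. 0)"
  by (simp add: smooth_on_def Ck_on_zero)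

lemma smooth_on_cong: "open S \<Longrightarrow> smooth_on S f \<Longrightarrow> (\<And>x. x \<in> S \<Longrightarrow> f x = g x) \<Longrightarrow> smooth_on S g"
  unfolding smooth_on_def using Ck_on_cong by blast

lemma smooth_on_scaleR: "open S \<Longrightarrow> smooth_on S f \<Longrightarrow> smooth_on S (\<lambda>x. r *\<^sub>R f x)"
  unfolding smooth_on_def using Ck_on_scaleR by blast

lemma smooth_on_sum:
  "finite I \<Longrightarrow> open S \<Longrightarrow> (\<And>i. i \<in> I \<Longrightarrow> smooth_on S (f i)) \<Longrightarrow> smooth_on S (\<lambda>x. \<Sum>i\<in>I. f i x)"
proof (induct I rule: finite_induct)
  case (insert i I)
  then show ?case using Ck_on_add[of S _ "f i" "\<lambda>x. \<Sum>i\<in>I. f i x"] by (simp add: smooth_on_def)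
qed (simp add: smooth_on_zero)

lemma smooth_on_differentiable: "smooth_on S f \<Longrightarrow> x \<in> S \<Longrightarrow> f differentiable (at x)"
  unfolding smooth_on_def by (metis Ck_on.simps(2))

lemma smooth_on_ddir: "smooth_on S f \<Longrightarrow> smooth_on S (\<lambda>x. ddir f x v)"
  unfolding smooth_on_def by (metis Ck_on.simps(2))

text \<open>The mean value theorem in the direction \<open>u\<close> turns the second difference into a difference of two
  values of the derivative along \<open>u\<close>, which the differentiability of that derivative evaluates.
  The second difference is symmetric in \<open>u\<close> and \<open>v\<close>; hence so is its limit.\<close>

lemma second_difference_limit:
  fixes f :: "'a::real_normed_vector \<Rightarrow> real"
  assumes S: "open S" "y \<in> S" and f: "\<And>x. x \<in> S \<Longrightarrow> f differentiable (at x)"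
    and du: "(\<lambda>x. ddir f x u) differentiable (at y)"
  shows "((\<lambda>s. (f (y + s *\<^sub>R u + s *\<^sub>R v) - f (y + s *\<^sub>R u) - f (y + s *\<^sub>R v) + f y) / s\<^sup>2)
            \<longlongrightarrow> ddir (\<lambda>x. ddir f x u) y v) (at_right 0)"
proof (rule tendstoI)
  fix e :: real assume e: "e > 0"
  define L where "L = ddir (\<lambda>x. ddir f x u) y"
  define N where "N = norm u + norm v"
  have N: "N \<ge> 0" by (simp add: N_def)
  \<comment> \<open>Two error terms of size \<open>e' * N\<close> have to stay below \<open>e\<close>.\<close>
  define e' where "e' = e / (2 * N + 1)"
  have e': "e' > 0" using e N by (simp add: e'_def)
  have L: "((\<lambda>x. ddir f x u) has_derivative L) (at y)"
    using ddir_has[OF du] by (simp add: L_def)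
  interpret L: bounded_linear L using L by (rule has_derivative_bounded_linear)
  obtain d where d: "d > 0"
    "\<And>x. norm (x - y) < d \<Longrightarrow> norm (ddir f x u - ddir f y u - L (x - y)) \<le> e' * norm (x - y)"
    using L e' unfolding has_derivative_at_alt by meson
  obtain r where r: "r > 0" "ball y r \<subseteq> S" using S open_contains_ball by blast
  define b where "b = min d r / (N + 1)"
  have b: "b > 0" using d r N by (simp add: b_def)
  have "dist ((f (y + s *\<^sub>R u + s *\<^sub>R v) - f (y + s *\<^sub>R u) - f (y + s *\<^sub>R v) + f y) / s\<^sup>2) (L v) < e"
    if s: "0 < s" "s < b" for s
  proof -
    have sN: "s * N < min d r"
    proof -
      have "s * N \<le> s * (N + 1)" using s by simp
      also have "\<dots> < b * (N + 1)" using s N by (intro mult_strict_right_mono) auto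
      also have "\<dots> = min d r" using N by (simp add: b_def)
      finally show ?thesis .
    qed
    have bd: "norm (a *\<^sub>R u + a' *\<^sub>R v) \<le> s * N" if "0 \<le> a" "a \<le> s" "0 \<le> a'" "a' \<le> s" for a a'
    proof -
      have "norm (a *\<^sub>R u + a' *\<^sub>R v) \<le> a * norm u + a' * norm v"
        using that by (metis abs_of_nonneg norm_scaleR norm_triangle_ineq)
      also have "\<dots> \<le> s * norm u + s * norm v" using that by (intro add_mono mult_right_mono) auto
      finally show ?thesis by (simp add: N_def algebra_simps)
    qed
    have inS: "y + a *\<^sub>R u + a' *\<^sub>R v \<in> S" if "0 \<le> a" "a \<le> s" "0 \<le> a'" "a' \<le> s" for a a'
    proof -
      have "norm (a *\<^sub>R u + a' *\<^sub>R v) < r" using bd[OF that] sN by simp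
      moreover have "y - (y + a *\<^sub>R u + a' *\<^sub>R v) = - (a *\<^sub>R u + a' *\<^sub>R v)" by simp
      ultimately have "y + a *\<^sub>R u + a' *\<^sub>R v \<in> ball y r"
        by (metis dist_norm mem_ball norm_minus_cancel)
      then show ?thesis using r by blast
    qed
    have dm: "((\<lambda>a. f (y + a *\<^sub>R u + a' *\<^sub>R v)) has_real_derivative ddir f (y + a *\<^sub>R u + a' *\<^sub>R v) u) (at a)"
      if "0 \<le> a" "a \<le> s" "0 \<le> a'" "a' \<le> s" for a a'
    proof -
      have F: "(f has_derivative ddir f (y + a *\<^sub>R u + a' *\<^sub>R v)) (at (y + a *\<^sub>R u + a' *\<^sub>R v))"
        using f inS that ddir_has by blast
      interpret F: bounded_linear "ddir f (y + a *\<^sub>R u + a' *\<^sub>R v)"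
        using F by (rule has_derivative_bounded_linear)
      have "((\<lambda>a. f (y + a *\<^sub>R u + a' *\<^sub>R v)) has_derivative
              (\<lambda>h. ddir f (y + a *\<^sub>R u + a' *\<^sub>R v) (h *\<^sub>R u))) (at a)"
        by (rule has_derivative_compose[where f="\<lambda>a. y + a *\<^sub>R u + a' *\<^sub>R v" and g=f])
          (auto intro!: derivative_eq_intros F)
      moreover have "(\<lambda>h. ddir f (y + a *\<^sub>R u + a' *\<^sub>R v) (h *\<^sub>R u)) =
          (*) (ddir f (y + a *\<^sub>R u + a' *\<^sub>R v) u)"
        by (auto simp: F.scaleR)
      ultimately show ?thesis by (simp add: has_field_derivative_def)
    qed
    define gg where "gg a = f (y + a *\<^sub>R u + s *\<^sub>R v) - f (y + a *\<^sub>R u)" for a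
    have "\<exists>\<xi>. 0 < \<xi> \<and> \<xi> < s \<and> gg s - gg 0 =
        (s - 0) * (ddir f (y + \<xi> *\<^sub>R u + s *\<^sub>R v) u - ddir f (y + \<xi> *\<^sub>R u) u)"
      unfolding gg_def using s dm[of _ s] dm[of _ 0]
      by (intro MVT2 derivative_eq_intros) auto
    then obtain \<xi> where \<xi>: "0 < \<xi>" "\<xi> < s" and
      g: "gg s - gg 0 = s * (ddir f (y + \<xi> *\<^sub>R u + s *\<^sub>R v) u - ddir f (y + \<xi> *\<^sub>R u) u)" by auto
    define P where "P = ddir f (y + \<xi> *\<^sub>R u + s *\<^sub>R v) u - ddir f y u - L (\<xi> *\<^sub>R u + s *\<^sub>R v)"
    define Q where "Q = ddir f (y + \<xi> *\<^sub>R u) u - ddir f y u - L (\<xi> *\<^sub>R u)"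
    have "\<bar>P\<bar> \<le> e' * norm (\<xi> *\<^sub>R u + s *\<^sub>R v)"
      using d(2)[of "y + \<xi> *\<^sub>R u + s *\<^sub>R v"] bd[of \<xi> s] \<xi> sN by (simp add: P_def add.assoc)
    also have "\<dots> \<le> e' * (s * N)" using bd[of \<xi> s] \<xi> e' by (intro mult_left_mono) auto
    finally have P: "\<bar>P\<bar> \<le> e' * (s * N)" .
    have "\<bar>Q\<bar> \<le> e' * norm (\<xi> *\<^sub>R u)"
      using d(2)[of "y + \<xi> *\<^sub>R u"] bd[of \<xi> 0] \<xi> sN by (simp add: Q_def)
    also have "\<dots> \<le> e' * (s * N)" using bd[of \<xi> 0] \<xi> e' by (intro mult_left_mono) auto
    finally have Q: "\<bar>Q\<bar> \<le> e' * (s * N)" .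
    have "gg s - gg 0 = s\<^sup>2 * L v + s * (P - Q)"
      by (simp add: g P_def Q_def L.add L.scaleR algebra_simps power2_eq_square)
    then have "(gg s - gg 0) / s\<^sup>2 - L v = (P - Q) / s"
      using s by (simp add: add_divide_distrib power2_eq_square)
    moreover have "f (y + s *\<^sub>R u + s *\<^sub>R v) - f (y + s *\<^sub>R u) - f (y + s *\<^sub>R v) + f y = gg s - gg 0"
      by (simp add: gg_def)
    moreover have "\<bar>(P - Q) / s\<bar> \<le> 2 * (e' * N)"
      using P Q s by (simp add: field_simps)
    moreover have "2 * (e' * N) < e"
      using e N by (simp add: e'_def field_simps)
    ultimately show ?thesis by (simp add: dist_real_def)
  qed
  then show "\<forall>\<^sub>F s in at_right 0. dist ((f (y + s *\<^sub>R u + s *\<^sub>R v) - f (y + s *\<^sub>R u)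
      - f (y + s *\<^sub>R v) + f y) / s\<^sup>2) (ddir (\<lambda>x. ddir f x u) y v) < e"
    unfolding L_def[symmetric] eventually_at_right_field using b by (intro exI[of _ b]) auto
qed

lemma ddir_commute:
  fixes f :: "'a::real_normed_vector \<Rightarrow> real"
  assumes "open S" "y \<in> S" "\<And>x. x \<in> S \<Longrightarrow> f differentiable (at x)"
    and "(\<lambda>x. ddir f x u) differentiable (at y)" "(\<lambda>x. ddir f x v) differentiable (at y)"
  shows "ddir (\<lambda>x. ddir f x u) y v = ddir (\<lambda>x. ddir f x v) y u"
proof (rule tendsto_unique)
  show "((\<lambda>s. (f (y + s *\<^sub>R u + s *\<^sub>R v) - f (y + s *\<^sub>R u) - f (y + s *\<^sub>R v) + f y) / s\<^sup>2)
            \<longlongrightarrow> ddir (\<lambda>x. ddir f x u) y v) (at_right 0)"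
    by (rule second_difference_limit[OF assms(1-4)])
  have "y + s *\<^sub>R v + s *\<^sub>R u = y + s *\<^sub>R u + s *\<^sub>R v" for s by simp
  with second_difference_limit[OF assms(1-3,5), of u]
  show "((\<lambda>s. (f (y + s *\<^sub>R u + s *\<^sub>R v) - f (y + s *\<^sub>R u) - f (y + s *\<^sub>R v) + f y) / s\<^sup>2)
            \<longlongrightarrow> ddir (\<lambda>x. ddir f x v) y u) (at_right 0)"
    by (simp add: algebra_simps)
qed simp

lemma differentiable_prod:
  fixes f :: "'i \<Rightarrow> 'a::real_normed_vector \<Rightarrow> real"
  shows "finite I \<Longrightarrow> (\<And>i. i \<in> I \<Longrightarrow> f i differentiable (at y)) \<Longrightarrow> (\<lambda>x. \<Prod>i\<in>I. f i x) differentiable (at y)"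
  by (induction I rule: finite_induct) auto

lemma differentiable_det:
  fixes M :: "'a::real_normed_vector \<Rightarrow> real^'n^'n"
  assumes "\<And>i j. (\<lambda>x. M x $ i $ j) differentiable (at y)"
  shows "(\<lambda>x. det (M x)) differentiable (at y)"
  unfolding det_def using assms
  by (intro differentiable_sum ballI differentiable_mult differentiable_prod differentiable_const) auto

lemma differentiable_vec:
  fixes f :: "'a::real_normed_vector \<Rightarrow> real^'k"
  assumes "\<And>i. (\<lambda>x. f x $ i) differentiable (at y)"
  shows "f differentiable (at y)"
proof -
  have "(\<lambda>x. \<Sum>i\<in>UNIV. (f x $ i) *\<^sub>R axis i (1::real)) differentiable (at y)"
    using assms by (intro differentiable_sum ballI differentiable_scaleR differentiable_const) auto
  moreover have "(\<Sum>i\<in>UNIV. (f x $ i) *\<^sub>R axis i (1::real)) = f x" for x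
    by (simp add: vec_eq_iff axis_def if_distrib cong: if_cong)
  ultimately show ?thesis by simp
qed

lemma differentiable_nth:
  fixes f :: "'a::real_normed_vector \<Rightarrow> real^'k"
  assumes "f differentiable (at y)"
  shows "(\<lambda>x. f x $ i) differentiable (at y)"
  using ddir_has[OF assms] bounded_linear.has_derivative[OF bounded_linear_vec_nth]
  by (metis differentiableI)

lemma ddir_nth:
  fixes f :: "'a::real_normed_vector \<Rightarrow> real^'k"
  assumes "f differentiable (at y)"
  shows "ddir f y u $ i = ddir (\<lambda>x. f x $ i) y u"
  using ddir_has[OF assms] bounded_linear.has_derivative[OF bounded_linear_vec_nth]
  by (metis ddir_eqI)

lemma matrix_inv_mult:
  fixes M :: "real^'n^'n"
  assumes "invertible M"
  shows "M ** matrix_inv M = mat 1" "matrix_inv M ** M = mat 1"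
  using assms someI_ex[of "\<lambda>N. M ** N = mat 1 \<and> N ** M = mat 1"]
  unfolding matrix_inv_def invertible_def by auto

text \<open>Cramer's rule presents the inverse as a quotient of determinants, which are polynomials in the
  entries; this is how the differentiability of the Christoffel symbols is obtained.\<close>

lemma matrix_inv_cramer:
  fixes M :: "real^'n^'n"
  assumes "invertible M"
  shows "matrix_inv M $ i $ j = det (\<chi> r s. if s = i then axis j 1 $ r else M $ r $ s) / det M"
proof -
  have "M *v (matrix_inv M *v axis j 1) = axis j 1"
    using matrix_inv_mult[OF assms] by (simp add: matrix_vector_mul_assoc)
  then have "matrix_inv M *v axis j 1 = (\<chi> k. det (\<chi> r s. if s = k then axis j 1 $ r else M $ r $ s) / det M)"
    using cramer[of M "matrix_inv M *v axis j 1" "axis j 1"] assms invertible_det_nz by blast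
  moreover have "(matrix_inv M *v axis j 1) $ i = matrix_inv M $ i $ j"
    by (simp add: matrix_vector_mult_basis column_def)
  ultimately show ?thesis by simp
qed

lemma differentiable_matrix_inv:
  fixes M :: "'a::real_normed_vector \<Rightarrow> real^'n^'n"
  assumes "open V" "y \<in> V" "\<And>x. x \<in> V \<Longrightarrow> invertible (M x)"
    and "\<And>i j. (\<lambda>x. M x $ i $ j) differentiable (at y)"
  shows "(\<lambda>x. matrix_inv (M x) $ i $ j) differentiable (at y)"
proof (rule differentiable_cong_open[OF assms(1,2)])
  show "(\<lambda>x. det (\<chi> r s. if s = i then axis j 1 $ r else M x $ r $ s) / det (M x)) differentiable (at y)"
  proof (intro differentiable_divide differentiable_det assms(4))
    show "det (M y) \<noteq> 0" using assms(2,3) invertible_det_nz by blast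
    show "(\<lambda>x. (\<chi> r s. if s = i then axis j 1 $ r else M x $ r $ s) $ r $ s) differentiable at y" for r s
      using assms(4)[of r s] by (cases "s = i") auto
  qed
qed (simp add: matrix_inv_cramer assms)

text \<open>The product rule behind all the covariant derivatives below: the metric, the Christoffel symbols
  and the complex structure are families of linear maps, applied to moving vectors.\<close>

lemma has_derivative_linear_family:
  fixes B :: "'a::real_normed_vector \<Rightarrow> real^'k \<Rightarrow> 'b::real_normed_vector"
  assumes V: "open V" "y \<in> V" and lin: "\<And>z. z \<in> V \<Longrightarrow> linear (B z)"
    and B: "\<And>v. (\<lambda>z. B z v) differentiable (at y)" and f: "f differentiable (at y)"
  shows "((\<lambda>z. B z (f z)) has_derivative (\<lambda>w. ddir (\<lambda>z. B z (f y)) y w + B y (ddir f y w))) (at y)"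
proof -
  have ex: "B z x = (\<Sum>i\<in>UNIV. (x $ i) *\<^sub>R B z (axis i 1))" if "z \<in> V" for z x
  proof -
    have "x = (\<Sum>i\<in>UNIV. (x $ i) *\<^sub>R axis i 1)"
      by (simp add: vec_eq_iff axis_def if_distrib cong: if_cong)
    then show ?thesis by (metis (no_types, lifting) lin[OF that] linear_sum linear_cmul sum.cong)
  qed
  have d: "((\<lambda>z. \<Sum>i\<in>UNIV. (f z $ i) *\<^sub>R B z (axis i 1)) has_derivative
      (\<lambda>w. \<Sum>i\<in>UNIV. (f y $ i) *\<^sub>R ddir (\<lambda>z. B z (axis i 1)) y w + (ddir f y w $ i) *\<^sub>R B y (axis i 1))) (at y)"
    by (intro has_derivative_sum has_derivative_scaleR ddir_has[OF B]
        bounded_linear.has_derivative[OF bounded_linear_vec_nth] ddir_has[OF f])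
  have e: "ddir (\<lambda>z. B z x) y w = (\<Sum>i\<in>UNIV. (x $ i) *\<^sub>R ddir (\<lambda>z. B z (axis i 1)) y w)" for x w
  proof -
    have "((\<lambda>z. \<Sum>i\<in>UNIV. (x $ i) *\<^sub>R B z (axis i 1)) has_derivative
      (\<lambda>w. \<Sum>i\<in>UNIV. (x $ i) *\<^sub>R ddir (\<lambda>z. B z (axis i 1)) y w)) (at y)"
      by (intro has_derivative_sum has_derivative_scaleR_right ddir_has[OF B])
    then have "((\<lambda>z. B z x) has_derivative
      (\<lambda>w. \<Sum>i\<in>UNIV. (x $ i) *\<^sub>R ddir (\<lambda>z. B z (axis i 1)) y w)) (at y)"
      by (rule has_derivative_transform_within_open[OF _ V]) (simp add: ex[symmetric])
    then show ?thesis by (rule ddir_eqI)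
  qed
  have "((\<lambda>z. B z (f z)) has_derivative
      (\<lambda>w. \<Sum>i\<in>UNIV. (f y $ i) *\<^sub>R ddir (\<lambda>z. B z (axis i 1)) y w + (ddir f y w $ i) *\<^sub>R B y (axis i 1))) (at y)"
    by (rule has_derivative_transform_within_open[OF d V]) (simp add: ex[symmetric])
  moreover have "(\<Sum>i\<in>UNIV. (f y $ i) *\<^sub>R ddir (\<lambda>z. B z (axis i 1)) y w + (ddir f y w $ i) *\<^sub>R B y (axis i 1))
     = ddir (\<lambda>z. B z (f y)) y w + B y (ddir f y w)" for w
    by (simp add: sum.distrib e[of "f y"] ex[OF V(2), of "ddir f y w"])
  ultimately show ?thesis by simp
qed


section \<open>Riemannian metrics on open subsets of Euclidean space\<close>

lemma vec_expand: "(x::real^'k) = (\<Sum>i\<in>UNIV. (x $ i) *\<^sub>R axis i 1)"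
  by (simp add: vec_eq_iff axis_def if_distrib cong: if_cong)

lemma linear_expand:
  fixes f :: "real^'k \<Rightarrow> 'b::real_vector"
  assumes "linear f"
  shows "f x = (\<Sum>i\<in>UNIV. (x $ i) *\<^sub>R f (axis i 1))"
  by (subst vec_expand) (simp add: linear_sum[OF assms] linear_cmul[OF assms])

lemma ddir_linear: "f differentiable (at y) \<Longrightarrow> linear (ddir f y)"
  by (rule linear_frechet_derivative)

lemma sum_swap_eq:
  assumes "\<And>i j. f i j = g j i"
  shows "(\<Sum>i\<in>A. \<Sum>j\<in>B. f i j) = (\<Sum>j\<in>B. \<Sum>i\<in>A. g j i)"
  unfolding assms by (rule sum.swap)

lemma sum_rotate: "(\<Sum>j\<in>A. \<Sum>k\<in>B. \<Sum>m\<in>C. f j k m) = (\<Sum>m\<in>C. \<Sum>j\<in>A. \<Sum>k\<in>B. f j k m)"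
proof -
  have "(\<Sum>j\<in>A. \<Sum>k\<in>B. \<Sum>m\<in>C. f j k m) = (\<Sum>j\<in>A. \<Sum>m\<in>C. \<Sum>k\<in>B. f j k m)"
    by (intro sum.cong refl sum.swap)
  also have "\<dots> = (\<Sum>m\<in>C. \<Sum>j\<in>A. \<Sum>k\<in>B. f j k m)" by (rule sum.swap)
  finally show ?thesis .
qed

text \<open>Tangent vectors are treated as coordinate vectors and the Christoffel symbols as a bilinear map
  \<open>\<Gamma> y\<close>, so that identities can be proved without indices. Indices only occur in the lemmas that
  connect this calculus with the coordinate definitions of the Levi-Civita connection and of the
  curvature.\<close>

locale local_metric =
  fixes V :: "(real^'k) set" and h :: "real^'k \<Rightarrow> real^'k^'k"
  assumes open_V: "open V"
    and smooth_h: "\<And>i j. smooth_on V (\<lambda>y. h y $ i $ j)"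
    and sym_h: "\<And>y i j. y \<in> V \<Longrightarrow> h y $ i $ j = h y $ j $ i"
    and pos_h: "\<And>y u. y \<in> V \<Longrightarrow> u \<noteq> 0 \<Longrightarrow> u \<bullet> (h y *v u) > 0"
begin

definition H :: "real^'k \<Rightarrow> real^'k \<Rightarrow> real^'k \<Rightarrow> real" where
  "H y u v = u \<bullet> (h y *v v)"

lemma H_sum: "H y u v = (\<Sum>i\<in>UNIV. \<Sum>j\<in>UNIV. (u $ i * v $ j) * h y $ i $ j)"
  by (simp add: H_def inner_vec_def matrix_vector_mult_def sum_distrib_left mult_ac)

lemma H_add_l [simp]: "H y (u + u') v = H y u v + H y u' v"
  and H_add_r [simp]: "H y u (v + v') = H y u v + H y u v'"
  and H_diff_l [simp]: "H y (u - u') v = H y u v - H y u' v"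
  and H_diff_r [simp]: "H y u (v - v') = H y u v - H y u v'"
  and H_scaleR_l [simp]: "H y (a *\<^sub>R u) v = a * H y u v"
  and H_scaleR_r [simp]: "H y u (a *\<^sub>R v) = a * H y u v"
  and H_minus_l [simp]: "H y (- u) v = - H y u v"
  and H_minus_r [simp]: "H y u (- v) = - H y u v"
  and H_zero_l [simp]: "H y 0 v = 0"
  and H_zero_r [simp]: "H y u 0 = 0"
  using matrix_vector_mult_diff_distrib[of "h y" 0 v]
  by (simp_all add: H_def inner_simps matrix_vector_right_distrib matrix_vector_mult_diff_distrib
      matrix_vector_mult_scaleR)

lemma linear_H_r: "linear (H y u)" and linear_H_l: "linear (\<lambda>u. H y u v)"
  by (auto intro!: linearI)

lemma H_sym: "y \<in> V \<Longrightarrow> H y u v = H y v u"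
  unfolding H_sum by (rule sum_swap_eq) (simp add: sym_h mult_ac)

lemma H_pos: "y \<in> V \<Longrightarrow> u \<noteq> 0 \<Longrightarrow> H y u u > 0"
  by (simp add: H_def pos_h)

lemma H_eqI:
  assumes "y \<in> V" "\<And>w. H y u w = H y v w"
  shows "u = v"
proof (rule ccontr)
  assume "u \<noteq> v"
  then have "H y (u - v) (u - v) > 0" using H_pos[OF assms(1), of "u - v"] by simp
  then show False using assms(2) by (metis H_diff_l diff_self less_irrefl)
qed

lemma invertible_h:
  assumes "y \<in> V" shows "invertible (h y)"
proof -
  have "h y *v u = h y *v v \<Longrightarrow> u = v" for u v
    using H_eqI[OF assms, of u v] H_sym[OF assms] by (simp add: H_def)
  then have "inj ((*v) (h y))" by (auto simp: inj_def)
  then show ?thesis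
    using invertible_left_inverse matrix_left_invertible_injective by blast
qed

lemma smooth_H: "smooth_on V (\<lambda>y. H y u v)"
proof -
  have "smooth_on V (\<lambda>y. \<Sum>i\<in>UNIV. \<Sum>j\<in>UNIV. (u $ i * v $ j) *\<^sub>R h y $ i $ j)"
    by (intro smooth_on_sum smooth_on_scaleR smooth_h open_V) auto
  then show ?thesis by (simp add: H_sum[abs_def])
qed

definition dH :: "real^'k \<Rightarrow> real^'k \<Rightarrow> real^'k \<Rightarrow> real^'k \<Rightarrow> real" where
  "dH y a v w = ddir (\<lambda>z. H z v w) y a"

lemma dH_expand:
  assumes "y \<in> V"
  shows "dH y a v w = (\<Sum>i\<in>UNIV. \<Sum>j\<in>UNIV. \<Sum>k\<in>UNIV. a $ i * v $ j * w $ k * partial i (\<lambda>z. h z $ j $ k) y)"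
proof -
  have d: "(\<lambda>z. h z $ j $ k) differentiable (at y)" for j k
    using smooth_h assms by (rule smooth_on_differentiable)
  have "((\<lambda>z. \<Sum>j\<in>UNIV. \<Sum>k\<in>UNIV. (v $ j * w $ k) * h z $ j $ k) has_derivative
      (\<lambda>a. \<Sum>j\<in>UNIV. \<Sum>k\<in>UNIV. (v $ j * w $ k) * ddir (\<lambda>z. h z $ j $ k) y a)) (at y)"
    by (intro has_derivative_sum has_derivative_mult_right ddir_has d)
  then have "dH y a v w = (\<Sum>j\<in>UNIV. \<Sum>k\<in>UNIV. (v $ j * w $ k) * ddir (\<lambda>z. h z $ j $ k) y a)"
    unfolding dH_def H_sum[abs_def] by (rule ddir_eqI)
  also have "\<dots> = (\<Sum>j\<in>UNIV. \<Sum>k\<in>UNIV. \<Sum>i\<in>UNIV. a $ i * v $ j * w $ k * partial i (\<lambda>z. h z $ j $ k) y)"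
    by (subst linear_expand[OF ddir_linear[OF d]])
      (simp add: partial_def sum_distrib_left mult_ac)
  finally show ?thesis by (subst sum_rotate[symmetric]) 
qed

lemma dH_sym: assumes "y \<in> V" shows "dH y a v w = dH y a w v"
  unfolding dH_def
  by (rule ddir_cong_open[OF open_V assms H_sym smooth_on_differentiable[OF smooth_H assms]])

lemma linear_dH:
  assumes "y \<in> V"
  shows "linear (\<lambda>a. dH y a v w)" "linear (\<lambda>v. dH y a v w)" "linear (\<lambda>w. dH y a v w)"
  unfolding dH_expand[OF assms]
  by (auto intro!: linearI simp: algebra_simps sum.distrib sum_distrib_left)

definition \<Gamma> :: "real^'k \<Rightarrow> real^'k \<Rightarrow> real^'k \<Rightarrow> real^'k" where
  "\<Gamma> y u v = (\<chi> k. \<Sum>i\<in>UNIV. \<Sum>j\<in>UNIV. (u $ i * v $ j) * christoffel h y k i j)"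

lemma linear_\<Gamma>_r: "linear (\<Gamma> y u)" and linear_\<Gamma>_l: "linear (\<lambda>u. \<Gamma> y u v)"
  by (auto intro!: linearI simp: \<Gamma>_def vec_eq_iff algebra_simps sum.distrib sum_distrib_left)

lemmas \<Gamma>_simps [simp] =
  linear_add[OF linear_\<Gamma>_r] linear_add[OF linear_\<Gamma>_l]
  linear_diff[OF linear_\<Gamma>_r] linear_diff[OF linear_\<Gamma>_l]
  linear_neg[OF linear_\<Gamma>_r] linear_neg[OF linear_\<Gamma>_l]
  linear_cmul[OF linear_\<Gamma>_r] linear_cmul[OF linear_\<Gamma>_l]
  linear_0[OF linear_\<Gamma>_r] linear_0[OF linear_\<Gamma>_l]

text \<open>The Koszul formula for coordinate fields. Together with nondegeneracy it gives the symmetry of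
  \<open>\<Gamma>\<close> and, with the roles of the arguments permuted, the compatibility with the metric.\<close>

lemma koszul:
  assumes y: "y \<in> V"
  shows "2 * H y (\<Gamma> y u v) w = dH y u v w + dH y v u w - dH y w u v"
proof -
  define C where "C w = dH y u v w + dH y v u w - dH y w u v" for w
  have linC: "linear C"
    unfolding C_def by (intro linear_compose_add linear_compose_sub linear_dH[OF y])
  have P: "C (axis l 1) = (\<Sum>i\<in>UNIV. \<Sum>j\<in>UNIV. (u $ i * v $ j) *
     (partial i (\<lambda>z. h z $ j $ l) y + partial j (\<lambda>z. h z $ i $ l) y - partial l (\<lambda>z. h z $ i $ j) y))" for l
  proof -
    have 1: "dH y u v (axis l 1) = (\<Sum>i\<in>UNIV. \<Sum>j\<in>UNIV. (u $ i * v $ j) * partial i (\<lambda>z. h z $ j $ l) y)"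
      for u v
      unfolding dH_expand[OF y] by (simp add: axis_def if_distrib if_distribR cong: if_cong)
    have 2: "dH y v u (axis l 1) = (\<Sum>i\<in>UNIV. \<Sum>j\<in>UNIV. (u $ i * v $ j) * partial j (\<lambda>z. h z $ i $ l) y)"
      unfolding 1 by (rule sum_swap_eq) (simp add: mult_ac)
    have 3: "dH y (axis l 1) u v = (\<Sum>i\<in>UNIV. \<Sum>j\<in>UNIV. (u $ i * v $ j) * partial l (\<lambda>z. h z $ i $ j) y)"
      unfolding dH_expand[OF y]
      by (subst sum_rotate[symmetric]) (simp add: axis_def if_distrib if_distribR cong: if_cong)
    show ?thesis
      unfolding C_def 1[of u v] 2 3 by (simp add: algebra_simps sum.distrib sum_subtractf)
  qed
  have G: "\<Gamma> y u v $ k = (1/2) * (\<Sum>l\<in>UNIV. matrix_inv (h y) $ k $ l * C (axis l 1))" for k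
  proof -
    have "\<Gamma> y u v $ k = (\<Sum>i\<in>UNIV. \<Sum>j\<in>UNIV. \<Sum>l\<in>UNIV. (1/2) * (matrix_inv (h y) $ k $ l * ((u $ i * v $ j) *
        (partial i (\<lambda>z. h z $ j $ l) y + partial j (\<lambda>z. h z $ i $ l) y - partial l (\<lambda>z. h z $ i $ j) y))))"
      unfolding \<Gamma>_def christoffel_def sum_distrib_left vec_lambda_beta
      by (intro sum.cong refl) (simp only: mult_ac)
    also have "\<dots> = (\<Sum>l\<in>UNIV. \<Sum>i\<in>UNIV. \<Sum>j\<in>UNIV. (1/2) * (matrix_inv (h y) $ k $ l * ((u $ i * v $ j) *
        (partial i (\<lambda>z. h z $ j $ l) y + partial j (\<lambda>z. h z $ i $ l) y - partial l (\<lambda>z. h z $ i $ j) y))))"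
      by (rule sum_rotate)
    finally show ?thesis unfolding P sum_distrib_left .
  qed
  have G: "\<Gamma> y u v = (1/2) *\<^sub>R (matrix_inv (h y) *v (\<chi> l. C (axis l 1)))"
    unfolding vec_eq_iff G by (simp add: matrix_vector_mult_def)
  have "h y *v \<Gamma> y u v = (1/2) *\<^sub>R (\<chi> l. C (axis l 1))"
    unfolding G
    by (simp add: matrix_vector_mult_scaleR matrix_vector_mul_assoc matrix_inv_mult[OF invertible_h[OF y]])
  then have "2 * H y w (\<Gamma> y u v) = C w"
    by (subst linear_expand[OF linC]) (simp add: H_def inner_vec_def sum_distrib_left)
  then show ?thesis by (simp add: C_def H_sym[OF y])
qed

lemma \<Gamma>_sym: assumes y: "y \<in> V" shows "\<Gamma> y u v = \<Gamma> y v u"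
proof (rule H_eqI[OF y])
  fix w show "H y (\<Gamma> y u v) w = H y (\<Gamma> y v u) w"
    using koszul[OF y, of u v w] koszul[OF y, of v u w] dH_sym[OF y, of w u v] by simp
qed

lemma metric_compat: assumes y: "y \<in> V"
  shows "dH y a v w = H y (\<Gamma> y a v) w + H y v (\<Gamma> y a w)"
  using koszul[OF y, of a v w] koszul[OF y, of a w v] dH_sym[OF y] H_sym[OF y, of v]
  by (smt (verit))

lemma differentiable_H: "y \<in> V \<Longrightarrow> (\<lambda>z. H z u v) differentiable (at y)"
  using smooth_H by (rule smooth_on_differentiable)

lemma differentiable_christoffel:
  assumes y: "y \<in> V" shows "(\<lambda>z. christoffel h z k i j) differentiable (at y)"
  unfolding christoffel_def partial_def
  by (intro differentiable_sum ballI differentiable_mult differentiable_add differentiable_diff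
      differentiable_const differentiable_matrix_inv[OF open_V y invertible_h]
      smooth_on_differentiable[OF smooth_h y] smooth_on_differentiable[OF smooth_on_ddir[OF smooth_h] y]) auto

lemma differentiable_\<Gamma>: assumes y: "y \<in> V" shows "(\<lambda>z. \<Gamma> z u v) differentiable (at y)"
proof (rule differentiable_vec)
  show "(\<lambda>z. \<Gamma> z u v $ k) differentiable (at y)" for k
    unfolding \<Gamma>_def using differentiable_christoffel[OF y] by simp
qed

definition D\<Gamma> :: "real^'k \<Rightarrow> real^'k \<Rightarrow> real^'k \<Rightarrow> real^'k \<Rightarrow> real^'k" where
  "D\<Gamma> y a u v = ddir (\<lambda>z. \<Gamma> z u v) y a"

definition R :: "real^'k \<Rightarrow> real^'k \<Rightarrow> real^'k \<Rightarrow> real^'k \<Rightarrow> real^'k" where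
  "R y u v w = D\<Gamma> y u v w - D\<Gamma> y v u w + \<Gamma> y u (\<Gamma> y v w) - \<Gamma> y v (\<Gamma> y u w)"

lemma D\<Gamma>_sym: assumes "y \<in> V" shows "D\<Gamma> y a u v = D\<Gamma> y a v u"
  unfolding D\<Gamma>_def by (rule ddir_cong_open[OF open_V assms \<Gamma>_sym differentiable_\<Gamma>[OF assms]])

lemma D\<Gamma>_expand:
  assumes y: "y \<in> V"
  shows "D\<Gamma> y u v w $ l = (\<Sum>i\<in>UNIV. \<Sum>j\<in>UNIV. \<Sum>k\<in>UNIV.
     partial i (\<lambda>z. christoffel h z l j k) y * u $ i * v $ j * w $ k)"
proof -
  note d = differentiable_christoffel[OF y]
  have "((\<lambda>z. \<Sum>j\<in>UNIV. \<Sum>k\<in>UNIV. (v $ j * w $ k) * christoffel h z l j k) has_derivative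
      (\<lambda>a. \<Sum>j\<in>UNIV. \<Sum>k\<in>UNIV. (v $ j * w $ k) * ddir (\<lambda>z. christoffel h z l j k) y a)) (at y)"
    by (intro has_derivative_sum has_derivative_mult_right ddir_has d)
  then have "D\<Gamma> y u v w $ l = (\<Sum>j\<in>UNIV. \<Sum>k\<in>UNIV. (v $ j * w $ k) * ddir (\<lambda>z. christoffel h z l j k) y u)"
    unfolding D\<Gamma>_def ddir_nth[OF differentiable_\<Gamma>[OF y]] unfolding \<Gamma>_def vec_lambda_beta
    by (rule ddir_eqI)
  also have "\<dots> = (\<Sum>j\<in>UNIV. \<Sum>k\<in>UNIV. \<Sum>i\<in>UNIV. partial i (\<lambda>z. christoffel h z l j k) y * u $ i * v $ j * w $ k)"
    by (subst linear_expand[OF ddir_linear[OF d]])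
      (simp add: partial_def sum_distrib_left mult_ac)
  finally show ?thesis by (subst sum_rotate[symmetric])
qed

lemma \<Gamma>\<Gamma>_expand:
  "\<Gamma> y u (\<Gamma> y v w) $ l = (\<Sum>i\<in>UNIV. \<Sum>j\<in>UNIV. \<Sum>k\<in>UNIV.
     (\<Sum>m\<in>UNIV. christoffel h y l i m * christoffel h y m j k) * u $ i * v $ j * w $ k)"
proof -
  have "(\<Sum>j\<in>UNIV. \<Sum>k\<in>UNIV. (\<Sum>m\<in>UNIV. christoffel h y l i m * christoffel h y m j k) * u $ i * v $ j * w $ k)
     = (\<Sum>m\<in>UNIV. \<Sum>j\<in>UNIV. \<Sum>k\<in>UNIV. christoffel h y l i m * christoffel h y m j k * u $ i * v $ j * w $ k)"
    for i unfolding sum_distrib_right by (rule sum_rotate)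
  then show ?thesis
    unfolding \<Gamma>_def by (simp add: sum_distrib_left sum_distrib_right mult_ac)
qed

lemma R_expand:
  assumes y: "y \<in> V"
  shows "R y u v w $ l = (\<Sum>i\<in>UNIV. \<Sum>j\<in>UNIV. \<Sum>k\<in>UNIV. riemann h y l k i j * u $ i * v $ j * w $ k)"
proof -
  have a: "D\<Gamma> y v u w $ l = (\<Sum>i\<in>UNIV. \<Sum>j\<in>UNIV. \<Sum>k\<in>UNIV.
     partial j (\<lambda>z. christoffel h z l i k) y * u $ i * v $ j * w $ k)"
    unfolding D\<Gamma>_expand[OF y] by (rule sum_swap_eq) (simp add: mult_ac)
  have b: "\<Gamma> y v (\<Gamma> y u w) $ l = (\<Sum>i\<in>UNIV. \<Sum>j\<in>UNIV. \<Sum>k\<in>UNIV.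
     (\<Sum>m\<in>UNIV. christoffel h y l j m * christoffel h y m i k) * u $ i * v $ j * w $ k)"
    unfolding \<Gamma>\<Gamma>_expand by (rule sum_swap_eq) (simp add: mult_ac)
  show ?thesis
    unfolding R_def riemann_def vector_add_component vector_minus_component a b
      D\<Gamma>_expand[OF y, of u v w] \<Gamma>\<Gamma>_expand[of y u v w]
      sum.distrib[symmetric] sum_subtractf[symmetric]
    by (intro sum.cong refl) (simp add: algebra_simps sum_subtractf)
qed

lemma riemann_form_H:
  assumes y: "y \<in> V"
  shows "riemann_form h y u v w z = H y (R y u v w) z"
proof -
  have "H y (R y u v w) z = (\<Sum>l\<in>UNIV. \<Sum>m\<in>UNIV. \<Sum>i\<in>UNIV. \<Sum>j\<in>UNIV. \<Sum>k\<in>UNIV.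
     h y $ l $ m * riemann h y l k i j * u $ i * v $ j * w $ k * z $ m)"
    unfolding H_sum R_expand[OF y] by (simp add: sum_distrib_left sum_distrib_right mult_ac)
  also have "\<dots> = (\<Sum>l\<in>UNIV. \<Sum>i\<in>UNIV. \<Sum>j\<in>UNIV. \<Sum>k\<in>UNIV. \<Sum>m\<in>UNIV.
     h y $ l $ m * riemann h y l k i j * u $ i * v $ j * w $ k * z $ m)"
  proof (rule sum.cong[OF refl])
    fix l
    let ?f = "\<lambda>i j k m. h y $ l $ m * riemann h y l k i j * u $ i * v $ j * w $ k * z $ m"
    have "(\<Sum>m\<in>UNIV. \<Sum>i\<in>UNIV. \<Sum>j\<in>UNIV. \<Sum>k\<in>UNIV. ?f i j k m)
        = (\<Sum>i\<in>UNIV. \<Sum>m\<in>UNIV. \<Sum>j\<in>UNIV. \<Sum>k\<in>UNIV. ?f i j k m)" by (rule sum.swap)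
    also have "\<dots> = (\<Sum>i\<in>UNIV. \<Sum>j\<in>UNIV. \<Sum>k\<in>UNIV. \<Sum>m\<in>UNIV. ?f i j k m)"
      by (intro sum.cong refl sum_rotate[symmetric])
    finally show "(\<Sum>m\<in>UNIV. \<Sum>i\<in>UNIV. \<Sum>j\<in>UNIV. \<Sum>k\<in>UNIV. ?f i j k m) =
      (\<Sum>i\<in>UNIV. \<Sum>j\<in>UNIV. \<Sum>k\<in>UNIV. \<Sum>m\<in>UNIV. ?f i j k m)" .
  qed
  also have "\<dots> = riemann_form h y u v w z"
  proof -
    let ?g = "\<lambda>i j k l. \<Sum>m\<in>UNIV. h y $ l $ m * riemann h y l k i j * u $ i * v $ j * w $ k * z $ m"
    have "(\<Sum>l\<in>UNIV. \<Sum>i\<in>UNIV. \<Sum>j\<in>UNIV. \<Sum>k\<in>UNIV. ?g i j k l)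
       = (\<Sum>i\<in>UNIV. \<Sum>l\<in>UNIV. \<Sum>j\<in>UNIV. \<Sum>k\<in>UNIV. ?g i j k l)" by (rule sum.swap)
    also have "\<dots> = (\<Sum>i\<in>UNIV. \<Sum>j\<in>UNIV. \<Sum>k\<in>UNIV. \<Sum>l\<in>UNIV. ?g i j k l)"
      by (intro sum.cong refl sum_rotate[symmetric])
    finally show ?thesis by (simp add: riemann_form_def)
  qed
  finally show ?thesis by simp
qed

lemma R_antisym: "R y u v w = - R y v u w"
  by (simp add: R_def)

lemma bianchi: assumes y: "y \<in> V" shows "R y u v w + R y v w u + R y w u v = 0"
  using \<Gamma>_sym[OF y] D\<Gamma>_sym[OF y] by (simp add: R_def)

lemma linear_R: assumes y: "y \<in> V"
  shows "linear (\<lambda>u. R y u v w)" "linear (\<lambda>v. R y u v w)" "linear (R y u v)"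
  by (auto intro!: linearI simp: vec_eq_iff R_expand[OF y] algebra_simps sum.distrib sum_distrib_left)

lemma has_derivative_H_l:
  assumes y: "y \<in> V" and f: "f differentiable (at y)"
  shows "((\<lambda>z. H z (f z) w) has_derivative (\<lambda>a. dH y a (f y) w + H y (ddir f y a) w)) (at y)"
  unfolding dH_def
  by (rule has_derivative_linear_family[OF open_V y linear_H_l differentiable_H[OF y] f])

lemma has_derivative_H_r:
  assumes y: "y \<in> V" and f: "f differentiable (at y)"
  shows "((\<lambda>z. H z v (f z)) has_derivative (\<lambda>a. dH y a v (f y) + H y v (ddir f y a))) (at y)"
  unfolding dH_def
  by (rule has_derivative_linear_family[OF open_V y linear_H_r differentiable_H[OF y] f])

text \<open>Differentiating \<open>dH a v w = H (\<Gamma> a v) w + H v (\<Gamma> a w)\<close> once more and antisymmetrizing the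
  two directions makes the second derivatives of the metric cancel and leaves the curvature.\<close>

lemma R_skew: assumes y: "y \<in> V" shows "H y (R y u v w) z = - H y (R y u v z) w"
proof -
  have second: "ddir (\<lambda>x. ddir (\<lambda>z'. H z' w z) x v) y u =
      H y (\<Gamma> y u (\<Gamma> y v w)) z + H y (\<Gamma> y v w) (\<Gamma> y u z) + H y (D\<Gamma> y u v w) z
    + H y (\<Gamma> y u w) (\<Gamma> y v z) + H y w (\<Gamma> y u (\<Gamma> y v z)) + H y w (D\<Gamma> y u v z)" for u v
  proof -
    have "((\<lambda>x. H x (\<Gamma> x v w) z + H x w (\<Gamma> x v z)) has_derivative
        (\<lambda>a. (dH y a (\<Gamma> y v w) z + H y (ddir (\<lambda>x. \<Gamma> x v w) y a) z) +
             (dH y a w (\<Gamma> y v z) + H y w (ddir (\<lambda>x. \<Gamma> x v z) y a)))) (at y)"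
      by (intro has_derivative_add has_derivative_H_l has_derivative_H_r y differentiable_\<Gamma>)
    then have "((\<lambda>x. ddir (\<lambda>z'. H z' w z) x v) has_derivative
        (\<lambda>a. (dH y a (\<Gamma> y v w) z + H y (ddir (\<lambda>x. \<Gamma> x v w) y a) z) +
             (dH y a w (\<Gamma> y v z) + H y w (ddir (\<lambda>x. \<Gamma> x v z) y a)))) (at y)"
      by (rule has_derivative_transform_within_open[OF _ open_V y])
        (simp add: metric_compat[unfolded dH_def])
    then show ?thesis
      by (simp add: ddir_eqI metric_compat[OF y] D\<Gamma>_def)
  qed
  have "ddir (\<lambda>x. ddir (\<lambda>z'. H z' w z) x v) y u = ddir (\<lambda>x. ddir (\<lambda>z'. H z' w z) x u) y v"
    by (rule ddir_commute[OF open_V y differentiable_H])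
      (use smooth_on_differentiable[OF smooth_on_ddir[OF smooth_H] y] in auto)
  then show ?thesis
    unfolding second by (simp add: R_def H_sym[OF y, of w])
qed

text \<open>The usual combination of four Bianchi identities.\<close>

lemma R_pair_sym: assumes y: "y \<in> V" shows "H y (R y u v w) z = H y (R y w z u) v"
proof -
  have B: "H y (R y a b c) d + H y (R y b c a) d + H y (R y c a b) d = 0" for a b c d
    using arg_cong[OF bianchi[OF y, of a b c], of "\<lambda>x. H y x d"] by simp
  have A: "H y (R y a b c) d = - H y (R y b a c) d" for a b c d
    using R_antisym[of y a b c] by simp
  show ?thesis
    using B[of u v w z] B[of v w z u] B[of w z u v] B[of z u v w]
      R_skew[OF y, of v w z u] R_skew[OF y, of w z v u] A[of z v w u]
      A[of z u w v] R_skew[OF y, of u z w v] A[of u w z v] R_skew[OF y, of w u z v]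
      A[of z u v w] R_skew[OF y, of u v z w] R_skew[OF y, of v z u w]
    by linarith
qed

end


section \<open>Kaehler metrics on open subsets of Euclidean space\<close>

lemma linear_axis_zero:
  fixes f :: "real^'k \<Rightarrow> 'b::real_vector"
  assumes "linear f" "\<And>i. f (axis i 1) = 0"
  shows "f x = 0"
  by (subst linear_expand[OF assms(1)]) (simp add: assms(2))

text \<open>In the polarization of the holomorphic curvature function \<open>S\<close> the terms with two \<open>u\<close> and two \<open>v\<close>
  are all equal to \<open>Q u (J v) (J v) u\<close> by the \<open>J\<close>-invariance, except for two of the form
  \<open>Q u (J u) (J v) v\<close>, which the Bianchi identity reduces to sectional curvatures. Since \<open>v\<close> and
  \<open>J v\<close> enter the right-hand side with different weights, the values of \<open>S\<close> separate the two.\<close>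

lemma quadrilinear_hermitian_identity:
  fixes Q :: "'a::real_vector \<Rightarrow> 'a \<Rightarrow> 'a \<Rightarrow> 'a \<Rightarrow> real" and J :: "'a \<Rightarrow> 'a"
  assumes lin1: "\<And>v w z. linear (\<lambda>u. Q u v w z)" and lin2: "\<And>u w z. linear (\<lambda>v. Q u v w z)"
    and lin3: "\<And>u v z. linear (\<lambda>w. Q u v w z)" and lin4: "\<And>u v w. linear (Q u v w)"
    and J: "linear J" "\<And>u. J (J u) = - u"
    and skew: "\<And>u v w z. Q u v w z = - Q v u w z" "\<And>u v w z. Q u v w z = - Q u v z w"
    and pair: "\<And>u v w z. Q u v w z = Q w z u v"
    and bianchi: "\<And>u v w z. Q u v w z + Q v w u z + Q w u v z = 0"
    and inv: "\<And>u v w z. Q (J u) (J v) w z = Q u v w z"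
  defines "S \<equiv> \<lambda>u. Q u (J u) (J u) u"
  shows "S (u + v) + S (u - v) = 2 * S u + 2 * S v + 4 * Q u v v u + 12 * Q u (J v) (J v) u"
proof -
  note simps = linear_add[OF lin1] linear_add[OF lin2] linear_add[OF lin3] linear_add[OF lin4]
    linear_diff[OF lin1] linear_diff[OF lin2] linear_diff[OF lin3] linear_diff[OF lin4]
    linear_add[OF J(1)] linear_diff[OF J(1)]
  have neg: "Q (- a) b c d = - Q a b c d" "Q a (- b) c d = - Q a b c d"
      "Q a b (- c) d = - Q a b c d" "Q a b c (- d) = - Q a b c d" for a b c d
    using linear_neg[OF lin1] linear_neg[OF lin2] linear_neg[OF lin3] linear_neg[OF lin4] by auto
  \<comment> \<open>The invariance under \<open>J\<close> in the first pair, in the form in which it permutes \<open>u\<close> and \<open>v\<close>.\<close>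
  have sw: "Q v (J u) c d = Q u (J v) c d" for c d
  proof -
    have "Q v (J u) c d = Q (J v) (J (J u)) c d" by (rule inv[symmetric])
    also have "\<dots> = Q u (J v) c d" using skew(1)[of "J v" u c d] by (simp add: J(2) neg)
    finally show ?thesis .
  qed
  have sw': "Q c d (J v) u = Q c d (J u) v" for c d
    using sw[of c d] pair[of c d "J v" u] pair[of c d "J u" v] skew(1)[of "J v" u c d]
      skew(1)[of "J u" v c d] by linarith
  have e1: "Q u (J v) (J u) v = Q u (J v) (J v) u" by (simp add: sw')
  have e2: "Q v (J u) (J u) v = Q u (J v) (J v) u" by (simp add: sw sw')
  have e3: "Q v (J u) (J v) u = Q u (J v) (J v) u" by (simp add: sw)
  have e4: "Q v (J v) (J u) u = Q u (J u) (J v) v"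
    using pair[of v "J v" "J u" u] skew(1)[of "J u" u v "J v"] skew(2)[of u "J u" v "J v"] by simp
  have e5: "Q u (J u) (J v) v = Q u v v u + Q u (J v) (J v) u"
  proof -
    have "Q u (J u) (J v) v + Q (J u) (J v) u v + Q (J v) u (J u) v = 0" by (rule bianchi)
    moreover have "Q (J u) (J v) u v = - Q u v v u" using inv[of u v u v] skew(2)[of u v u v] by simp
    moreover have "Q (J v) u (J u) v = - Q u (J v) (J v) u" using skew(1)[of "J v" u "J u" v] e1 by simp
    ultimately show ?thesis by linarith
  qed
  show ?thesis
    unfolding S_def by (simp add: simps e1 e2 e3 e4 e5)
qed

locale local_kaehler = local_metric V h for V :: "(real^'k) set" and h :: "real^'k \<Rightarrow> real^'k^'k" +
  fixes F :: "real^'k \<Rightarrow> real^'k^'k"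
  assumes smooth_F: "\<And>i j. smooth_on V (\<lambda>y. F y $ i $ j)"
    and F_square: "\<And>y u. y \<in> V \<Longrightarrow> F y *v (F y *v u) = - u"
    and F_isom: "\<And>y u v. y \<in> V \<Longrightarrow> (F y *v u) \<bullet> (h y *v (F y *v v)) = u \<bullet> (h y *v v)"
    and F_integrable: "\<And>y k i j. y \<in> V \<Longrightarrow> nijenhuis F y k i j = 0"
    and F_closed: "\<And>y i j k. y \<in> V \<Longrightarrow>
       partial i (\<lambda>z. axis j 1 \<bullet> (h z *v (F z *v axis k 1))) y
     + partial j (\<lambda>z. axis k 1 \<bullet> (h z *v (F z *v axis i 1))) y
     + partial k (\<lambda>z. axis i 1 \<bullet> (h z *v (F z *v axis j 1))) y = 0"
begin

definition J :: "real^'k \<Rightarrow> real^'k \<Rightarrow> real^'k" where "J y u = F y *v u"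

lemma linear_J: "linear (J y)"
  by (auto intro!: linearI simp: J_def matrix_vector_right_distrib matrix_vector_mult_scaleR)

lemmas J_simps [simp] = linear_add[OF linear_J] linear_diff[OF linear_J] linear_neg[OF linear_J]
  linear_cmul[OF linear_J] linear_0[OF linear_J]

lemma J_J [simp]: "y \<in> V \<Longrightarrow> J y (J y u) = - u"
  by (simp add: J_def F_square)

lemma H_J_J: "y \<in> V \<Longrightarrow> H y (J y u) (J y v) = H y u v"
  by (simp add: J_def H_def F_isom)

lemma H_J: "y \<in> V \<Longrightarrow> H y u (J y v) = - H y (J y u) v"
  using H_J_J[of y u "J y v"] by simp

lemma differentiable_F: "y \<in> V \<Longrightarrow> (\<lambda>z. F z $ i $ j) differentiable (at y)"
  using smooth_F by (rule smooth_on_differentiable)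

lemma differentiable_J: assumes y: "y \<in> V" shows "(\<lambda>z. J z v) differentiable (at y)"
  by (rule differentiable_vec) (simp add: J_def matrix_vector_mult_def differentiable_F[OF y])

lemma smooth_J: "smooth_on V (\<lambda>y. J y v $ l)"
proof -
  have "smooth_on V (\<lambda>y. \<Sum>j\<in>UNIV. v $ j *\<^sub>R F y $ l $ j)"
    by (intro smooth_on_sum smooth_on_scaleR smooth_F open_V) auto
  then show ?thesis by (simp add: J_def matrix_vector_mult_def mult.commute)
qed

definition DJ :: "real^'k \<Rightarrow> real^'k \<Rightarrow> real^'k \<Rightarrow> real^'k" where
  "DJ y a v = ddir (\<lambda>z. J z v) y a"

lemma DJ_expand:
  assumes y: "y \<in> V"
  shows "DJ y a v $ l = (\<Sum>i\<in>UNIV. \<Sum>j\<in>UNIV. a $ i * v $ j * partial i (\<lambda>z. F z $ l $ j) y)"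
proof -
  have "((\<lambda>z. \<Sum>j\<in>UNIV. v $ j * F z $ l $ j) has_derivative
      (\<lambda>a. \<Sum>j\<in>UNIV. v $ j * ddir (\<lambda>z. F z $ l $ j) y a)) (at y)"
    by (intro has_derivative_sum has_derivative_mult_right ddir_has differentiable_F y)
  then have "ddir (\<lambda>z. J z v $ l) y a = (\<Sum>j\<in>UNIV. v $ j * ddir (\<lambda>z. F z $ l $ j) y a)"
    by (intro ddir_eqI) (simp add: J_def matrix_vector_mult_def mult.commute)
  also have "\<dots> = (\<Sum>j\<in>UNIV. \<Sum>i\<in>UNIV. a $ i * v $ j * partial i (\<lambda>z. F z $ l $ j) y)"
    by (subst linear_expand[OF ddir_linear[OF differentiable_F[OF y]]])
      (simp add: partial_def sum_distrib_left mult_ac)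
  finally show ?thesis
    unfolding DJ_def ddir_nth[OF differentiable_J[OF y]] by (subst sum.swap)
qed

lemma linear_DJ: assumes y: "y \<in> V" shows "linear (\<lambda>a. DJ y a v)" "linear (DJ y a)"
  by (auto intro!: linearI simp: vec_eq_iff DJ_expand[OF y] algebra_simps sum.distrib sum_distrib_left)

lemma has_derivative_J:
  assumes y: "y \<in> V" and f: "f differentiable (at y)"
  shows "((\<lambda>z. J z (f z)) has_derivative (\<lambda>a. DJ y a (f y) + J y (ddir f y a))) (at y)"
  unfolding DJ_def
  by (rule has_derivative_linear_family[OF open_V y linear_J differentiable_J[OF y] f])

lemma has_derivative_\<Gamma>:
  assumes y: "y \<in> V" and f: "f differentiable (at y)"
  shows "((\<lambda>z. \<Gamma> z u (f z)) has_derivative (\<lambda>a. D\<Gamma> y a u (f y) + \<Gamma> y u (ddir f y a))) (at y)"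
  unfolding D\<Gamma>_def
  by (rule has_derivative_linear_family[OF open_V y linear_\<Gamma>_r differentiable_\<Gamma>[OF y] f])

text \<open>Both sides of the coordinate formula of the Nijenhuis tensor are bilinear, so it suffices to
  compare them on coordinate vectors.\<close>

lemma nijenhuis_DJ:
  assumes y: "y \<in> V"
  shows "DJ y (J y u) v - DJ y (J y v) u - J y (DJ y u v) + J y (DJ y v u) = 0"
proof -
  define S where "S u v = DJ y (J y u) v - DJ y (J y v) u - J y (DJ y u v) + J y (DJ y v u)" for u v
  note lin = linear_add[OF linear_DJ(1)[OF y]] linear_add[OF linear_DJ(2)[OF y]]
    linear_cmul[OF linear_DJ(1)[OF y]] linear_cmul[OF linear_DJ(2)[OF y]]
  have 1: "linear (S u)" for u by (auto intro!: linearI simp: S_def lin algebra_simps)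
  have 2: "linear (\<lambda>u. S u v)" for v by (auto intro!: linearI simp: S_def lin algebra_simps)
  have J_axis: "J y (axis i 1) $ l = F y $ l $ i" for i l
    by (simp add: J_def matrix_vector_mult_basis column_def)
  have DJ_axis: "DJ y a (axis j 1) $ k = (\<Sum>l\<in>UNIV. a $ l * partial l (\<lambda>z. F z $ k $ j) y)" for a j k
    unfolding DJ_expand[OF y] by (simp add: axis_def if_distrib if_distribR cong: if_cong)
  have DJ_axis2: "DJ y (axis i 1) (axis j 1) $ k = partial i (\<lambda>z. F z $ k $ j) y" for i j k
    unfolding DJ_axis by (simp add: axis_def if_distrib if_distribR cong: if_cong)
  have "S (axis i 1) (axis j 1) $ k = nijenhuis F y k i j" for i j k
  proof -
    have "J y x $ k = (\<Sum>l\<in>UNIV. F y $ k $ l * x $ l)" for x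
      by (simp add: J_def matrix_vector_mult_def)
    then have "J y (DJ y (axis i 1) (axis j 1)) $ k = (\<Sum>l\<in>UNIV. F y $ k $ l * partial i (\<lambda>z. F z $ l $ j) y)"
      for i j by (simp only: DJ_axis2)
    then show ?thesis
      unfolding S_def nijenhuis_def
      by (simp add: DJ_axis J_axis sum.distrib sum_subtractf algebra_simps)
  qed
  then have "S (axis i 1) (axis j 1) = 0" for i j
    by (simp add: vec_eq_iff F_integrable[OF y])
  then have "S u (axis j 1) = 0" for u j using linear_axis_zero[OF 2] by blast
  then have "S u v = 0" using linear_axis_zero[OF 1] by blast
  then show ?thesis by (simp add: S_def)
qed

lemma closed_DJ:
  assumes y: "y \<in> V"
  shows "dH y a v (J y w) + H y v (DJ y a w) + (dH y v w (J y a) + H y w (DJ y v a))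
     + (dH y w a (J y v) + H y a (DJ y w v)) = 0"
proof -
  define S where "S a v w = dH y a v (J y w) + H y v (DJ y a w) + (dH y v w (J y a) + H y w (DJ y v a))
     + (dH y w a (J y v) + H y a (DJ y w v))" for a v w
  note lin = linear_add[OF linear_DJ(1)[OF y]] linear_add[OF linear_DJ(2)[OF y]]
    linear_cmul[OF linear_DJ(1)[OF y]] linear_cmul[OF linear_DJ(2)[OF y]]
    linear_add[OF linear_dH(1)[OF y]] linear_add[OF linear_dH(2)[OF y]] linear_add[OF linear_dH(3)[OF y]]
    linear_cmul[OF linear_dH(1)[OF y]] linear_cmul[OF linear_dH(2)[OF y]] linear_cmul[OF linear_dH(3)[OF y]]
  have 1: "linear (S a v)" for a v by (auto intro!: linearI simp: S_def lin algebra_simps)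
  have 2: "linear (\<lambda>v. S a v w)" for a w by (auto intro!: linearI simp: S_def lin algebra_simps)
  have 3: "linear (\<lambda>a. S a v w)" for v w by (auto intro!: linearI simp: S_def lin algebra_simps)
  have "ddir (\<lambda>z. H z v (J z w)) y a = dH y a v (J y w) + H y v (DJ y a w)" for a v w
    unfolding DJ_def by (rule ddir_eqI) (rule has_derivative_H_r[OF y differentiable_J[OF y]])
  then have "S (axis i 1) (axis j 1) (axis k 1) = 0" for i j k
    using F_closed[OF y, of i j k] by (simp add: S_def partial_def H_def J_def)
  then have "S (axis i 1) (axis j 1) w = 0" for i j w using linear_axis_zero[OF 1] by blast
  then have "S (axis i 1) v w = 0" for i v w
    using linear_axis_zero[OF 2, of "axis i 1" w v] by blast
  then have "S a v w = 0" using linear_axis_zero[OF 3, of v w a] by blast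
  then show ?thesis by (simp add: S_def)
qed

text \<open>With \<open>N a v\<close> for the covariant derivative of \<open>J\<close> applied to \<open>v\<close>, the form
  \<open>H (N a v) w\<close> is skew in \<open>v, w\<close> because \<open>J\<close> is skew, and \<open>J\<close> can be moved from \<open>v\<close> to \<open>w\<close> in it because
  \<open>J\<^sup>2 = -1\<close>. Its cyclic sum vanishes because the fundamental form is closed. Substituting the
  cyclic identity in the integrability condition cancels all terms but two equal ones.\<close>

theorem J_parallel:
  assumes y: "y \<in> V"
  shows "DJ y a v = J y (\<Gamma> y a v) - \<Gamma> y a (J y v)"
proof -
  define N where "N a v = DJ y a v + \<Gamma> y a (J y v) - J y (\<Gamma> y a v)" for a v
  have skew: "H y (N a w) v = - H y (N a v) w" for a v w
  proof -
    have 1: "ddir (\<lambda>z. H z (J z w) v) y a = dH y a (J y w) v + H y (DJ y a w) v" for v w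
      unfolding DJ_def by (rule ddir_eqI) (rule has_derivative_H_l[OF y differentiable_J[OF y]])
    have "H x (J x w) v = - H x (J x v) w" if "x \<in> V" for x
      using H_J[OF that, of v w] H_sym[OF that, of "J x w" v] by simp
    then have "ddir (\<lambda>z. H z (J z w) v) y a = ddir (\<lambda>z. - H z (J z v) w) y a"
      by (rule ddir_cong_open[OF open_V y _ differentiableI[OF has_derivative_H_l[OF y differentiable_J[OF y]]]])
    also have "\<dots> = - ddir (\<lambda>z. H z (J z v) w) y a"
      by (rule ddir_eqI) (intro has_derivative_minus ddir_has differentiableI[OF has_derivative_H_l] y differentiable_J)
    finally show ?thesis
      unfolding 1 metric_compat[OF y] N_def
      using H_J[OF y, of "\<Gamma> y a v" w] H_sym[OF y, of "J y w" "\<Gamma> y a v"]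
        H_J[OF y, of "\<Gamma> y a w" v] H_sym[OF y, of "J y v" "\<Gamma> y a w"]
      by simp
  qed
  have anti: "N a (J y w) = - J y (N a w)" for a w
  proof -
    have "((\<lambda>z. J z (J z w)) has_derivative (\<lambda>a. DJ y a (J y w) + J y (ddir (\<lambda>z. J z w) y a))) (at y)"
      by (rule has_derivative_J[OF y differentiable_J[OF y]])
    then have "((\<lambda>z. - w) has_derivative (\<lambda>a. DJ y a (J y w) + J y (ddir (\<lambda>z. J z w) y a))) (at y)"
      by (rule has_derivative_transform_within_open[OF _ open_V y]) simp
    then have "ddir (\<lambda>z. - w) y a = DJ y a (J y w) + J y (DJ y a w)"
      unfolding DJ_def[of y a w] by (rule ddir_eqI)
    then have "DJ y a (J y w) = - J y (DJ y a w)"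
      by (simp add: eq_neg_iff_add_eq_0)
    then show ?thesis by (simp add: N_def y)
  qed
  have nij: "N (J y u) v - N (J y v) u - J y (N u v) + J y (N v u) = 0" for u v
    using nijenhuis_DJ[OF y, of u v]
    by (simp add: N_def y \<Gamma>_sym[OF y, of v u] \<Gamma>_sym[OF y, of "J y v" "J y u"]
        \<Gamma>_sym[OF y, of "J y u" v] \<Gamma>_sym[OF y, of "J y v" u] algebra_simps)
  have cyc: "H y (N a w) v + H y (N v a) w + H y (N w v) a = 0" for a v w
  proof -
    have K: "H y p (J y q) = - H y q (J y p)" for p q
      using H_J[OF y, of p q] H_sym[OF y, of "J y p" q] by simp
    have "H y v (N a w) + H y w (N v a) + H y a (N w v) = 0"
      using closed_DJ[OF y, of a v w] K[of v "\<Gamma> y a w"] K[of w "\<Gamma> y a v"] K[of a "\<Gamma> y v w"]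
      by (simp add: N_def metric_compat[OF y] \<Gamma>_sym[OF y, of v a] \<Gamma>_sym[OF y, of w a] \<Gamma>_sym[OF y, of w v])
    then show ?thesis
      using H_sym[OF y, of v "N a w"] H_sym[OF y, of w "N v a"] H_sym[OF y, of a "N w v"] by simp
  qed
  have "N z x = 0" for z x
  proof (rule H_eqI[OF y])
    fix x'
    \<comment> \<open>Every vector is of the form \<open>J w\<close>, so it is enough to test against these.\<close>
    define w where "w = - J y x'"
    have w: "x' = J y w" by (simp add: w_def y)
    have a: "H y (N a (J y b)) c = H y (N a b) (J y c)" for a b c by (simp add: anti H_J[OF y])
    have "H y (N (J y x) w) z - H y (N (J y w) x) z - H y (J y (N x w)) z + H y (J y (N w x)) z = 0"
      using arg_cong[OF nij[of x w], of "\<lambda>u. H y u z"] by simp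
    moreover have "H y (J y (N x w)) z = - H y (N x w) (J y z)" "H y (J y (N w x)) z = - H y (N w x) (J y z)"
      by (simp_all add: H_J[OF y])
    moreover note cyc[of "J y x" w z] cyc[of "J y w" x z] a[of z x w] a[of w x z] a[of z w x] a[of x w z]
      skew[of w "J y x" z] skew[of x "J y w" z] skew[of z "J y x" w]
    ultimately have "H y (N z x) (J y w) = 0" by linarith
    then show "H y (N z x) x' = H y 0 x'" by (simp add: w)
  qed
  then have "N a v = 0" by simp
  then show ?thesis by (simp add: N_def algebra_simps)
qed

text \<open>The equation \<open>DJ a v = J (\<Gamma> a v) - \<Gamma> a (J v)\<close> is differentiated and antisymmetrized, as the
  corresponding equation for the metric was.\<close>

lemma R_J:
  assumes y: "y \<in> V"
  shows "R y b a (J y v) = J y (R y b a v)"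
proof -
  have second: "ddir (\<lambda>x. DJ x a v) y b = J y (\<Gamma> y b (\<Gamma> y a v)) - \<Gamma> y b (J y (\<Gamma> y a v))
     + J y (D\<Gamma> y b a v) - D\<Gamma> y b a (J y v) - \<Gamma> y a (J y (\<Gamma> y b v)) + \<Gamma> y a (\<Gamma> y b (J y v))" for a b
  proof -
    have "((\<lambda>x. J x (\<Gamma> x a v) - \<Gamma> x a (J x v)) has_derivative
       (\<lambda>b. (DJ y b (\<Gamma> y a v) + J y (ddir (\<lambda>x. \<Gamma> x a v) y b)) -
            (D\<Gamma> y b a (J y v) + \<Gamma> y a (ddir (\<lambda>x. J x v) y b)))) (at y)"
      by (intro has_derivative_diff has_derivative_J has_derivative_\<Gamma> y differentiable_\<Gamma> differentiable_J)
    then have "((\<lambda>x. DJ x a v) has_derivative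
       (\<lambda>b. (DJ y b (\<Gamma> y a v) + J y (ddir (\<lambda>x. \<Gamma> x a v) y b)) -
            (D\<Gamma> y b a (J y v) + \<Gamma> y a (ddir (\<lambda>x. J x v) y b)))) (at y)"
      by (rule has_derivative_transform_within_open[OF _ open_V y]) (simp add: J_parallel)
    then have "ddir (\<lambda>x. DJ x a v) y b = (DJ y b (\<Gamma> y a v) + J y (D\<Gamma> y b a v)) -
            (D\<Gamma> y b a (J y v) + \<Gamma> y a (DJ y b v))"
      unfolding D\<Gamma>_def[of y b a v] DJ_def[of y b v] by (rule ddir_eqI)
    then show ?thesis by (simp add: J_parallel[OF y])
  qed
  have "ddir (\<lambda>x. DJ x a v) y b = ddir (\<lambda>x. DJ x b v) y a"
  proof (simp only: vec_eq_iff, intro allI)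
    fix l
    have d: "(\<lambda>x. DJ x a v) differentiable (at y)" for a
      using y by (intro differentiable_vec differentiable_cong_open[OF open_V y _
          smooth_on_differentiable[OF smooth_on_ddir[OF smooth_J] y]])
        (simp add: DJ_def ddir_nth differentiable_J)
    have e: "ddir (\<lambda>x. DJ x a v) y b $ l = ddir (\<lambda>x. ddir (\<lambda>z. J z v $ l) x a) y b" for a b
      unfolding ddir_nth[OF d]
      by (rule ddir_cong_open[OF open_V y _ differentiable_nth[OF d]]) (simp add: DJ_def ddir_nth differentiable_J)
    show "ddir (\<lambda>x. DJ x a v) y b $ l = ddir (\<lambda>x. DJ x b v) y a $ l"
      unfolding e
      by (rule ddir_commute[OF open_V y smooth_on_differentiable[OF smooth_J]])
        (use smooth_on_differentiable[OF smooth_on_ddir[OF smooth_J] y] in auto)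
  qed
  then show ?thesis unfolding second by (simp add: R_def algebra_simps)
qed

lemma R_J_J:
  assumes y: "y \<in> V"
  shows "H y (R y (J y u) (J y v) w) z = H y (R y u v w) z"
proof -
  have "H y (R y (J y u) (J y v) w) z = H y (R y w z (J y u)) (J y v)" by (rule R_pair_sym[OF y])
  also have "\<dots> = H y (R y w z u) v" by (simp add: R_J[OF y] H_J_J[OF y])
  finally show ?thesis using R_pair_sym[OF y] by metis
qed

text \<open>The vectors \<open>u \<plusminus> v\<close> and \<open>u \<plusminus> J v\<close> have the same length, so constancy makes the
  left-hand sides of the polarization identity for \<open>v\<close> and for \<open>J v\<close> equal; comparing the right-hand
  sides gives the claim. This is the only consequence of constant holomorphic sectional curvature
  that is used.\<close>

lemma constant_holomorphic_curvature:
  assumes y: "y \<in> V"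
    and const: "\<And>u. H y (R y u (J y u) (J y u)) u = k * (H y u u)\<^sup>2"
    and orth: "H y u v = 0" "H y u (J y v) = 0"
  shows "H y (R y u v v) u = H y (R y u (J y v) (J y v)) u"
proof -
  define Q where "Q u v w z = H y (R y u v w) z" for u v w z
  define S where "S u = Q u (J y u) (J y u) u" for u
  have id: "S (u + v) + S (u - v) = 2 * S u + 2 * S v + 4 * Q u v v u + 12 * Q u (J y v) (J y v) u" for u v
    unfolding S_def
  proof (rule quadrilinear_hermitian_identity[where Q = Q and J = "J y" and u = u and v = v])
    show "linear (\<lambda>u. Q u v w z)" "linear (\<lambda>v. Q u v w z)" "linear (\<lambda>w. Q u v w z)" "linear (Q u v w)" for u v w z
      using linear_R[OF y] unfolding Q_def linear_iff by simp_all
    show "Q u v w z = - Q v u w z" for u v w z using R_antisym[of y u v w] by (simp add: Q_def)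
    show "Q u v w z = - Q u v z w" for u v w z unfolding Q_def by (rule R_skew[OF y])
    show "Q u v w z = Q w z u v" for u v w z unfolding Q_def by (rule R_pair_sym[OF y])
    show "Q u v w z + Q v w u z + Q w u v z = 0" for u v w z
      using arg_cong[OF bianchi[OF y, of u v w], of "\<lambda>x. H y x z"] by (simp add: Q_def)
    show "Q (J y u) (J y v) w z = Q u v w z" for u v w z unfolding Q_def by (rule R_J_J[OF y])
  qed (simp_all add: linear_J y)
  have S: "S u = k * (H y u u)\<^sup>2" for u by (simp add: S_def Q_def const)
  have "H y v u = 0" "H y (J y v) u = 0" using orth H_sym[OF y] by metis+
  then have "S (u + v) = k * (H y u u + H y v v)\<^sup>2" "S (u - v) = k * (H y u u + H y v v)\<^sup>2"
    "S (u + J y v) = k * (H y u u + H y v v)\<^sup>2" "S (u - J y v) = k * (H y u u + H y v v)\<^sup>2"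
    "S (J y v) = S v"
    by (simp_all add: S orth H_J_J[OF y])
  moreover have "Q u (- v) (- v) u = Q u v v u"
    by (simp add: Q_def linear_neg[OF linear_R(2)[OF y]] linear_neg[OF linear_R(3)[OF y]])
  ultimately have "Q u v v u = Q u (J y v) (J y v) u"
    using id[of u v] id[of u "J y v"] by (simp add: y)
  then show ?thesis by (simp add: Q_def)
qed

end


section \<open>Curvature in the direction of a gradient field\<close>

text \<open>The field is \<open>z \<mapsto> T z\<close> for a linear projection \<open>T\<close>; its flow lines are rays, up to
  parametrization. The assumption \<open>closed\<close> says that the dual 1-form of the field is closed, that is,
  that the field is locally a gradient.\<close>

locale closed_linear_field = local_metric V h for V :: "(real^'k) set" and h :: "real^'k \<Rightarrow> real^'k^'k" +
  fixes T :: "real^'k \<Rightarrow> real^'k"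
  assumes linear_T: "linear T" and T_T: "\<And>z. T (T z) = T z"
    and closed: "\<And>z u v. z \<in> V \<Longrightarrow> ddir (\<lambda>z. H z (T z) v) z u = ddir (\<lambda>z. H z (T z) u) z v"
begin

lemmas T_simps [simp] = linear_add[OF linear_T] linear_diff[OF linear_T] linear_neg[OF linear_T]
  linear_cmul[OF linear_T] linear_0[OF linear_T] T_T

lemma T_has_derivative: "(T has_derivative T) (at z)"
  using linear_T by (simp add: linear_imp_has_derivative)

lemma ddir_T: "T differentiable (at z)" "ddir T z = T"
  using T_has_derivative by (auto intro: differentiableI simp: frechet_derivative_at[symmetric])

text \<open>The covariant derivative of the field, as an endomorphism. For a gradient field it is half the
  Lie derivative of the metric.\<close>

definition B :: "real^'k \<Rightarrow> real^'k \<Rightarrow> real^'k" where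
  "B z u = T u + \<Gamma> z u (T z)"

lemma linear_B: "linear (B z)"
  by (auto intro!: linearI simp: B_def algebra_simps)

lemmas B_simps [simp] = linear_add[OF linear_B] linear_cmul[OF linear_B] linear_0[OF linear_B]

lemma B_form:
  assumes z: "z \<in> V"
  shows "2 * H z (B z u) v = H z (T u) v + H z u (T v) + dH z (T z) u v"
proof -
  have d: "ddir (\<lambda>z. H z (T z) v) z u = dH z u (T z) v + H z (T u) v" for u v
    using ddir_eqI[OF has_derivative_H_l[OF z ddir_T(1)], of v u] by (simp add: ddir_T)
  have "2 * H z (\<Gamma> z u (T z)) v = dH z u (T z) v + dH z (T z) u v - dH z v (T z) u"
    using koszul[OF z, of u "T z" v] dH_sym[OF z, of v u "T z"] by simp
  then show ?thesis
    using closed[OF z, of v u] H_sym[OF z, of "T v" u] by (simp add: d B_def)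
qed

text \<open>The Lie derivative is computed on the ray through \<open>z\<close>; this needs the metric only along that ray,
  and in particular no derivatives in other directions.\<close>

lemma B_ray:
  assumes z: "z \<in> V"
    and D: "((\<lambda>r. H (z + r *\<^sub>R T z) (u + r *\<^sub>R T u) v) has_real_derivative D) (at 0)"
  shows "2 * H z (B z u) v = D + H z u (T v)"
proof -
  have 1: "((\<lambda>x. H x (u + f x *\<^sub>R T u) v) has_derivative
      (\<lambda>a. dH z a u v + H z (f' a *\<^sub>R T u) v)) (at z)"
    if f: "(f has_derivative f') (at z)" "f z = 0" for f :: "real^'k \<Rightarrow> real" and f'
  proof -
    have g: "((\<lambda>x. u + f x *\<^sub>R T u) has_derivative (\<lambda>a. f' a *\<^sub>R T u)) (at z)"
      by (auto intro!: derivative_eq_intros f)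
    have "((\<lambda>x. H x (u + f x *\<^sub>R T u) v) has_derivative
      (\<lambda>a. dH z a (u + f z *\<^sub>R T u) v + H z (ddir (\<lambda>x. u + f x *\<^sub>R T u) z a) v)) (at z)"
      by (rule has_derivative_H_l[OF z differentiableI[OF g]])
    then show ?thesis by (simp add: f(2) frechet_derivative_at[OF g, symmetric])
  qed
  have ray: "((\<lambda>r. z + r *\<^sub>R T z) has_derivative (\<lambda>r. r *\<^sub>R T z)) (at 0)"
    by (auto intro!: derivative_eq_intros)
  have dm: "((\<lambda>x. H x w v) has_derivative (\<lambda>a. dH z a w v)) (at (z + 0 *\<^sub>R T z))" for w
    using ddir_has[OF differentiable_H[OF z]] by (simp add: dH_def)
  have c: "((\<lambda>r. H (z + r *\<^sub>R T z) w v) has_derivative (\<lambda>r. dH z (r *\<^sub>R T z) w v)) (at 0)" for w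
    by (rule has_derivative_compose[OF ray dm])
  have "((\<lambda>r. H (z + r *\<^sub>R T z) u v + r * H (z + r *\<^sub>R T z) (T u) v) has_derivative
      (\<lambda>r. dH z (r *\<^sub>R T z) u v + (0 * dH z (r *\<^sub>R T z) (T u) v + r * H (z + 0 *\<^sub>R T z) (T u) v))) (at 0)"
    by (intro has_derivative_add has_derivative_mult c has_derivative_ident)
  then have "((\<lambda>r. H (z + r *\<^sub>R T z) (u + r *\<^sub>R T u) v) has_derivative
      (\<lambda>r. (dH z (T z) u v + H z (T u) v) * r)) (at 0)"
    by (simp add: linear_cmul[OF linear_dH(1)[OF z]] algebra_simps)
  then have "((\<lambda>r. H (z + r *\<^sub>R T z) (u + r *\<^sub>R T u) v) has_real_derivative
      (dH z (T z) u v + H z (T u) v)) (at 0)"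
    by (simp add: has_field_derivative_def)
  then have "D = dH z (T z) u v + H z (T u) v" using D DERIV_unique by blast
  then show ?thesis using B_form[OF z, of u v] by simp
qed

lemma B_eigen:
  assumes z: "z \<in> V"
    and D: "\<And>v. ((\<lambda>r. H (z + r *\<^sub>R T z) (u + r *\<^sub>R T u) v) has_real_derivative (D v)) (at 0)"
    and e: "\<And>v. D v + H z u (T v) = 2 * b * H z u v"
  shows "B z u = b *\<^sub>R u"
proof (rule H_eqI[OF z])
  fix v show "H z (B z u) v = H z (b *\<^sub>R u) v"
    using B_ray[OF z D[of v]] e[of v] by simp
qed

lemma has_derivative_\<Gamma>_T: "y \<in> V \<Longrightarrow> ((\<lambda>z. \<Gamma> z v (T z)) has_derivative
    (\<lambda>a. D\<Gamma> y a v (T y) + \<Gamma> y v (T a))) (at y)"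
  using has_derivative_linear_family[OF open_V _ linear_\<Gamma>_r differentiable_\<Gamma> ddir_T(1), of y v]
  by (simp add: D\<Gamma>_def ddir_T)

lemma B_has_derivative:
  assumes y: "y \<in> V"
  shows "((\<lambda>z. B z v) has_derivative (\<lambda>a. D\<Gamma> y a v (T y) + \<Gamma> y v (T a))) (at y)"
  unfolding B_def using has_derivative_add[OF has_derivative_const has_derivative_\<Gamma>_T[OF y]] by simp

text \<open>The Riccati equation for \<open>B\<close>: the last bracket is the Lie derivative of \<open>B\<close> along the field.
  The rays being geodesics up to parametrization, the covariant derivative of \<open>B\<close> in the
  direction \<open>u\<close>, evaluated on the field, reduces to derivatives of \<open>\<mu>\<close>.\<close>

lemma riccati:
  assumes y: "y \<in> V" and geo: "\<And>z. z \<in> V \<Longrightarrow> B z (T z) = \<mu> z *\<^sub>R T z"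
    and \<mu>: "\<mu> differentiable (at y)"
  defines "e \<equiv> T y"
  shows "R y u e e = ddir \<mu> y u *\<^sub>R e + \<mu> y *\<^sub>R B y u - B y (B y u)
     - (ddir (\<lambda>z. B z u) y e + B y (T u) - T (B y u))"
proof -
  have DB: "ddir (\<lambda>z. B z v) y a = D\<Gamma> y a v e + \<Gamma> y v (T a)" for a v
    unfolding e_def by (rule ddir_eqI[OF B_has_derivative[OF y]])
  have 1: "((\<lambda>z. B z (T z)) has_derivative (\<lambda>w. ddir (\<lambda>z. B z (T y)) y w + B y (ddir T y w))) (at y)"
    by (rule has_derivative_linear_family[OF open_V y linear_B differentiableI[OF B_has_derivative[OF y]] ddir_T(1)])
  have "((\<lambda>z. \<mu> z *\<^sub>R T z) has_derivative (\<lambda>w. \<mu> y *\<^sub>R T w + ddir \<mu> y w *\<^sub>R T y)) (at y)"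
    by (intro has_derivative_scaleR ddir_has \<mu> T_has_derivative)
  then have "((\<lambda>z. B z (T z)) has_derivative (\<lambda>w. \<mu> y *\<^sub>R T w + ddir \<mu> y w *\<^sub>R T y)) (at y)"
    by (rule has_derivative_transform_within_open[OF _ open_V y]) (simp add: geo)
  from has_derivative_unique[OF this 1]
  have 2: "D\<Gamma> y u e e + \<Gamma> y e (T u) + B y (T u) = \<mu> y *\<^sub>R T u + ddir \<mu> y u *\<^sub>R e"
    using DB[of e u] by (simp add: fun_eq_iff ddir_T e_def)
  have Te: "T e = e" by (simp add: e_def)
  have "\<Gamma> y e e = \<mu> y *\<^sub>R e - e" using geo[OF y] by (simp add: B_def e_def algebra_simps)
  then have 3: "\<Gamma> y u (\<Gamma> y e e) = \<mu> y *\<^sub>R (B y u - T u) - \<Gamma> y u e"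
    by (simp add: B_def e_def)
  have "\<Gamma> y u e = B y u - T u" by (simp add: B_def e_def)
  moreover have "\<Gamma> y e w = \<Gamma> y w e" for w by (rule \<Gamma>_sym[OF y])
  ultimately have 4: "\<Gamma> y e (\<Gamma> y u e) = \<Gamma> y (B y u) e - \<Gamma> y e (T u)" by simp
  have 5: "\<Gamma> y (B y u) e = B y (B y u) - T (B y u)" by (simp add: B_def e_def)
  have 6: "D\<Gamma> y u e e = \<mu> y *\<^sub>R T u + ddir \<mu> y u *\<^sub>R e - B y (T u) - \<Gamma> y e (T u)"
    using 2 by (simp add: algebra_simps)
  show ?thesis
    unfolding R_def 3 4 5 6 DB Te by (simp add: algebra_simps)
qed

text \<open>If \<open>B\<close> has an eigenvector field along a ray, the Riccati equation becomes a scalar equation for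
  the eigenvalue \<open>\<beta>\<close>. The eigenvector field is the affine one through \<open>u\<close> with velocity \<open>T u\<close>; both the
  horizontal lifts and the vertical vectors are of this kind, up to a scalar factor.\<close>

lemma radial_curvature:
  assumes y: "y \<in> V" and geo: "\<And>z. z \<in> V \<Longrightarrow> B z (T z) = \<mu> z *\<^sub>R T z"
    and \<mu>: "\<mu> differentiable (at y)" and orth: "H y (T y) u = 0"
    and eig: "\<And>s. \<bar>s\<bar> < 1 \<Longrightarrow> B (y + s *\<^sub>R T y) (u + s *\<^sub>R T u) = \<beta> s *\<^sub>R (u + s *\<^sub>R T u)"
    and \<beta>: "(\<beta> has_real_derivative \<beta>') (at 0)"
  shows "H y (R y (T y) u u) (T y) = (\<mu> y * \<beta> 0 - (\<beta> 0)\<^sup>2 - \<beta>') * H y u u"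
proof -
  have B0: "B y u = \<beta> 0 *\<^sub>R u" using eig[of 0] by simp
  have ray: "((\<lambda>s. y + s *\<^sub>R T y) has_derivative (\<lambda>s. s *\<^sub>R T y)) (at 0)"
    by (auto intro!: derivative_eq_intros)
  have DB: "((\<lambda>z. B z v) has_derivative ddir (\<lambda>z. B z v) y) (at (y + 0 *\<^sub>R T y))" for v
    using ddir_has[OF differentiableI[OF B_has_derivative[OF y]]] by simp
  have "((\<lambda>s. B (y + s *\<^sub>R T y) v) has_derivative (\<lambda>s. ddir (\<lambda>z. B z v) y (s *\<^sub>R T y))) (at 0)" for v
    by (rule has_derivative_compose[OF ray DB])
  from has_derivative_add[OF this has_derivative_scaleR[OF has_derivative_ident this]]
  have 1: "((\<lambda>s. B (y + s *\<^sub>R T y) (u + s *\<^sub>R T u)) has_derivative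
     (\<lambda>s. ddir (\<lambda>z. B z u) y (s *\<^sub>R T y) + s *\<^sub>R B y (T u))) (at 0)"
    by simp
  have \<beta>_d: "(\<beta> has_derivative (\<lambda>s. \<beta>' * s)) (at 0)"
    using \<beta> by (simp add: has_field_derivative_def)
  have "((\<lambda>s. \<beta> s *\<^sub>R (u + s *\<^sub>R T u)) has_derivative
     (\<lambda>s. \<beta> 0 *\<^sub>R (s *\<^sub>R T u) + (\<beta>' * s) *\<^sub>R (u + 0 *\<^sub>R T u))) (at 0)"
    by (intro has_derivative_scaleR \<beta>_d) (auto intro!: derivative_eq_intros)
  then have "((\<lambda>s. B (y + s *\<^sub>R T y) (u + s *\<^sub>R T u)) has_derivative
     (\<lambda>s. \<beta> 0 *\<^sub>R (s *\<^sub>R T u) + (\<beta>' * s) *\<^sub>R (u + 0 *\<^sub>R T u))) (at 0)"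
    by (rule has_derivative_transform_within_open[where s = "{-1<..<1}"]) (auto simp: eig[symmetric] simp del: B_simps)
  from fun_cong[OF has_derivative_unique[OF this 1], of 1]
  have DB1: "ddir (\<lambda>z. B z u) y (T y) + B y (T u) = \<beta> 0 *\<^sub>R T u + \<beta>' *\<^sub>R u" by simp
  have "R y u (T y) (T y) = ddir \<mu> y u *\<^sub>R T y + (\<mu> y * \<beta> 0 - (\<beta> 0)\<^sup>2 - \<beta>') *\<^sub>R u"
    using riccati[OF y geo \<mu>, of u] unfolding DB1 B0
    by (simp add: B0 algebra_simps power2_eq_square)
  then have "H y (R y u (T y) (T y)) u = (\<mu> y * \<beta> 0 - (\<beta> 0)\<^sup>2 - \<beta>') * H y u u"
    by (simp add: orth)
  then show ?thesis using R_pair_sym[OF y] by metis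
qed

end


section \<open>Coordinates on a manifold\<close>

text \<open>What the calculus of tangent vectors needs of an atlas; it holds for the charts of the base
  and for the induced charts of the cotangent bundle, for which differentiable transition maps suffice.\<close>

definition differentiable_atlas :: "('m, 'n::finite) chart set \<Rightarrow> bool" where
  "differentiable_atlas \<A> \<longleftrightarrow>
     (\<forall>\<phi>\<in>\<A>. inj_on (snd \<phi>) (fst \<phi>)) \<and>
     (\<forall>\<phi>\<in>\<A>. \<forall>\<psi>\<in>\<A>. open (snd \<phi> ` (fst \<phi> \<inter> fst \<psi>)) \<and>
        (\<forall>y\<in>snd \<phi> ` (fst \<phi> \<inter> fst \<psi>). transition \<phi> \<psi> differentiable (at y)))"

context
  fixes \<A> :: "('m, 'n::finite) chart set"
  assumes \<A>: "differentiable_atlas \<A>"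
begin

lemma chart_inv_eq: "\<phi> \<in> \<A> \<Longrightarrow> x \<in> fst \<phi> \<Longrightarrow> chart_inv \<phi> (snd \<phi> x) = x"
  using \<A> by (simp add: differentiable_atlas_def chart_inv_def)

lemma transition_eq: "\<phi> \<in> \<A> \<Longrightarrow> x \<in> fst \<phi> \<Longrightarrow> transition \<phi> \<psi> (snd \<phi> x) = snd \<psi> x"
  by (simp add: transition_def chart_inv_eq)

lemma open_overlap: "\<phi> \<in> \<A> \<Longrightarrow> \<psi> \<in> \<A> \<Longrightarrow> open (snd \<phi> ` (fst \<phi> \<inter> fst \<psi>))"
  using \<A> by (simp add: differentiable_atlas_def)

lemma open_image: "\<phi> \<in> \<A> \<Longrightarrow> open (snd \<phi> ` fst \<phi>)"
  using open_overlap[of \<phi> \<phi>] by simp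

lemma transition_differentiable:
  "\<phi> \<in> \<A> \<Longrightarrow> \<psi> \<in> \<A> \<Longrightarrow> x \<in> fst \<phi> \<Longrightarrow> x \<in> fst \<psi> \<Longrightarrow> transition \<phi> \<psi> differentiable (at (snd \<phi> x))"
  using \<A> by (auto simp: differentiable_atlas_def)

lemma transition_self:
  assumes "\<phi> \<in> \<A>" "x \<in> fst \<phi>"
  shows "ddir (transition \<phi> \<phi>) (snd \<phi> x) e = e"
proof -
  have "((\<lambda>y. y) has_derivative (\<lambda>y. y)) (at (snd \<phi> x))" by (rule has_derivative_ident)
  then have "(transition \<phi> \<phi> has_derivative (\<lambda>y. y)) (at (snd \<phi> x))"
    by (rule has_derivative_transform_within_open[OF _ open_image[OF assms(1)]])
      (use assms in \<open>auto simp: transition_eq\<close>)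
  then show ?thesis by (rule ddir_eqI)
qed

lemma transition_chain:
  assumes "\<phi> \<in> \<A>" "\<psi> \<in> \<A>" "\<rho> \<in> \<A>" "x \<in> fst \<phi>" "x \<in> fst \<psi>" "x \<in> fst \<rho>"
  shows "ddir (transition \<phi> \<rho>) (snd \<phi> x) e
    = ddir (transition \<psi> \<rho>) (snd \<psi> x) (ddir (transition \<phi> \<psi>) (snd \<phi> x) e)"
proof -
  have 1: "(transition \<phi> \<psi> has_derivative ddir (transition \<phi> \<psi>) (snd \<phi> x)) (at (snd \<phi> x))"
    by (rule ddir_has[OF transition_differentiable]) (use assms in auto)
  have 2: "(transition \<psi> \<rho> has_derivative ddir (transition \<psi> \<rho>) (snd \<psi> x)) (at (transition \<phi> \<psi> (snd \<phi> x)))"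
    using ddir_has[OF transition_differentiable, of \<psi> \<rho> x] assms by (simp add: transition_eq)
  have "((\<lambda>y. transition \<psi> \<rho> (transition \<phi> \<psi> y)) has_derivative
     (\<lambda>e. ddir (transition \<psi> \<rho>) (snd \<psi> x) (ddir (transition \<phi> \<psi>) (snd \<phi> x) e))) (at (snd \<phi> x))"
    by (rule has_derivative_compose[OF 1 2])
  then have "(transition \<phi> \<rho> has_derivative
     (\<lambda>e. ddir (transition \<psi> \<rho>) (snd \<psi> x) (ddir (transition \<phi> \<psi>) (snd \<phi> x) e))) (at (snd \<phi> x))"
    by (rule has_derivative_transform_within_open[OF _ open_overlap[of \<phi> \<psi>]])
      (use assms in \<open>auto simp: transition_eq\<close>)
  then show ?thesis by (rule ddir_eqI)
qed

lemma tvec_self: "\<phi> \<in> \<A> \<Longrightarrow> x \<in> fst \<phi> \<Longrightarrow> tvec \<A> \<phi> x e \<phi> = e"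
  by (simp add: tvec_def transition_self)

text \<open>This is the chain rule for transition maps.\<close>

lemma tvec_in_tangent_space:
  assumes "\<phi> \<in> \<A>" "x \<in> fst \<phi>"
  shows "tvec \<A> \<phi> x e \<in> tangent_space \<A> x"
  unfolding tangent_space_def
proof (intro CollectI ballI impI ext)
  fix \<psi> \<rho> assume "\<psi> \<in> \<A>" "x \<in> fst \<psi>"
  then show "tvec \<A> \<phi> x e \<rho> = tvec \<A> \<psi> x (tvec \<A> \<phi> x e \<psi>) \<rho>"
    using assms transition_chain[of \<phi> \<psi> \<rho> x e] by (simp add: tvec_def)
qed

lemma tangent_tvec: "\<phi> \<in> \<A> \<Longrightarrow> x \<in> fst \<phi> \<Longrightarrow> u \<in> tangent_space \<A> x \<Longrightarrow> u = tvec \<A> \<phi> x (u \<phi>)"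
  by (simp add: tangent_space_def)

lemma tvec_lincomb:
  assumes "\<phi> \<in> \<A>" "x \<in> fst \<phi>"
  shows "lincomb a (tvec \<A> \<phi> x e) b (tvec \<A> \<phi> x f) = tvec \<A> \<phi> x (a *\<^sub>R e + b *\<^sub>R f)"
proof
  fix \<psi>
  show "lincomb a (tvec \<A> \<phi> x e) b (tvec \<A> \<phi> x f) \<psi> = tvec \<A> \<phi> x (a *\<^sub>R e + b *\<^sub>R f) \<psi>"
  proof (cases "\<psi> \<in> \<A> \<and> x \<in> fst \<psi>")
    case True
    then have "linear (ddir (transition \<phi> \<psi>) (snd \<phi> x))"
      using assms by (intro ddir_linear transition_differentiable) auto
    then show ?thesis by (simp add: lincomb_def tvec_def linear_add linear_cmul)
  qed (auto simp: lincomb_def tvec_def)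
qed

lemma lincomb_in_tangent_space:
  assumes "\<phi> \<in> \<A>" "x \<in> fst \<phi>" "u \<in> tangent_space \<A> x" "v \<in> tangent_space \<A> x"
  shows "lincomb a u b v \<in> tangent_space \<A> x"
proof -
  have "lincomb a u b v = tvec \<A> \<phi> x (a *\<^sub>R u \<phi> + b *\<^sub>R v \<phi>)"
    using assms tangent_tvec tvec_lincomb by metis
  then show ?thesis using tvec_in_tangent_space assms by simp
qed

lemma tvec_zero_iff: "\<phi> \<in> \<A> \<Longrightarrow> x \<in> fst \<phi> \<Longrightarrow> tvec \<A> \<phi> x e = zero_vec \<longleftrightarrow> e = 0"
proof -
  assume a: "\<phi> \<in> \<A>" "x \<in> fst \<phi>"
  have "tvec \<A> \<phi> x 0 = zero_vec"
    using tvec_lincomb[OF a, of 0 0 0 0] by (auto simp: lincomb_def zero_vec_def fun_eq_iff)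
  then show ?thesis using tvec_self[OF a, of e] by (auto simp: zero_vec_def)
qed

text \<open>Linearity is only available for \<open>lincomb\<close> and on the tangent space; this lemma turns it into
  ordinary linearity in the coordinates, for covectors, metrics and endomorphisms alike.\<close>

lemma tangent_linear_expand:
  fixes f :: "('m, 'n) tangent \<Rightarrow> 'b::real_vector"
  assumes a: "\<phi> \<in> \<A>" "x \<in> fst \<phi>"
    and f: "\<And>u v a b. u \<in> tangent_space \<A> x \<Longrightarrow> v \<in> tangent_space \<A> x \<Longrightarrow>
      f (lincomb a u b v) = a *\<^sub>R f u + b *\<^sub>R f v"
  shows "f (tvec \<A> \<phi> x e) = (\<Sum>i\<in>UNIV. e $ i *\<^sub>R f (coord_vec \<A> \<phi> x i))"
proof -
  have l: "f (tvec \<A> \<phi> x (a *\<^sub>R e + b *\<^sub>R e')) = a *\<^sub>R f (tvec \<A> \<phi> x e) + b *\<^sub>R f (tvec \<A> \<phi> x e')" for a b e e'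
    using f[OF tvec_in_tangent_space[OF a] tvec_in_tangent_space[OF a]] tvec_lincomb[OF a] by metis
  have "linear (\<lambda>e. f (tvec \<A> \<phi> x e))"
  proof (rule linearI)
    show "f (tvec \<A> \<phi> x (e + e')) = f (tvec \<A> \<phi> x e) + f (tvec \<A> \<phi> x e')" for e e'
      using l[of 1 e 1 e'] by simp
    show "f (tvec \<A> \<phi> x (r *\<^sub>R e)) = r *\<^sub>R f (tvec \<A> \<phi> x e)" for r e
      using l[of r e 0 e] by simp
  qed
  then show ?thesis unfolding coord_vec_def by (rule linear_expand)
qed

lemma metric_coords_tvec:
  assumes a: "\<phi> \<in> \<A>" "x \<in> fst \<phi>" and g: "riemannian_metric \<A> g"
  shows "g x (tvec \<A> \<phi> x u) (tvec \<A> \<phi> x v) = u \<bullet> (metric_coords \<A> g \<phi> (snd \<phi> x) *v v)"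
proof -
  have x: "x \<in> points \<A>" using a by (auto simp: points_def)
  have sym: "g x u v = g x v u" if "u \<in> tangent_space \<A> x" "v \<in> tangent_space \<A> x" for u v
    using g x that by (auto simp: riemannian_metric_def)
  have lin: "g x (lincomb a u b v) w = a *\<^sub>R g x u w + b *\<^sub>R g x v w"
    if "u \<in> tangent_space \<A> x" "v \<in> tangent_space \<A> x" "w \<in> tangent_space \<A> x" for u v w a b
    using g x that by (auto simp: riemannian_metric_def)
  have lin': "g x w (lincomb a u b v) = a *\<^sub>R g x w u + b *\<^sub>R g x w v"
    if "u \<in> tangent_space \<A> x" "v \<in> tangent_space \<A> x" "w \<in> tangent_space \<A> x" for u v w a b
    using lin[OF that] sym[OF _ that(3)] that lincomb_in_tangent_space[OF a] by simp
  have t: "coord_vec \<A> \<phi> x i \<in> tangent_space \<A> x" for i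
    unfolding coord_vec_def by (rule tvec_in_tangent_space[OF a])
  have "g x (tvec \<A> \<phi> x u) (tvec \<A> \<phi> x v) = (\<Sum>i\<in>UNIV. u $ i *\<^sub>R g x (coord_vec \<A> \<phi> x i) (tvec \<A> \<phi> x v))"
    by (rule tangent_linear_expand[OF a]) (intro lin tvec_in_tangent_space a)
  also have "\<dots> = (\<Sum>i\<in>UNIV. u $ i *\<^sub>R (\<Sum>j\<in>UNIV. v $ j *\<^sub>R g x (coord_vec \<A> \<phi> x i) (coord_vec \<A> \<phi> x j)))"
    by (intro sum.cong refl arg_cong[where f = "\<lambda>x. _ *\<^sub>R x"] tangent_linear_expand[OF a] lin' t)
  also have "\<dots> = u \<bullet> (metric_coords \<A> g \<phi> (snd \<phi> x) *v v)"
    by (simp add: metric_coords_def chart_inv_eq[OF a] inner_vec_def matrix_vector_mult_def mult.commute)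
  finally show ?thesis .
qed

lemma local_metric_coords:
  assumes \<phi>: "\<phi> \<in> \<A>" and g: "riemannian_metric \<A> g"
  shows "local_metric (snd \<phi> ` fst \<phi>) (metric_coords \<A> g \<phi>)"
proof
  show "open (snd \<phi> ` fst \<phi>)" by (rule open_image[OF \<phi>])
  show "smooth_on (snd \<phi> ` fst \<phi>) (\<lambda>y. metric_coords \<A> g \<phi> y $ i $ j)" for i j
    using g \<phi> by (simp add: riemannian_metric_def)
next
  fix y i j assume "y \<in> snd \<phi> ` fst \<phi>"
  then obtain x where x: "x \<in> fst \<phi>" "y = snd \<phi> x" by auto
  have "x \<in> points \<A>" using \<phi> x by (auto simp: points_def)
  then show "metric_coords \<A> g \<phi> y $ i $ j = metric_coords \<A> g \<phi> y $ j $ i"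
    using g tvec_in_tangent_space[OF \<phi> x(1)]
    by (simp add: metric_coords_def x chart_inv_eq[OF \<phi> x(1)] coord_vec_def riemannian_metric_def)
next
  fix y u assume "y \<in> snd \<phi> ` fst \<phi>" and u: "u \<noteq> (0::real^'n)"
  then obtain x where x: "x \<in> fst \<phi>" "y = snd \<phi> x" by auto
  have "x \<in> points \<A>" using \<phi> x by (auto simp: points_def)
  then have "g x (tvec \<A> \<phi> x u) (tvec \<A> \<phi> x u) > 0"
    using g tvec_in_tangent_space[OF \<phi> x(1), of u] u tvec_zero_iff[OF \<phi> x(1), of u]
    by (simp add: riemannian_metric_def)
  then show "u \<bullet> (metric_coords \<A> g \<phi> y *v u) > 0"
    by (simp add: metric_coords_tvec[OF \<phi> x(1) g] x)
qed

lemma endo_coords_tvec: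
  assumes a: "\<phi> \<in> \<A>" "x \<in> fst \<phi>" and J: "almost_complex \<A> J"
  shows "J x (tvec \<A> \<phi> x u) = tvec \<A> \<phi> x (endo_coords \<A> J \<phi> (snd \<phi> x) *v u)"
proof -
  have x: "x \<in> points \<A>" using a by (auto simp: points_def)
  have "J x (tvec \<A> \<phi> x u) \<phi> = (\<Sum>i\<in>UNIV. u $ i *\<^sub>R J x (coord_vec \<A> \<phi> x i) \<phi>)"
    by (rule tangent_linear_expand[OF a, of "\<lambda>v. J x v \<phi>"])
      (use J x in \<open>simp add: almost_complex_def lincomb_def\<close>)
  also have "\<dots> = endo_coords \<A> J \<phi> (snd \<phi> x) *v u"
    by (simp add: endo_coords_def chart_inv_eq[OF a] vec_eq_iff matrix_vector_mult_def mult.commute)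
  finally have "J x (tvec \<A> \<phi> x u) \<phi> = endo_coords \<A> J \<phi> (snd \<phi> x) *v u" .
  moreover have "J x (tvec \<A> \<phi> x u) \<in> tangent_space \<A> x"
    using J x tvec_in_tangent_space[OF a] by (auto simp: almost_complex_def)
  ultimately show ?thesis using tangent_tvec[OF a] by metis
qed

lemma local_kaehler_coords:
  assumes \<phi>: "\<phi> \<in> \<A>" and K: "kaehler_structure \<A> g J"
  shows "local_kaehler (snd \<phi> ` fst \<phi>) (metric_coords \<A> g \<phi>) (endo_coords \<A> J \<phi>)"
proof -
  have g: "riemannian_metric \<A> g" and J: "almost_complex \<A> J"
    using K by (auto simp: kaehler_structure_def)
  interpret local_metric "snd \<phi> ` fst \<phi>" "metric_coords \<A> g \<phi>"
    by (rule local_metric_coords[OF \<phi> g])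
  show ?thesis
  proof
    show "smooth_on (snd \<phi> ` fst \<phi>) (\<lambda>y. endo_coords \<A> J \<phi> y $ i $ j)" for i j
      using J \<phi> by (simp add: almost_complex_def)
    show "nijenhuis (endo_coords \<A> J \<phi>) y k i j = 0" if "y \<in> snd \<phi> ` fst \<phi>" for y k i j
      using K \<phi> that by (auto simp: kaehler_structure_def integrable_structure_def)
  next
    fix y u assume "y \<in> snd \<phi> ` fst \<phi>"
    then obtain x where x: "x \<in> fst \<phi>" "y = snd \<phi> x" by auto
    have "x \<in> points \<A>" using \<phi> x by (auto simp: points_def)
    then have "J x (J x (tvec \<A> \<phi> x u)) = lincomb (-1) (tvec \<A> \<phi> x u) 0 (tvec \<A> \<phi> x u)"
      using J tvec_in_tangent_space[OF \<phi> x(1)] by (simp add: almost_complex_def)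
    then have "tvec \<A> \<phi> x (endo_coords \<A> J \<phi> y *v (endo_coords \<A> J \<phi> y *v u)) = tvec \<A> \<phi> x (- u)"
      by (simp add: endo_coords_tvec[OF \<phi> x(1) J] tvec_lincomb[OF \<phi> x(1)] x)
    then show "endo_coords \<A> J \<phi> y *v (endo_coords \<A> J \<phi> y *v u) = - u"
      using tvec_self[OF \<phi> x(1)] by metis
  next
    fix y u v assume "y \<in> snd \<phi> ` fst \<phi>"
    then obtain x where x: "x \<in> fst \<phi>" "y = snd \<phi> x" by auto
    have "x \<in> points \<A>" using \<phi> x by (auto simp: points_def)
    then have "g x (J x (tvec \<A> \<phi> x u)) (J x (tvec \<A> \<phi> x v)) = g x (tvec \<A> \<phi> x u) (tvec \<A> \<phi> x v)"
      using K tvec_in_tangent_space[OF \<phi> x(1)] by (simp add: kaehler_structure_def)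
    then show "(endo_coords \<A> J \<phi> y *v u) \<bullet> (metric_coords \<A> g \<phi> y *v (endo_coords \<A> J \<phi> y *v v))
       = u \<bullet> (metric_coords \<A> g \<phi> y *v v)"
      by (simp add: endo_coords_tvec[OF \<phi> x(1) J] metric_coords_tvec[OF \<phi> x(1) g] x)
  next
    fix y i j k assume y: "y \<in> snd \<phi> ` fst \<phi>"
    have eq: "fundamental_coords \<A> g J \<phi> z a b = axis a 1 \<bullet> (metric_coords \<A> g \<phi> z *v (endo_coords \<A> J \<phi> z *v axis b 1))"
      if "z \<in> snd \<phi> ` fst \<phi>" for z a b
    proof -
      obtain x where x: "x \<in> fst \<phi>" "z = snd \<phi> x" using \<open>z \<in> _\<close> by auto
      then show ?thesis
        by (simp add: fundamental_coords_def chart_inv_eq[OF \<phi> x(1)] coord_vec_def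
            endo_coords_tvec[OF \<phi> x(1) J] metric_coords_tvec[OF \<phi> x(1) g])
    qed
    have d: "(\<lambda>z. axis a 1 \<bullet> (metric_coords \<A> g \<phi> z *v (endo_coords \<A> J \<phi> z *v axis b 1))) differentiable (at y)" for a b
    proof -
      have "smooth_on (snd \<phi> ` fst \<phi>) (\<lambda>z. endo_coords \<A> J \<phi> z $ k $ i)" for k i
        using J \<phi> by (simp add: almost_complex_def)
      then have "(\<lambda>z. endo_coords \<A> J \<phi> z $ k $ i) differentiable (at y)" for k i
        using y by (rule smooth_on_differentiable)
      then have "(\<lambda>z. endo_coords \<A> J \<phi> z *v axis b 1) differentiable (at y)"
        by (intro differentiable_vec) (simp add: matrix_vector_mult_def)
      from differentiableI[OF has_derivative_H_r[OF y this]] show ?thesis by (simp add: H_def)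
    qed
    have p: "partial m (\<lambda>z. axis a 1 \<bullet> (metric_coords \<A> g \<phi> z *v (endo_coords \<A> J \<phi> z *v axis b 1))) y
        = partial m (\<lambda>z. fundamental_coords \<A> g J \<phi> z a b) y" for m a b
      unfolding partial_def by (rule ddir_cong_open[OF open_V y eq[symmetric] d])
    show "partial i (\<lambda>z. axis j 1 \<bullet> (metric_coords \<A> g \<phi> z *v (endo_coords \<A> J \<phi> z *v axis k 1))) y
     + partial j (\<lambda>z. axis k 1 \<bullet> (metric_coords \<A> g \<phi> z *v (endo_coords \<A> J \<phi> z *v axis i 1))) y
     + partial k (\<lambda>z. axis i 1 \<bullet> (metric_coords \<A> g \<phi> z *v (endo_coords \<A> J \<phi> z *v axis j 1))) y = 0"
      unfolding p using K \<phi> y by (auto simp: kaehler_structure_def closed_fundamental_form_def)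
  qed
qed

end

lemma smooth_manifold_atlas:
  assumes "smooth_manifold X \<A>"
  shows "differentiable_atlas \<A>"
  unfolding differentiable_atlas_def
proof (intro conjI ballI)
  fix \<phi> assume \<phi>: "\<phi> \<in> \<A>"
  then have c: "is_chart X \<phi>" using assms by (simp add: smooth_manifold_def)
  then have o: "openin X (fst \<phi>)" "open (snd \<phi> ` fst \<phi>)"
    and h: "homeomorphic_map (subtopology X (fst \<phi>)) (top_of_set (snd \<phi> ` fst \<phi>)) (snd \<phi>)"
    by (auto simp: is_chart_def)
  have t: "topspace (subtopology X (fst \<phi>)) = fst \<phi>"
    using openin_subset[OF o(1)] by auto
  show "inj_on (snd \<phi>) (fst \<phi>)"
    using homeomorphic_imp_injective_map[OF h] unfolding t .
  fix \<psi> assume \<psi>: "\<psi> \<in> \<A>"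
  have "openin X (fst \<psi>)" using \<psi> assms by (simp add: smooth_manifold_def is_chart_def)
  then have "openin (subtopology X (fst \<phi>)) (fst \<phi> \<inter> fst \<psi>)"
    using openin_subtopology_Int2 by blast
  then have "openin (top_of_set (snd \<phi> ` fst \<phi>)) (snd \<phi> ` (fst \<phi> \<inter> fst \<psi>))"
    using homeomorphic_imp_open_map[OF h] by (simp add: open_map_def)
  then show "open (snd \<phi> ` (fst \<phi> \<inter> fst \<psi>))" using o(2) openin_open_trans by blast
  have "smooth_on (snd \<phi> ` (fst \<phi> \<inter> fst \<psi>)) (transition \<phi> \<psi>)"
    using assms \<phi> \<psi> by (simp add: smooth_manifold_def smoothly_compatible_def)
  then show "transition \<phi> \<psi> differentiable at y" if "y \<in> snd \<phi> ` (fst \<phi> \<inter> fst \<psi>)" for y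
    using that by (rule smooth_on_differentiable)
qed


section \<open>Charts of the nonzero cotangent bundle\<close>

definition q_part :: "real^('n::finite + 'n) \<Rightarrow> real^'n" where "q_part y = (\<chi> i. y $ Inl i)"
definition p_part :: "real^('n::finite + 'n) \<Rightarrow> real^'n" where "p_part y = (\<chi> i. y $ Inr i)"
definition join :: "real^'n::finite \<Rightarrow> real^'n \<Rightarrow> real^('n + 'n)" where
  "join a b = (\<chi> s. case s of Inl i \<Rightarrow> a $ i | Inr i \<Rightarrow> b $ i)"

lemma parts_join [simp]: "q_part (join a b) = a" "p_part (join a b) = b"
  by (simp_all add: q_part_def p_part_def join_def)

lemma join_parts [simp]: "join (q_part y) (p_part y) = y"
  by (auto simp: q_part_def p_part_def join_def vec_eq_iff split: sum.split)

lemma join_eq_iff: "y = join a b \<longleftrightarrow> q_part y = a \<and> p_part y = b"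
  by (metis join_parts parts_join)

lemma linear_q_part: "linear q_part" and linear_p_part: "linear p_part"
  by (auto intro!: linearI simp: q_part_def p_part_def vec_eq_iff)

lemmas parts_simps [simp] = linear_add[OF linear_q_part] linear_add[OF linear_p_part]
  linear_diff[OF linear_q_part] linear_diff[OF linear_p_part]
  linear_cmul[OF linear_q_part] linear_cmul[OF linear_p_part]
  linear_0[OF linear_q_part] linear_0[OF linear_p_part]
  linear_neg[OF linear_q_part] linear_neg[OF linear_p_part]

lemma parts_has_derivative: "(q_part has_derivative q_part) (at y)" "(p_part has_derivative p_part) (at y)"
  by (auto intro!: linear_imp_has_derivative linear_q_part linear_p_part)

lemma continuous_parts: "continuous_on UNIV q_part" "continuous_on UNIV p_part"
  by (simp_all add: linear_continuous_on linear_conv_bounded_linear[symmetric] linear_q_part linear_p_part)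

lemma open_parts:
  assumes "open S"
  shows "open {y. q_part y \<in> S \<and> p_part y \<noteq> 0}"
proof -
  have "{y. q_part y \<in> S \<and> p_part y \<noteq> 0} = q_part -` S \<inter> p_part -` (- {0})" by auto
  moreover have "open (q_part -` S)" "open (p_part -` (- {0}))"
    using continuous_parts assms open_vimage by blast+
  ultimately show ?thesis by auto
qed

lemma snd_cotangent0_chart:
  "snd (cotangent0_chart \<A> \<phi>) P = join (snd \<phi> (fst P)) (fibre_coords \<A> \<phi> P)"
  by (simp add: cotangent0_chart_def join_def)

lemma fst_cotangent0_chart:
  "P \<in> fst (cotangent0_chart \<A> \<phi>) \<longleftrightarrow>
     fst P \<in> fst \<phi> \<and> snd P \<in> cotangent_space \<A> (fst P) \<and> snd P \<noteq> (\<lambda>u. 0)"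
  by (cases P) (simp add: cotangent0_chart_def)

context
  fixes X :: "'m topology" and \<A> :: "('m, 'n::finite) chart set"
  assumes M: "smooth_manifold X \<A>"
begin

lemmas base_atlas = smooth_manifold_atlas[OF M]

lemma covector_expand:
  assumes a: "\<phi> \<in> \<A>" "x \<in> fst \<phi>" and p: "p \<in> cotangent_space \<A> x"
  shows "p (tvec \<A> \<phi> x e) = e \<bullet> fibre_coords \<A> \<phi> (x, p)"
  using tangent_linear_expand[OF base_atlas a, of p e] p
  by (simp add: cotangent_space_def fibre_coords_def inner_vec_def)

definition covector :: "('m, 'n) chart \<Rightarrow> 'm \<Rightarrow> real^'n \<Rightarrow> ('m, 'n) tangent \<Rightarrow> real" where
  "covector \<phi> x b = (\<lambda>u. if u \<in> tangent_space \<A> x then u \<phi> \<bullet> b else 0)"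

lemma covector:
  assumes a: "\<phi> \<in> \<A>" "x \<in> fst \<phi>"
  shows "covector \<phi> x b \<in> cotangent_space \<A> x" "fibre_coords \<A> \<phi> (x, covector \<phi> x b) = b"
proof -
  show "covector \<phi> x b \<in> cotangent_space \<A> x"
    using lincomb_in_tangent_space[OF base_atlas a]
    by (simp add: cotangent_space_def covector_def) (simp add: lincomb_def inner_simps)
  show "fibre_coords \<A> \<phi> (x, covector \<phi> x b) = b"
    by (simp add: fibre_coords_def covector_def coord_vec_def tvec_in_tangent_space[OF base_atlas a]
        tvec_self[OF base_atlas a] vec_eq_iff inner_axis' )
qed

lemma fibre_coords_zero:
  assumes a: "\<phi> \<in> \<A>" "x \<in> fst \<phi>" and p: "p \<in> cotangent_space \<A> x"
  shows "fibre_coords \<A> \<phi> (x, p) = 0 \<longleftrightarrow> p = (\<lambda>u. 0)"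
proof
  assume 0: "fibre_coords \<A> \<phi> (x, p) = 0"
  show "p = (\<lambda>u. 0)"
  proof
    fix u
    show "p u = 0"
    proof (cases "u \<in> tangent_space \<A> x")
      case True
      then show ?thesis using covector_expand[OF a p, of "u \<phi>"] tangent_tvec[OF base_atlas a True] 0 by simp
    next
      case False
      then show ?thesis using p by (simp add: cotangent_space_def)
    qed
  qed
qed (simp add: fibre_coords_def vec_eq_iff)

lemma fibre_coords_inj:
  assumes a: "\<phi> \<in> \<A>" "x \<in> fst \<phi>" and p: "p \<in> cotangent_space \<A> x" "p' \<in> cotangent_space \<A> x"
    and eq: "fibre_coords \<A> \<phi> (x, p) = fibre_coords \<A> \<phi> (x, p')"
  shows "p = p'"
proof
  fix u
  show "p u = p' u"
  proof (cases "u \<in> tangent_space \<A> x")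
    case True
    then show ?thesis
      using covector_expand[OF a p(1), of "u \<phi>"] covector_expand[OF a p(2), of "u \<phi>"]
        tangent_tvec[OF base_atlas a True] eq by simp
  next
    case False
    then show ?thesis using p by (simp add: cotangent_space_def)
  qed
qed

lemma cotangent0_inj:
  assumes "\<phi> \<in> \<A>"
  shows "inj_on (snd (cotangent0_chart \<A> \<phi>)) (fst (cotangent0_chart \<A> \<phi>))"
proof (rule inj_onI)
  fix P P' assume P: "P \<in> fst (cotangent0_chart \<A> \<phi>)" "P' \<in> fst (cotangent0_chart \<A> \<phi>)"
    and eq: "snd (cotangent0_chart \<A> \<phi>) P = snd (cotangent0_chart \<A> \<phi>) P'"
  from eq have q: "snd \<phi> (fst P) = snd \<phi> (fst P')" and p: "fibre_coords \<A> \<phi> P = fibre_coords \<A> \<phi> P'"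
    unfolding snd_cotangent0_chart join_eq_iff by simp_all
  have f: "fst P = fst P'"
    using q P assms base_atlas unfolding fst_cotangent0_chart differentiable_atlas_def by (metis inj_onD)
  then have "snd P = snd P'"
    using fibre_coords_inj[OF assms, of "fst P" "snd P" "snd P'"] P p unfolding fst_cotangent0_chart
    by (metis prod.collapse)
  with f show "P = P'" by (simp add: prod_eq_iff)
qed

lemma cotangent0_image:
  assumes "\<phi> \<in> \<A>"
  shows "snd (cotangent0_chart \<A> \<phi>) ` (fst (cotangent0_chart \<A> \<phi>) \<inter> fst (cotangent0_chart \<A> \<psi>))
    = {y. q_part y \<in> snd \<phi> ` (fst \<phi> \<inter> fst \<psi>) \<and> p_part y \<noteq> 0}" (is "?L = ?R")
proof
  show "?L \<subseteq> ?R"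
  proof
    fix y assume "y \<in> ?L"
    then obtain P where P: "P \<in> fst (cotangent0_chart \<A> \<phi>)" "P \<in> fst (cotangent0_chart \<A> \<psi>)"
      "y = snd (cotangent0_chart \<A> \<phi>) P" by auto
    then show "y \<in> ?R"
      using fibre_coords_zero[OF assms, of "fst P" "snd P"]
      by (simp add: snd_cotangent0_chart fst_cotangent0_chart)
  qed
  show "?R \<subseteq> ?L"
  proof
    fix y assume "y \<in> ?R"
    then obtain x where x: "x \<in> fst \<phi>" "x \<in> fst \<psi>" "q_part y = snd \<phi> x" and p: "p_part y \<noteq> 0" by auto
    let ?P = "(x, covector \<phi> x (p_part y))"
    have "covector \<phi> x (p_part y) \<noteq> (\<lambda>u. 0)"
      using fibre_coords_zero[OF assms x(1) covector(1)[OF assms x(1)], of "p_part y"] p covector(2)[OF assms x(1)] by simp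
    then have "?P \<in> fst (cotangent0_chart \<A> \<phi>)" "?P \<in> fst (cotangent0_chart \<A> \<psi>)"
      using x covector(1)[OF assms x(1)] by (simp_all add: fst_cotangent0_chart)
    moreover have "y = snd (cotangent0_chart \<A> \<phi>) ?P"
      using x covector(2)[OF assms x(1)] by (simp add: snd_cotangent0_chart join_eq_iff)
    ultimately show "y \<in> ?L" by blast
  qed
qed

text \<open>The transformation rule of covectors: the transpose of the differential of the inverse
  transition map.\<close>

lemma fibre_coords_change:
  assumes a: "\<phi> \<in> \<A>" "x \<in> fst \<phi>" and b: "\<psi> \<in> \<A>" "x \<in> fst \<psi>" and p: "p \<in> cotangent_space \<A> x"
  shows "fibre_coords \<A> \<psi> (x, p) $ j
    = ddir (transition \<psi> \<phi>) (snd \<psi> x) (axis j 1) \<bullet> fibre_coords \<A> \<phi> (x, p)"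
proof -
  have "coord_vec \<A> \<psi> x j = tvec \<A> \<phi> x (coord_vec \<A> \<psi> x j \<phi>)"
    unfolding coord_vec_def by (intro tangent_tvec[OF base_atlas a] tvec_in_tangent_space[OF base_atlas b])
  also have "coord_vec \<A> \<psi> x j \<phi> = ddir (transition \<psi> \<phi>) (snd \<psi> x) (axis j 1)"
    by (simp add: coord_vec_def tvec_def a)
  finally show ?thesis
    using covector_expand[OF a p] by (simp add: fibre_coords_def[of \<A> \<psi>])
qed

text \<open>The transition maps are \<open>(q, p) \<mapsto> (\<tau> q, p \<circ> D\<tau>\<^sup>-\<^sup>1)\<close> with \<open>\<tau>\<close> smooth, and they are defined on the
  open sets where \<open>q\<close> lies in the overlap and \<open>p \<noteq> 0\<close>.\<close>

theorem cotangent0_atlas_differentiable: "differentiable_atlas (cotangent0_atlas \<A>)"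
  unfolding differentiable_atlas_def
proof (intro conjI ballI)
  fix \<Phi> assume "\<Phi> \<in> cotangent0_atlas \<A>"
  then obtain \<phi> where \<phi>: "\<phi> \<in> \<A>" "\<Phi> = cotangent0_chart \<A> \<phi>" by (auto simp: cotangent0_atlas_def)
  show inj: "inj_on (snd \<Phi>) (fst \<Phi>)" by (simp add: \<phi> cotangent0_inj)
  fix \<Psi> assume "\<Psi> \<in> cotangent0_atlas \<A>"
  then obtain \<psi> where \<psi>: "\<psi> \<in> \<A>" "\<Psi> = cotangent0_chart \<A> \<psi>" by (auto simp: cotangent0_atlas_def)
  have im: "snd \<Phi> ` (fst \<Phi> \<inter> fst \<Psi>) = {y. q_part y \<in> snd \<phi> ` (fst \<phi> \<inter> fst \<psi>) \<and> p_part y \<noteq> 0}"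
    unfolding \<phi>(2) \<psi>(2) by (rule cotangent0_image[OF \<phi>(1)])
  show op: "open (snd \<Phi> ` (fst \<Phi> \<inter> fst \<Psi>))"
    unfolding im by (rule open_parts[OF open_overlap[OF base_atlas \<phi>(1) \<psi>(1)]])
  have tr: "transition \<Phi> \<Psi> y = join (transition \<phi> \<psi> (q_part y))
     (\<chi> j. ddir (transition \<psi> \<phi>) (transition \<phi> \<psi> (q_part y)) (axis j 1) \<bullet> p_part y)"
    if y: "y \<in> snd \<Phi> ` (fst \<Phi> \<inter> fst \<Psi>)" for y
  proof -
    obtain P where P: "P \<in> fst \<Phi>" "P \<in> fst \<Psi>" "y = snd \<Phi> P" using y by auto
    have x: "fst P \<in> fst \<phi>" "fst P \<in> fst \<psi>" "snd P \<in> cotangent_space \<A> (fst P)"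
      using P by (auto simp: \<phi> \<psi> fst_cotangent0_chart)
    have "chart_inv \<Phi> y = P" using inj P by (simp add: chart_inv_def)
    moreover have "q_part y = snd \<phi> (fst P)" "p_part y = fibre_coords \<A> \<phi> P"
      by (simp_all add: P(3) \<phi> snd_cotangent0_chart)
    moreover have "fibre_coords \<A> \<psi> P = (\<chi> j. ddir (transition \<psi> \<phi>) (snd \<psi> (fst P)) (axis j 1) \<bullet> fibre_coords \<A> \<phi> P)"
      using fibre_coords_change[OF \<phi>(1) x(1) \<psi>(1) x(2,3)] by (simp add: vec_eq_iff)
    ultimately show ?thesis
      by (simp add: transition_def[of \<Phi> "cotangent0_chart \<A> \<psi>"] \<psi>(2) snd_cotangent0_chart transition_eq[OF base_atlas \<phi>(1) x(1)])
  qed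
  fix y assume y: "y \<in> snd \<Phi> ` (fst \<Phi> \<inter> fst \<Psi>)"
  then obtain x where x: "x \<in> fst \<phi>" "x \<in> fst \<psi>" "q_part y = snd \<phi> x" unfolding im by auto
  have t: "(\<lambda>y. transition \<phi> \<psi> (q_part y)) differentiable (at y)"
  proof (rule differentiable_compose[where f = "transition \<phi> \<psi>" and g = q_part])
    show "transition \<phi> \<psi> differentiable (at (q_part y))"
      using transition_differentiable[OF base_atlas \<phi>(1) \<psi>(1) x(1,2)] x(3) by simp
    show "q_part differentiable (at y)" using parts_has_derivative(1) by (rule differentiableI)
  qed
  have "(\<lambda>z. ddir (transition \<psi> \<phi>) z (axis j 1)) differentiable (at (transition \<phi> \<psi> (q_part y)))" for j
  proof -
    have "smooth_on (snd \<psi> ` (fst \<psi> \<inter> fst \<phi>)) (transition \<psi> \<phi>)"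
      using M \<phi>(1) \<psi>(1) by (simp add: smooth_manifold_def smoothly_compatible_def)
    from smooth_on_differentiable[OF smooth_on_ddir[OF this]] x show ?thesis
      by (simp add: transition_eq[OF base_atlas \<phi>(1)])
  qed
  from differentiable_compose[where g = "\<lambda>y. transition \<phi> \<psi> (q_part y)", OF this t]
  have d: "(\<lambda>y. ddir (transition \<psi> \<phi>) (transition \<phi> \<psi> (q_part y)) (axis j 1)) differentiable (at y)" for j .
  have "(\<lambda>y. join (transition \<phi> \<psi> (q_part y))
     (\<chi> j. ddir (transition \<psi> \<phi>) (transition \<phi> \<psi> (q_part y)) (axis j 1) \<bullet> p_part y)) differentiable (at y)"
  proof (rule differentiable_vec)
    fix s :: "'n + 'n"
    show "(\<lambda>y. join (transition \<phi> \<psi> (q_part y))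
     (\<chi> j. ddir (transition \<psi> \<phi>) (transition \<phi> \<psi> (q_part y)) (axis j 1) \<bullet> p_part y) $ s) differentiable (at y)"
      using differentiable_nth[OF t] differentiableI[OF has_derivative_inner[OF ddir_has[OF d] parts_has_derivative(2)]]
      by (cases s) (simp_all add: join_def)
  qed
  from differentiable_cong_open[OF op y tr[symmetric] this]
  show "transition \<Phi> \<Psi> differentiable (at y)" .
qed

end


section \<open>Functions of the energy density\<close>

lemma smooth_on_deriv:
  fixes l :: "real \<Rightarrow> real"
  assumes "smooth_on S l" "open S"
  shows "smooth_on S (deriv l)" and "\<And>t. t \<in> S \<Longrightarrow> (l has_real_derivative deriv l t) (at t)"
proof -
  show d: "(l has_real_derivative deriv l t) (at t)" if "t \<in> S" for t
    using smooth_on_differentiable[OF assms(1) that] real_differentiableE DERIV_imp_deriv by metis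
  show "smooth_on S (deriv l)"
  proof (rule smooth_on_cong[OF assms(2) smooth_on_ddir[OF assms(1), of 1]])
    show "ddir l t 1 = deriv l t" if "t \<in> S" for t
      using ddir_eqI[of l "(*) (deriv l t)" t 1] d[OF that] by (simp add: has_field_derivative_def)
  qed
qed

locale profile =
  fixes A c :: real and l :: "real \<Rightarrow> real"
  assumes A: "A > 0" and smooth_l: "smooth_on {0<..} l"
    and l_pos: "\<And>t. t > 0 \<Longrightarrow> l t > 0"
    and D_pos: "\<And>t. t > 0 \<Longrightarrow> 2 * c - A\<^sup>2 * t * (l t)\<^sup>2 > 0"
    and S_pos: "\<And>t. t > 0 \<Longrightarrow> l t + 2 * t * deriv l t > 0"
begin

text \<open>\<open>radial_coeff\<close> relates the radial field to the differential of the energy density,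
  \<open>radial_rate\<close> and \<open>horizontal_rate\<close> are the eigenvalues of the covariant derivative of the radial
  field on itself and on the horizontal lifts of vectors annihilated by the covector. Up to a
  constant, \<open>D\<close> is the squared length of the geodesic spray after normalization.\<close>

definition S :: "real \<Rightarrow> real" where "S t = l t + 2 * t * deriv l t"
definition S' :: "real \<Rightarrow> real" where "S' t = 3 * deriv l t + 2 * t * deriv (deriv l) t"
definition D :: "real \<Rightarrow> real" where "D t = 2 * c - A\<^sup>2 * t * (l t)\<^sup>2"
definition radial_coeff :: "real \<Rightarrow> real" where "radial_coeff t = A * (S t)\<^sup>2 / D t"
definition radial_rate :: "real \<Rightarrow> real" where "radial_rate t = 1 + 2 * t * S' t / S t + t * A\<^sup>2 * l t * S t / D t"
definition horizontal_rate :: "real \<Rightarrow> real" where "horizontal_rate t = S t / l t"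
definition horizontal_rate' :: "real \<Rightarrow> real" where "horizontal_rate' t = (S' t * l t - S t * deriv l t) / (l t)\<^sup>2"

lemma pos: assumes "t > 0" shows "S t > 0" "D t > 0" "radial_coeff t > 0" "l t > 0"
proof -
  show 1: "S t > 0" "D t > 0" "l t > 0"
    using assms l_pos D_pos S_pos by (simp_all add: S_def D_def)
  show "radial_coeff t > 0" using A 1 by (simp add: radial_coeff_def)
qed

lemma l_deriv [derivative_intros]: assumes "t > 0"
  shows "(l has_real_derivative deriv l t) (at t)"
    and "(deriv l has_real_derivative deriv (deriv l) t) (at t)"
    and "(deriv (deriv l) has_real_derivative deriv (deriv (deriv l)) t) (at t)"
  using assms smooth_on_deriv[OF smooth_l] smooth_on_deriv[OF smooth_on_deriv(1)[OF smooth_l]]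
    smooth_on_deriv[OF smooth_on_deriv(1)[OF smooth_on_deriv(1)[OF smooth_l]]] by auto

lemma S_deriv: assumes "t > 0" shows "(S has_real_derivative S' t) (at t)"
  unfolding S_def[abs_def] S'_def by (rule derivative_eq_intros l_deriv assms refl)+ simp

lemma D_deriv: assumes "t > 0" shows "(D has_real_derivative - A\<^sup>2 * l t * S t) (at t)"
  unfolding D_def[abs_def] S_def
  by (rule derivative_eq_intros l_deriv assms refl)+ (simp add: algebra_simps power2_eq_square)

lemma horizontal_coeff_deriv: assumes "t > 0" shows "((\<lambda>t. A * t * (l t)\<^sup>2) has_real_derivative A * l t * S t) (at t)"
  unfolding S_def
  by (rule derivative_eq_intros l_deriv assms refl)+ (simp add: algebra_simps power2_eq_square)

lemma radial_coeff_deriv: assumes t: "t > 0" shows "(radial_coeff has_real_derivative (radial_rate t - 1) * radial_coeff t / t) (at t)"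
proof -
  have n: "S t \<noteq> 0" "D t \<noteq> 0" "t \<noteq> 0" using pos[OF t] t by auto
  have "(radial_coeff has_real_derivative ((A * (2 * S t * S' t)) * D t - A * (S t)\<^sup>2 * (- A\<^sup>2 * l t * S t)) / (D t * D t)) (at t)"
    unfolding radial_coeff_def[abs_def]
    by (rule derivative_eq_intros S_deriv D_deriv t refl n)+ simp
  moreover have "((A * (2 * S t * S' t)) * D t - A * (S t)\<^sup>2 * (- A\<^sup>2 * l t * S t)) / (D t * D t)
     = (radial_rate t - 1) * radial_coeff t / t"
    using n by (simp add: radial_rate_def radial_coeff_def divide_simps) (simp add: algebra_simps power2_eq_square)
  ultimately show ?thesis by simp
qed

lemma horizontal_rate_deriv: assumes t: "t > 0" shows "(horizontal_rate has_real_derivative horizontal_rate' t) (at t)"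
proof -
  have "l t \<noteq> 0" using pos[OF t] by auto
  then show ?thesis
    unfolding horizontal_rate_def[abs_def] horizontal_rate'_def
    by (auto intro!: derivative_eq_intros S_deriv l_deriv t simp: power2_eq_square)
qed

lemma radial_rate_differentiable: assumes t: "t > 0" shows "radial_rate differentiable (at t)"
proof -
  have n: "S t \<noteq> 0" "D t \<noteq> 0" using pos[OF t] by auto
  have d: "S differentiable (at t)" "D differentiable (at t)" "l differentiable (at t)"
     "deriv l differentiable (at t)" "deriv (deriv l) differentiable (at t)"
    using S_deriv[OF t] D_deriv[OF t] l_deriv[OF t] real_differentiable_def by blast+
  have "S' differentiable (at t)"
    unfolding S'_def[abs_def] using d by (intro differentiable_add differentiable_mult) auto
  then show ?thesis
    unfolding radial_rate_def[abs_def] using n d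
    by (intro differentiable_add differentiable_mult differentiable_divide) auto
qed

text \<open>The second derivative of \<open>l\<close> cancels, and what remains has a sign. In terms of
  \<open>\<theta>\<close> with \<open>A \<sqroot>t l t = \<sqroot>(2c) sin \<theta>\<close> it is \<open>(E \<theta>)\<^sup>2\<close>, in accordance with
  \<open>-(sin \<theta>)'' / sin \<theta> = 1\<close>.\<close>

lemma curvature_function:
  assumes t: "t > 0"
  shows "radial_rate t * horizontal_rate t - (horizontal_rate t)\<^sup>2 - 2 * t * horizontal_rate' t = t * A\<^sup>2 * (S t)\<^sup>2 / D t"
proof -
  have n: "S t \<noteq> 0" "D t \<noteq> 0" "l t \<noteq> 0" using pos[OF t] by auto
  have m: "2 * t * deriv l t = S t - l t" by (simp add: S_def)
  have 1: "radial_rate t * horizontal_rate t = S t / l t + 2 * t * S' t / l t + t * A\<^sup>2 * (S t)\<^sup>2 / D t"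
    using n unfolding radial_rate_def horizontal_rate_def by (simp add: divide_simps) (simp add: algebra_simps power2_eq_square)
  have "2 * t * horizontal_rate' t = 2 * t * S' t / l t - S t * (2 * t * deriv l t) / (l t)\<^sup>2"
    using n unfolding horizontal_rate'_def by (simp add: divide_simps power2_eq_square) (simp add: algebra_simps)
  also have "\<dots> = 2 * t * S' t / l t - (S t)\<^sup>2 / (l t)\<^sup>2 + S t / l t"
    unfolding m using n by (simp add: divide_simps power2_eq_square) (simp add: algebra_simps)
  finally have "2 * t * horizontal_rate' t = 2 * t * S' t / l t - (S t)\<^sup>2 / (l t)\<^sup>2 + S t / l t" .
  moreover have "(horizontal_rate t)\<^sup>2 = (S t)\<^sup>2 / (l t)\<^sup>2" by (simp add: horizontal_rate_def power_divide)
  ultimately show ?thesis using 1 by simp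
qed

text \<open>The radial component of \<open>G\<close> on the vertical distribution.\<close>

lemma radial_coefficient:
  assumes t: "t > 0"
  shows "1 / (A * t) - (c - A\<^sup>2 * t * ((l t)\<^sup>2 + 2 * t * deriv l t * (l t + t * deriv l t)))
       / (A * t\<^sup>2 * (2 * c - A\<^sup>2 * t * (l t)\<^sup>2)) * (2 * t) = radial_coeff t"
proof -
  have n: "D t \<noteq> 0" "t \<noteq> 0" "A \<noteq> 0" using pos[OF t] t A by auto
  have c: "2 * c = D t + A\<^sup>2 * t * (l t)\<^sup>2" by (simp add: D_def)
  have "1 / (A * t) - (c - A\<^sup>2 * t * ((l t)\<^sup>2 + 2 * t * deriv l t * (l t + t * deriv l t)))
       / (A * t\<^sup>2 * D t) * (2 * t)
     = (D t - (2 * c - 2 * A\<^sup>2 * t * ((l t)\<^sup>2 + 2 * t * deriv l t * (l t + t * deriv l t)))) / (A * t * D t)"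
    using n by (simp add: divide_simps power2_eq_square)
  also have "\<dots> = A\<^sup>2 * t * (S t)\<^sup>2 / (A * t * D t)"
    unfolding c S_def by (simp add: algebra_simps power2_eq_square)
  also have "\<dots> = radial_coeff t" using n by (simp add: radial_coeff_def power2_eq_square)
  finally show ?thesis by (simp add: D_def)
qed

end


section \<open>The structure in a chart of the cotangent bundle\<close>

lemma join_expand: "join a b = (\<Sum>i\<in>UNIV. a $ i *\<^sub>R axis (Inl i) 1) + (\<Sum>i\<in>UNIV. b $ i *\<^sub>R axis (Inr i) 1)"
proof -
  have "(\<Sum>i\<in>UNIV. a $ i *\<^sub>R axis (Inl i) 1) = join a 0" "(\<Sum>i\<in>UNIV. b $ i *\<^sub>R axis (Inr i) 1) = join 0 b"
    by (auto simp: vec_eq_iff join_def axis_def if_distrib cong: if_cong split: sum.split)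
  then show ?thesis by (auto simp: join_def vec_eq_iff split: sum.split)
qed

lemma join_add: "join a b + join a' b' = join (a + a') (b + b')"
  and join_scaleR: "k *\<^sub>R join a b = join (k *\<^sub>R a) (k *\<^sub>R b)"
  by (auto simp: join_def vec_eq_iff split: sum.split)

lemma adapted_frame_expand:
  "(\<Sum>i\<in>UNIV. a $ i *\<^sub>R (axis (Inl i) 1 + (\<Sum>h\<in>UNIV. N i h *\<^sub>R axis (Inr h) 1)))
     + (\<Sum>i\<in>UNIV. b $ i *\<^sub>R axis (Inr i) 1) = join a (b + (\<chi> h. \<Sum>i\<in>UNIV. a $ i * N i h))"
proof -
  have "(\<Sum>i\<in>UNIV. a $ i *\<^sub>R (\<Sum>h\<in>UNIV. N i h *\<^sub>R axis (Inr h) 1))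
     = (\<Sum>h\<in>UNIV. \<Sum>i\<in>UNIV. (a $ i * N i h) *\<^sub>R (axis (Inr h) 1 :: real^('a + 'a)))"
    by (simp add: scaleR_sum_right) (rule sum.swap)
  also have "\<dots> = (\<Sum>h\<in>UNIV. (\<chi> h. \<Sum>i\<in>UNIV. a $ i * N i h) $ h *\<^sub>R axis (Inr h) 1)"
    by (simp add: scaleR_sum_left)
  finally show ?thesis
    unfolding join_expand by (simp add: scaleR_add_right sum.distrib scaleR_add_left)
qed

text \<open>A chart \<open>\<phi>\<close> of the base is fixed. The interpretations \<open>base\<close> and \<open>tm\<close> provide the calculus of
  the metric \<open>g\<close> in this chart and of the Kaehler structure in the induced chart.\<close>

locale cotangent_kaehler = profile A c l for A c :: real and l +
  fixes X :: "'m topology" and \<A> :: "('m, 'n::finite) chart set" and g :: "('m, 'n) metric"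
    and G :: "(('m, 'n) cotangent, 'n + 'n) metric"
    and J :: "(('m, 'n) cotangent, 'n + 'n) endo_field"
    and \<phi> :: "('m, 'n) chart"
  assumes M: "smooth_manifold X \<A>" and g: "riemannian_metric \<A> g"
    and K: "kaehler_structure (cotangent0_atlas \<A>) G J"
    and given_J: "given_J A c l \<A> g J" and given_G: "given_G A c l \<A> g G"
    and \<phi>: "\<phi> \<in> \<A>"
begin

abbreviation "\<Phi> \<equiv> cotangent0_chart \<A> \<phi>"
abbreviation "U \<equiv> snd \<phi> ` fst \<phi>"
abbreviation "hb \<equiv> metric_coords \<A> g \<phi>"
abbreviation "V \<equiv> snd \<Phi> ` fst \<Phi>"

sublocale base: local_metric U hb
  by (rule local_metric_coords[OF smooth_manifold_atlas[OF M] \<phi> g])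

lemma \<Phi>: "\<Phi> \<in> cotangent0_atlas \<A>" using \<phi> by (simp add: cotangent0_atlas_def)

lemmas atlas = cotangent0_atlas_differentiable[OF M]

sublocale tm: local_kaehler V "metric_coords (cotangent0_atlas \<A>) G \<Phi>" "endo_coords (cotangent0_atlas \<A>) J \<Phi>"
  by (rule local_kaehler_coords[OF atlas \<Phi> K])

lemma V_iff: "y \<in> V \<longleftrightarrow> q_part y \<in> U \<and> p_part y \<noteq> 0"
  using cotangent0_image[OF M \<phi>, of \<phi>] by simp

definition sharp :: "real^'n \<Rightarrow> real^'n \<Rightarrow> real^'n" where "sharp q b = raise (hb q) b"

lemma linear_sharp: "linear (sharp q)"
  by (auto intro!: linearI simp: sharp_def raise_def vec_eq_iff algebra_simps sum.distrib sum_distrib_left)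

lemma sharp_scaleR [simp]: "sharp q (k *\<^sub>R b) = k *\<^sub>R sharp q b" and sharp_0 [simp]: "sharp q 0 = 0"
  by (auto simp: linear_cmul[OF linear_sharp] linear_0[OF linear_sharp])

lemma hb_sharp: assumes q: "q \<in> U" shows "hb q *v sharp q b = b"
proof -
  have tr: "transpose (hb q) = hb q" using base.sym_h[OF q] by (simp add: transpose_def vec_eq_iff)
  have "sharp q b = b v* matrix_inv (hb q)"
    by (simp add: sharp_def raise_def vector_matrix_mult_def vec_eq_iff mult.commute)
  then have "hb q *v sharp q b = b v* (matrix_inv (hb q) ** hb q)"
    by (metis tr transpose_matrix_vector vector_matrix_mul_assoc)
  then show ?thesis by (simp add: matrix_inv_mult[OF base.invertible_h[OF q]])
qed

lemma base_H_sharp: assumes q: "q \<in> U" shows "base.H q a (sharp q b) = a \<bullet> b"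
  by (simp add: base.H_def hb_sharp[OF q])

lemma sharp_sym: assumes q: "q \<in> U" shows "sharp q a \<bullet> b = a \<bullet> sharp q b"
  using base.H_sym[OF q, of "sharp q a" "sharp q b"] by (simp add: base_H_sharp[OF q] inner_commute)

lemma sharp_pos: assumes q: "q \<in> U" and b: "b \<noteq> 0" shows "sharp q b \<bullet> b > 0" "sharp q b \<noteq> 0"
proof -
  show n: "sharp q b \<noteq> 0" using hb_sharp[OF q, of b] b by auto
  show "sharp q b \<bullet> b > 0" using base.H_pos[OF q n] by (simp add: base_H_sharp[OF q])
qed

text \<open>In a chart of the cotangent bundle \<open>r\<close> is \<open>g\<^sup>0\<^sup>i\<close>, \<open>t\<close> is the energy density, \<open>gamma0 y a\<close> is \<open>\<Gamma>\<^sup>0\<^sub>i\<^sub>j a\<^sup>j\<close>,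
  \<open>dp y\<close> consists of the forms \<open>Dp\<^sub>i\<close>, and \<open>hor y a\<close> is the horizontal lift of \<open>a\<close>.\<close>

definition r :: "real^('n + 'n) \<Rightarrow> real^'n" where "r y = sharp (q_part y) (p_part y)"
definition t :: "real^('n + 'n) \<Rightarrow> real" where "t y = (1/2) * (r y \<bullet> p_part y)"
definition gamma0 :: "real^('n + 'n) \<Rightarrow> real^'n \<Rightarrow> real^'n" where
  "gamma0 y a = (\<chi> i. \<Sum>j\<in>UNIV. (\<Sum>k\<in>UNIV. p_part y $ k * christoffel hb (q_part y) k i j) * a $ j)"
definition dp :: "real^('n + 'n) \<Rightarrow> real^('n + 'n) \<Rightarrow> real^'n" where
  "dp y v = p_part v - gamma0 y (q_part v)"
definition hor :: "real^('n + 'n) \<Rightarrow> real^'n \<Rightarrow> real^('n + 'n)" where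
  "hor y a = join a (gamma0 y a)"

lemma t_pos: "y \<in> V \<Longrightarrow> t y > 0"
  unfolding V_iff t_def r_def by (simp add: sharp_pos)

lemma linear_gamma0: "linear (gamma0 y)"
  by (auto intro!: linearI simp: gamma0_def vec_eq_iff algebra_simps sum.distrib sum_distrib_left)

lemma dp_hor [simp]: "dp y (hor y a) = 0" by (simp add: dp_def hor_def)

lemma dp_vertical [simp]: "dp y (join 0 b) = b" by (simp add: dp_def linear_0[OF linear_gamma0])

lemma inner_gamma0: "w \<bullet> gamma0 y a = base.\<Gamma> (q_part y) w a \<bullet> p_part y"
proof -
  have "w \<bullet> gamma0 y a = (\<Sum>i\<in>UNIV. \<Sum>j\<in>UNIV. \<Sum>k\<in>UNIV. p_part y $ k * (w $ i * a $ j * christoffel hb (q_part y) k i j))"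
    by (simp add: gamma0_def inner_vec_def sum_distrib_left sum_distrib_right mult_ac)
  also have "\<dots> = (\<Sum>k\<in>UNIV. \<Sum>i\<in>UNIV. \<Sum>j\<in>UNIV. p_part y $ k * (w $ i * a $ j * christoffel hb (q_part y) k i j))"
    by (rule sum_rotate)
  also have "\<dots> = base.\<Gamma> (q_part y) w a \<bullet> p_part y"
    by (simp add: base.\<Gamma>_def inner_vec_def sum_distrib_left mult_ac)
  finally show ?thesis .
qed

text \<open>The frame and the coframe contract \<open>\<Gamma>\<^sup>0\<^sub>i\<^sub>j\<close> with different indices; they agree by the symmetry of
  the Christoffel symbols.\<close>

lemma gamma0_christoffel0:
  assumes y: "y \<in> V"
  shows "(\<Sum>i\<in>UNIV. a $ i * (\<Sum>k\<in>UNIV. p_part y $ k * christoffel hb (q_part y) k i h)) = gamma0 y a $ h"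
proof -
  have "(\<Sum>i\<in>UNIV. a $ i * (\<Sum>k\<in>UNIV. p_part y $ k * christoffel hb (q_part y) k i h)) = a \<bullet> gamma0 y (axis h 1)"
    by (simp add: gamma0_def inner_vec_def axis_def if_distrib cong: if_cong)
  also have "\<dots> = axis h 1 \<bullet> gamma0 y a"
    using y base.\<Gamma>_sym[of "q_part y" a "axis h 1"] by (simp add: inner_gamma0 V_iff)
  finally show ?thesis by (simp add: inner_axis')
qed

lemma chart_point:
  assumes y: "y \<in> V"
  obtains P where "P \<in> fst \<Phi>" "snd \<Phi> P = y" "fibre_coords \<A> \<phi> P = p_part y"
    "base_metric \<A> g \<phi> P = hb (q_part y)" "energy_density \<A> g \<phi> P = t y"
    "\<forall>i h. christoffel0 \<A> g \<phi> P i h = (\<Sum>k\<in>UNIV. p_part y $ k * christoffel hb (q_part y) k i h)"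
proof -
  obtain P where P: "P \<in> fst \<Phi>" "snd \<Phi> P = y" using y by auto
  have q: "snd \<phi> (fst P) = q_part y" and p: "fibre_coords \<A> \<phi> P = p_part y"
    using P(2) by (auto simp: snd_cotangent0_chart)
  have b: "base_metric \<A> g \<phi> P = hb (q_part y)" by (simp add: base_metric_def q)
  \<comment> \<open>\<open>raise\<close> contracts the first index of the inverse matrix, hence the interchange of the sums.\<close>
  have e: "energy_density \<A> g \<phi> P = t y"
  proof -
    have "(\<Sum>i\<in>UNIV. \<Sum>j\<in>UNIV. matrix_inv (hb (q_part y)) $ i $ j * p_part y $ i * p_part y $ j)
      = (\<Sum>j\<in>UNIV. \<Sum>i\<in>UNIV. p_part y $ i * matrix_inv (hb (q_part y)) $ i $ j * p_part y $ j)"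
      by (rule sum_swap_eq) simp
    then show ?thesis
      by (simp add: energy_density_def b p t_def r_def sharp_def raise_def inner_vec_def sum_distrib_right)
  qed
  show ?thesis
    by (rule that[OF P p b e]) (simp add: christoffel0_def p q)
qed

definition G1_radial :: "real^('n + 'n) \<Rightarrow> real" where
  "G1_radial y = (c - A\<^sup>2 * t y * (l (t y))\<^sup>2) / (A * t y)"
definition G2_radial :: "real^('n + 'n) \<Rightarrow> real" where
  "G2_radial y = (c - A\<^sup>2 * t y * ((l (t y))\<^sup>2 + 2 * t y * deriv l (t y) * (l (t y) + t y * deriv l (t y))))
       / (A * (t y)\<^sup>2 * (2 * c - A\<^sup>2 * t y * (l (t y))\<^sup>2))"

lemma H_formula:
  assumes y: "y \<in> V"
  shows "tm.H y u v = A * t y * (l (t y))\<^sup>2 * base.H (q_part y) (q_part u) (q_part v)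
     + G1_radial y * ((p_part y \<bullet> q_part u) * (p_part y \<bullet> q_part v))
     + 1 / (A * t y) * (sharp (q_part y) (dp y u) \<bullet> dp y v) - G2_radial y * ((r y \<bullet> dp y u) * (r y \<bullet> dp y v))"
proof -
  obtain P where P: "P \<in> fst \<Phi>" "snd \<Phi> P = y" "fibre_coords \<A> \<phi> P = p_part y"
    "base_metric \<A> g \<phi> P = hb (q_part y)" "energy_density \<A> g \<phi> P = t y"
    "\<forall>i h. christoffel0 \<A> g \<phi> P i h = (\<Sum>k\<in>UNIV. p_part y $ k * christoffel hb (q_part y) k i h)"
    using chart_point[OF y] by blast
  define u' where "u' = tvec (cotangent0_atlas \<A>) \<Phi> P u"
  define v' where "v' = tvec (cotangent0_atlas \<A>) \<Phi> P v"
  have in_T: "u' \<in> tangent_space (cotangent0_atlas \<A>) P" "v' \<in> tangent_space (cotangent0_atlas \<A>) P"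
    unfolding u'_def v'_def by (rule tvec_in_tangent_space[OF atlas \<Phi> P(1)])+
  have dq: "dq \<A> \<phi> i u' = q_part u $ i" "dq \<A> \<phi> i v' = q_part v $ i" for i
    by (simp_all add: dq_def u'_def v'_def tvec_self[OF atlas \<Phi> P(1)] q_part_def)
  have Dp: "Dp \<A> g \<phi> P i u' = dp y u $ i" "Dp \<A> g \<phi> P i v' = dp y v $ i" for i
    unfolding Dp_def dq dp_def gamma0_def P(6)[rule_format]
    by (simp_all add: u'_def v'_def tvec_self[OF atlas \<Phi> P(1)] p_part_def)
  have "tm.H y u v = G P u' v'"
    unfolding tm.H_def P(2)[symmetric] u'_def v'_def
    using metric_coords_tvec[OF atlas \<Phi> P(1), of G u v] K by (simp add: kaehler_structure_def)
  also have "\<dots> = (\<Sum>i\<in>UNIV. \<Sum>j\<in>UNIV.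
       G1_coeff A c l (t y) (hb (q_part y)) (p_part y) i j * q_part u $ i * q_part v $ j
     + G2_coeff A c l (t y) (hb (q_part y)) (p_part y) i j * dp y u $ i * dp y v $ j)"
    using given_G \<phi> P(1) in_T by (simp add: given_G_def Let_def P dq Dp)
  also have "\<dots> = (\<Sum>i\<in>UNIV. \<Sum>j\<in>UNIV.
       A * t y * (l (t y))\<^sup>2 * (q_part u $ i * q_part v $ j * hb (q_part y) $ i $ j)
     + G1_radial y * ((p_part y $ i * q_part u $ i) * (p_part y $ j * q_part v $ j))
     + 1 / (A * t y) * (dp y u $ i * matrix_inv (hb (q_part y)) $ i $ j * dp y v $ j)
     - G2_radial y * ((r y $ i * dp y u $ i) * (r y $ j * dp y v $ j)))"
    unfolding G1_coeff_def G2_coeff_def G1_radial_def[symmetric] G2_radial_def[symmetric] sharp_def[symmetric] r_def[symmetric]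
    by (intro sum.cong refl) (simp add: algebra_simps)
  also have "\<dots> = A * t y * (l (t y))\<^sup>2 * (\<Sum>i\<in>UNIV. \<Sum>j\<in>UNIV. (q_part u $ i * q_part v $ j * hb (q_part y) $ i $ j))
     + G1_radial y * (\<Sum>i\<in>UNIV. \<Sum>j\<in>UNIV. ((p_part y $ i * q_part u $ i) * (p_part y $ j * q_part v $ j)))
     + 1 / (A * t y) * (\<Sum>i\<in>UNIV. \<Sum>j\<in>UNIV. (dp y u $ i * matrix_inv (hb (q_part y)) $ i $ j * dp y v $ j))
     - G2_radial y * (\<Sum>i\<in>UNIV. \<Sum>j\<in>UNIV. ((r y $ i * dp y u $ i) * (r y $ j * dp y v $ j)))"
    unfolding sum_distrib_left sum.distrib sum_subtractf ..
  also have "(\<Sum>i\<in>UNIV. \<Sum>j\<in>UNIV. (q_part u $ i * q_part v $ j * hb (q_part y) $ i $ j))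
     = base.H (q_part y) (q_part u) (q_part v)" by (simp add: base.H_sum)
  also have "(\<Sum>i\<in>UNIV. \<Sum>j\<in>UNIV. ((p_part y $ i * q_part u $ i) * (p_part y $ j * q_part v $ j)))
     = (p_part y \<bullet> q_part u) * (p_part y \<bullet> q_part v)" by (simp add: inner_vec_def sum_product)
  also have "(\<Sum>i\<in>UNIV. \<Sum>j\<in>UNIV. ((r y $ i * dp y u $ i) * (r y $ j * dp y v $ j)))
     = (r y \<bullet> dp y u) * (r y \<bullet> dp y v)" by (simp add: inner_vec_def sum_product)
  also have "(\<Sum>i\<in>UNIV. \<Sum>j\<in>UNIV. (dp y u $ i * matrix_inv (hb (q_part y)) $ i $ j * dp y v $ j))
     = sharp (q_part y) (dp y u) \<bullet> dp y v"
    by (simp add: sharp_def raise_def inner_vec_def sum_distrib_right) (rule sum.swap)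
  finally show ?thesis .
qed

text \<open>On vertical vectors annihilated by \<open>g\<^sup>0\<^sup>i\<close> the rank one term of \<open>J\<close> vanishes.\<close>

lemma J_vertical:
  assumes y: "y \<in> V" and b: "r y \<bullet> b = 0"
  shows "tm.J y (join 0 b) = hor y (- (1 / (A * t y * l (t y))) *\<^sub>R sharp (q_part y) b)"
proof -
  obtain P where P: "P \<in> fst \<Phi>" "snd \<Phi> P = y" "fibre_coords \<A> \<phi> P = p_part y"
    "base_metric \<A> g \<phi> P = hb (q_part y)" "energy_density \<A> g \<phi> P = t y"
    "\<forall>i h. christoffel0 \<A> g \<phi> P i h = (\<Sum>k\<in>UNIV. p_part y $ k * christoffel hb (q_part y) k i h)"
    using chart_point[OF y] by blast
  define J2 where "J2 i j = J2_coeff A c l (t y) (hb (q_part y)) (p_part y) i j" for i j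
  have ad: "adapted_vec \<A> g \<phi> P a e = tvec (cotangent0_atlas \<A>) \<Phi> P (join a (e + gamma0 y a))" for a e
  proof -
    have "(\<chi> h. \<Sum>i\<in>UNIV. a $ i * christoffel0 \<A> g \<phi> P i h) = gamma0 y a"
      by (simp add: vec_eq_iff P(6)[rule_format] gamma0_christoffel0[OF y])
    then show ?thesis unfolding adapted_vec_def adapted_frame_expand by simp
  qed
  have Jt: "J P (tvec (cotangent0_atlas \<A>) \<Phi> P u) = tvec (cotangent0_atlas \<A>) \<Phi> P (tm.J y u)" for u
    using endo_coords_tvec[OF atlas \<Phi> P(1), of J u] K by (simp add: tm.J_def P(2) kaehler_structure_def)
  have ax: "tm.J y (join 0 (axis i 1)) = hor y (\<chi> j. - J2 i j)" for i
  proof -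
    have "J P (ver_frame \<A> g \<phi> P i) = adapted_vec \<A> g \<phi> P (\<chi> j. - J2 i j) 0"
      using given_J \<phi> P(1) by (simp add: given_J_def Let_def P J2_def)
    then have "tvec (cotangent0_atlas \<A>) \<Phi> P (tm.J y (join 0 (axis i 1))) = tvec (cotangent0_atlas \<A>) \<Phi> P (hor y (\<chi> j. - J2 i j))"
      unfolding ver_frame_def ad Jt by (simp add: hor_def linear_0[OF linear_gamma0])
    then show ?thesis using tvec_self[OF atlas \<Phi> P(1)] by metis
  qed
  have lin_hor: "linear (hor y)"
    by (auto intro!: linearI simp: hor_def linear_add[OF linear_gamma0] linear_cmul[OF linear_gamma0] join_add join_scaleR)
  have "linear (join 0 :: real^'n \<Rightarrow> _)"
    by (auto intro!: linearI simp: join_def vec_eq_iff split: sum.split)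
  then have lin: "linear (\<lambda>b. tm.J y (join 0 b))"
    using linear_compose[OF _ tm.linear_J] by (force simp: o_def)
  have "tm.J y (join 0 b) = (\<Sum>i\<in>UNIV. b $ i *\<^sub>R hor y (\<chi> j. - J2 i j))"
    by (subst linear_expand[OF lin]) (simp add: ax)
  also have "\<dots> = hor y (\<Sum>i\<in>UNIV. b $ i *\<^sub>R (\<chi> j. - J2 i j))"
    by (simp add: linear_sum[OF lin_hor] linear_cmul[OF lin_hor])
  also have "(\<Sum>i\<in>UNIV. b $ i *\<^sub>R (\<chi> j. - J2 i j)) = - (1 / (A * t y * l (t y))) *\<^sub>R sharp (q_part y) b"
  proof (simp only: vec_eq_iff, intro allI)
    fix j
    let ?k = "(c - A\<^sup>2 * t y * l (t y) * (l (t y) + t y * deriv l (t y))) /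
        (A * (t y)\<^sup>2 * l (t y) * (2 * c - A\<^sup>2 * t y * (l (t y))\<^sup>2))"
    have "(\<Sum>i\<in>UNIV. b $ i *\<^sub>R (\<chi> j. - J2 i j)) $ j
      = (\<Sum>i\<in>UNIV. (- (1 / (A * t y * l (t y)))) * (b $ i * matrix_inv (hb (q_part y)) $ i $ j) + ?k * r y $ j * (r y $ i * b $ i))"
      unfolding J2_def J2_coeff_def sharp_def[symmetric] r_def[symmetric]
      by (simp add: sum_component) (intro sum.cong refl, simp add: algebra_simps)
    also have "\<dots> = (- (1 / (A * t y * l (t y)))) * (\<Sum>i\<in>UNIV. b $ i * matrix_inv (hb (q_part y)) $ i $ j)
       + ?k * r y $ j * (\<Sum>i\<in>UNIV. r y $ i * b $ i)"
      unfolding sum_distrib_left sum.distrib ..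
    also have "(\<Sum>i\<in>UNIV. r y $ i * b $ i) = 0" using b by (simp add: inner_vec_def)
    also have "(\<Sum>i\<in>UNIV. b $ i * matrix_inv (hb (q_part y)) $ i $ j) = sharp (q_part y) b $ j"
      by (simp add: sharp_def raise_def)
    finally show "(\<Sum>i\<in>UNIV. b $ i *\<^sub>R (\<chi> j. - J2 i j)) $ j = (- (1 / (A * t y * l (t y))) *\<^sub>R sharp (q_part y) b) $ j"
      by simp
  qed
  finally show ?thesis .
qed

end


section \<open>The radial field and the contradiction\<close>

lemma deriv_at_0_cong:
  assumes "(f has_real_derivative D) (at 0)" "\<And>s::real. s > -1 \<Longrightarrow> f s = f' s"
  shows "(f' has_real_derivative D) (at 0)"
  by (rule has_field_derivative_transform_within_open[OF assms(1), of "{-1<..}"]) (use assms(2) in auto)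

lemma scaling_deriv:
  assumes "(f has_real_derivative d) (at (t0::real))"
  shows "((\<lambda>s. f ((1 + s)\<^sup>2 * t0)) has_real_derivative d * (2 * t0)) (at 0)"
proof -
  have "((\<lambda>s. (1 + s)\<^sup>2 * t0) has_real_derivative 2 * t0) (at 0)"
    by (auto intro!: derivative_eq_intros)
  then show ?thesis using DERIV_chain2[of f d "\<lambda>s. (1 + s)\<^sup>2 * t0" 0 "2 * t0" UNIV] assms by simp
qed

context cotangent_kaehler
begin

lemma differentiable_nth_p: "(\<lambda>z. p_part z $ k) differentiable (at y)"
  by (rule differentiable_nth[OF differentiableI[OF parts_has_derivative(2)]])

lemma differentiable_base:
  assumes y: "y \<in> V" and f: "\<And>q. q \<in> U \<Longrightarrow> f differentiable (at q)"
  shows "(\<lambda>z. f (q_part z)) differentiable (at y)"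
  by (rule differentiable_compose[where f = f and g = q_part])
    (use y f V_iff differentiableI[OF parts_has_derivative(1)] in auto)

lemma differentiable_r: assumes y: "y \<in> V" shows "r differentiable (at y)"
proof (rule differentiable_vec)
  fix i
  have "(\<lambda>q. matrix_inv (hb q) $ k $ i) differentiable (at q)" if "q \<in> U" for q k
    by (rule differentiable_matrix_inv[OF base.open_V that base.invertible_h
        smooth_on_differentiable[OF base.smooth_h that]])
  from differentiable_base[OF y this]
  show "(\<lambda>z. r z $ i) differentiable (at y)"
    unfolding r_def sharp_def raise_def vec_lambda_beta
    by (intro differentiable_sum ballI differentiable_mult differentiable_nth_p) auto
qed

lemma differentiable_gamma0: assumes y: "y \<in> V" shows "(\<lambda>z. gamma0 z a) differentiable (at y)"
proof (rule differentiable_vec)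
  fix i
  show "(\<lambda>z. gamma0 z a $ i) differentiable (at y)"
    unfolding gamma0_def vec_lambda_beta
    by (intro differentiable_sum ballI differentiable_mult differentiable_nth_p differentiable_const
        differentiable_base[OF y base.differentiable_christoffel]) auto
qed

lemma differentiable_r_dp: assumes y: "y \<in> V" shows "(\<lambda>z. r z \<bullet> dp z v) differentiable (at y)"
proof -
  have "(\<lambda>z. dp z v) differentiable (at y)"
    unfolding dp_def by (intro differentiable_diff differentiable_const differentiable_gamma0 y)
  from differentiableI[OF has_derivative_inner[OF ddir_has[OF differentiable_r[OF y]] ddir_has[OF this]]]
  show ?thesis .
qed

text \<open>Writing \<open>t\<close> as \<open>p(r) - g(r, r) / 2\<close> makes it stationary in \<open>r\<close>, so no derivative of the inverse
  matrix enters. The remaining derivative of the metric is \<open>-\<Gamma>\<^sup>0(r, a)\<close> by metric compatibility,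
  and the result says that \<open>t\<close> is constant along horizontal curves.\<close>

lemma t_has_derivative:
  assumes y: "y \<in> V"
  shows "(t has_derivative (\<lambda>v. r y \<bullet> dp y v)) (at y)"
proof -
  have q: "q_part y \<in> U" using y V_iff by blast
  have qd: "((\<lambda>z. base.H (q_part z) w x) has_derivative (\<lambda>v. base.dH (q_part y) (q_part v) w x)) (at y)" for w x
    unfolding base.dH_def
    by (rule has_derivative_compose[OF parts_has_derivative(1) ddir_has[OF base.differentiable_H[OF q]]])
  have 1: "((\<lambda>z. base.H (q_part z) w (r z)) has_derivative
     (\<lambda>v. ddir (\<lambda>z. base.H (q_part z) w (r y)) y v + base.H (q_part y) w (ddir r y v))) (at y)" for w
    by (rule has_derivative_linear_family[OF tm.open_V y base.linear_H_r differentiableI[OF qd] differentiable_r[OF y]])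
  have 2: "((\<lambda>z. base.H (q_part z) (r z) (r z)) has_derivative
     (\<lambda>v. ddir (\<lambda>z. base.H (q_part z) (r y) (r z)) y v + base.H (q_part y) (ddir r y v) (r y))) (at y)"
    by (rule has_derivative_linear_family[where B = "\<lambda>z x. base.H (q_part z) x (r z)",
        OF tm.open_V y base.linear_H_l differentiableI[OF 1] differentiable_r[OF y]])
  have 3: "ddir (\<lambda>z. base.H (q_part z) (r y) (r z)) y v
     = base.dH (q_part y) (q_part v) (r y) (r y) + base.H (q_part y) (r y) (ddir r y v)" for v
    unfolding ddir_eqI[OF 1] ddir_eqI[OF qd] ..
  have Hr: "base.H (q_part z) x (r z) = x \<bullet> p_part z" if "z \<in> V" for z x
    using that by (simp add: r_def base_H_sharp V_iff)
  have "((\<lambda>z. r z \<bullet> p_part z - (1/2) * base.H (q_part z) (r z) (r z)) has_derivative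
     (\<lambda>v. (r y \<bullet> p_part v + ddir r y v \<bullet> p_part y) - (1/2) *
        (base.dH (q_part y) (q_part v) (r y) (r y) + base.H (q_part y) (r y) (ddir r y v)
          + base.H (q_part y) (ddir r y v) (r y)))) (at y)"
    using has_derivative_diff[OF has_derivative_inner[OF ddir_has[OF differentiable_r[OF y]] parts_has_derivative(2)]
        has_derivative_mult_right[OF 2, of "1/2"]] unfolding 3 .
  then have D: "(t has_derivative
     (\<lambda>v. (r y \<bullet> p_part v + ddir r y v \<bullet> p_part y) - (1/2) *
        (base.dH (q_part y) (q_part v) (r y) (r y) + base.H (q_part y) (r y) (ddir r y v)
          + base.H (q_part y) (ddir r y v) (r y)))) (at y)"
    by (rule has_derivative_transform_within_open[OF _ tm.open_V y]) (simp add: Hr t_def)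
  have "(r y \<bullet> p_part v + ddir r y v \<bullet> p_part y) - (1/2) *
        (base.dH (q_part y) (q_part v) (r y) (r y) + base.H (q_part y) (r y) (ddir r y v)
          + base.H (q_part y) (ddir r y v) (r y)) = r y \<bullet> dp y v" for v
  proof -
    have "base.dH (q_part y) (q_part v) (r y) (r y) = 2 * (r y \<bullet> gamma0 y (q_part v))"
      using base.metric_compat[OF q, of "q_part v" "r y" "r y"] base.\<Gamma>_sym[OF q, of "r y" "q_part v"]
        base.H_sym[OF q, of "r y" "base.\<Gamma> (q_part y) (q_part v) (r y)"]
      by (simp add: inner_gamma0 Hr[OF y])
    moreover have "base.H (q_part y) (r y) (ddir r y v) = ddir r y v \<bullet> p_part y"
      using base.H_sym[OF q, of "r y" "ddir r y v"] by (simp add: Hr[OF y])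
    ultimately show ?thesis by (simp add: Hr[OF y] dp_def inner_simps add_divide_distrib)
  qed
  then show ?thesis using D by simp
qed

lemma differentiable_t: "y \<in> V \<Longrightarrow> t differentiable (at y)"
  using t_has_derivative by (rule differentiableI)

text \<open>The radial field \<open>p\<^sub>i \<partial>/\<partial>p\<^sub>i\<close>.\<close>

definition E :: "real^('n + 'n) \<Rightarrow> real^('n + 'n)" where "E y = join 0 (p_part y)"

lemma E_parts [simp]: "q_part (E y) = 0" "p_part (E y) = p_part y"
  by (simp_all add: E_def)

lemma dp_E [simp]: "dp y (E v) = p_part v" by (simp add: E_def)

text \<open>Thus \<open>E\<close> is dual to a function of \<open>t\<close> times the differential of \<open>t\<close>, and so it is a gradient field.\<close>

lemma H_E:
  assumes y: "y \<in> V"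
  shows "tm.H y (E y) v = radial_coeff (t y) * (r y \<bullet> dp y v)"
proof -
  have rp: "r y \<bullet> p_part y = 2 * t y" by (simp add: t_def)
  have "tm.H y (E y) v = (1 / (A * t y) - G2_radial y * (2 * t y)) * (r y \<bullet> dp y v)"
    unfolding H_formula[OF y] by (simp add: r_def[symmetric] rp algebra_simps)
  also have "1 / (A * t y) - G2_radial y * (2 * t y) = radial_coeff (t y)"
    unfolding G2_radial_def by (rule radial_coefficient[OF t_pos[OF y]])
  finally show ?thesis .
qed

sublocale rad: closed_linear_field V "metric_coords (cotangent0_atlas \<A>) G \<Phi>" E
proof
  show "E (a + b) = E a + E b" "E (k *\<^sub>R a) = k *\<^sub>R E a" for a b k
    by (simp_all add: E_def join_add join_scaleR)
  show "E (E z) = E z" for z by (simp add: E_def)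
  fix z u v assume z: "z \<in> V"
  have dt: "ddir t x v = r x \<bullet> dp x v" if "x \<in> V" for x v using t_has_derivative[OF that] by (rule ddir_eqI)
  have Fd: "((\<lambda>z. radial_coeff (t z)) has_derivative (\<lambda>u. (radial_rate (t z) - 1) * radial_coeff (t z) / t z * (r z \<bullet> dp z u))) (at z)"
    by (rule has_derivative_compose[OF t_has_derivative[OF z] radial_coeff_deriv[OF t_pos[OF z], unfolded has_field_derivative_def]])
  have d: "ddir (\<lambda>z. tm.H z (E z) v) z u =
     radial_coeff (t z) * ddir (\<lambda>x. ddir t x v) z u + (radial_rate (t z) - 1) * radial_coeff (t z) / t z * (r z \<bullet> dp z u) * (r z \<bullet> dp z v)" for u v
  proof -
    have "((\<lambda>x. r x \<bullet> dp x v) has_derivative (\<lambda>u. ddir (\<lambda>x. r x \<bullet> dp x v) z u)) (at z)"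
      by (rule ddir_has[OF differentiable_r_dp[OF z]])
    from has_derivative_mult[OF Fd this]
    have "((\<lambda>z. tm.H z (E z) v) has_derivative (\<lambda>u. radial_coeff (t z) * ddir (\<lambda>x. r x \<bullet> dp x v) z u
       + (radial_rate (t z) - 1) * radial_coeff (t z) / t z * (r z \<bullet> dp z u) * (r z \<bullet> dp z v))) (at z)"
      by (rule has_derivative_transform_within_open[OF _ tm.open_V z]) (simp add: H_E)
    moreover have "ddir (\<lambda>x. r x \<bullet> dp x v) z u = ddir (\<lambda>x. ddir t x v) z u" for u
      by (rule ddir_cong_open[OF tm.open_V z _ differentiable_r_dp[OF z]]) (simp add: dt)
    ultimately show ?thesis by (simp add: ddir_eqI)
  qed
  have dd: "(\<lambda>x. ddir t x w) differentiable (at z)" for w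
    by (rule differentiable_cong_open[OF tm.open_V z _ differentiable_r_dp[OF z, of w]]) (simp add: dt)
  have "ddir (\<lambda>x. ddir t x v) z u = ddir (\<lambda>x. ddir t x u) z v"
    by (rule ddir_commute[OF tm.open_V z differentiable_t dd dd])
  then show "ddir (\<lambda>z. tm.H z (E z) v) z u = ddir (\<lambda>z. tm.H z (E z) u) z v"
    unfolding d by simp
qed

lemma along_ray:
  assumes y: "y \<in> V" and s: "s > -1"
  shows "y + s *\<^sub>R E y \<in> V" "q_part (y + s *\<^sub>R E y) = q_part y" "p_part (y + s *\<^sub>R E y) = (1 + s) *\<^sub>R p_part y"
    "r (y + s *\<^sub>R E y) = (1 + s) *\<^sub>R r y" "t (y + s *\<^sub>R E y) = (1 + s)\<^sup>2 * t y"
    "gamma0 (y + s *\<^sub>R E y) a = (1 + s) *\<^sub>R gamma0 y a"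
    "dp (y + s *\<^sub>R E y) v = p_part v - (1 + s) *\<^sub>R gamma0 y (q_part v)"
proof -
  show q: "q_part (y + s *\<^sub>R E y) = q_part y" and p: "p_part (y + s *\<^sub>R E y) = (1 + s) *\<^sub>R p_part y"
    by (simp_all add: algebra_simps)
  show "y + s *\<^sub>R E y \<in> V" using y s unfolding V_iff q p by simp
  show r: "r (y + s *\<^sub>R E y) = (1 + s) *\<^sub>R r y" by (simp add: r_def q p del: parts_simps)
  show "t (y + s *\<^sub>R E y) = (1 + s)\<^sup>2 * t y"
    unfolding t_def r p by (simp add: power2_eq_square)
  show c: "gamma0 (y + s *\<^sub>R E y) a = (1 + s) *\<^sub>R gamma0 y a" for a
    unfolding gamma0_def q p by (simp add: vec_eq_iff sum_distrib_left mult_ac)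
  show "dp (y + s *\<^sub>R E y) v = p_part v - (1 + s) *\<^sub>R gamma0 y (q_part v)"
    by (simp add: dp_def c q del: parts_simps)
qed

lemma B_radial:
  assumes z: "z \<in> V" shows "rad.B z (E z) = radial_rate (t z) *\<^sub>R E z"
proof (rule rad.B_eigen[OF z])
  fix v
  let ?X = "r z \<bullet> p_part v" and ?Y = "r z \<bullet> gamma0 z (q_part v)"
  have n: "t z > 0" by (rule t_pos[OF z])
  have eq: "radial_coeff ((1 + s)\<^sup>2 * t z) * ((1 + s) * ?X - (1 + s)\<^sup>2 * ?Y)
     = tm.H (z + s *\<^sub>R E z) (E z + s *\<^sub>R E (E z)) v" if s: "s > -1" for s
  proof -
    have "E z + s *\<^sub>R E (E z) = E (z + s *\<^sub>R E z)" by simp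
    then show ?thesis
      using H_E[OF along_ray(1)[OF z s], of v] along_ray(4,5,7)[OF z s] by (simp add: inner_simps algebra_simps power2_eq_square)
  qed
  have p: "((\<lambda>s. (1 + s) * ?X - (1 + s)\<^sup>2 * ?Y) has_real_derivative ?X - 2 * ?Y) (at 0)"
    by (auto intro!: derivative_eq_intros)
  show "((\<lambda>s. tm.H (z + s *\<^sub>R E z) (E z + s *\<^sub>R E (E z)) v) has_real_derivative
     (radial_rate (t z) - 1) * radial_coeff (t z) / t z * (2 * t z) * (?X - ?Y) + (?X - 2 * ?Y) * radial_coeff (t z)) (at 0)"
    using deriv_at_0_cong[OF DERIV_mult[OF scaling_deriv[OF radial_coeff_deriv[OF n]] p] eq] by simp
  show "(radial_rate (t z) - 1) * radial_coeff (t z) / t z * (2 * t z) * (?X - ?Y) + (?X - 2 * ?Y) * radial_coeff (t z)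
     + tm.H z (E z) (E v) = 2 * radial_rate (t z) * tm.H z (E z) v"
  proof -
    have "(radial_rate (t z) - 1) * radial_coeff (t z) / t z * (2 * t z) = 2 * (radial_rate (t z) - 1) * radial_coeff (t z)" using n by simp
    then show ?thesis
      by (simp only: H_E[OF z] dp_E) (simp add: dp_def[of z v] inner_simps algebra_simps)
  qed
qed

lemma B_horizontal:
  assumes z: "z \<in> V" and a: "p_part z \<bullet> a = 0"
  shows "rad.B z (hor z a) = horizontal_rate (t z) *\<^sub>R hor z a"
proof (rule rad.B_eigen[OF z])
  fix v
  let ?K = "base.H (q_part z) a (q_part v)"
  have n: "t z > 0" "l (t z) \<noteq> 0" using t_pos[OF z] pos(4)[OF t_pos[OF z]] by auto
  have H_hor: "tm.H y (hor y a) v = A * t y * (l (t y))\<^sup>2 * base.H (q_part y) a (q_part v)"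
    if "y \<in> V" "p_part y \<bullet> a = 0" for y v
    unfolding H_formula[OF that(1)] using that(2) linear_0[OF linear_sharp] by (simp add: hor_def[of y a] dp_def linear_0[OF linear_gamma0])
  have eq: "A * ((1 + s)\<^sup>2 * t z) * (l ((1 + s)\<^sup>2 * t z))\<^sup>2 * ?K
     = tm.H (z + s *\<^sub>R E z) (hor z a + s *\<^sub>R E (hor z a)) v" if s: "s > -1" for s
  proof -
    have "hor z a + s *\<^sub>R E (hor z a) = hor (z + s *\<^sub>R E z) a"
      unfolding hor_def along_ray(6)[OF z s] by (simp add: E_def join_add join_scaleR algebra_simps)
    then show ?thesis
      using H_hor[OF along_ray(1)[OF z s], of v] along_ray(2,3,5)[OF z s] a by simp
  qed
  show "((\<lambda>s. tm.H (z + s *\<^sub>R E z) (hor z a + s *\<^sub>R E (hor z a)) v) has_real_derivative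
     A * l (t z) * S (t z) * (2 * t z) * ?K) (at 0)"
    by (rule deriv_at_0_cong[OF DERIV_cmult_right[OF scaling_deriv[OF horizontal_coeff_deriv[OF n(1)]]] eq])
  show "A * l (t z) * S (t z) * (2 * t z) * ?K + tm.H z (hor z a) (E v) = 2 * horizontal_rate (t z) * tm.H z (hor z a) v"
    using n by (simp add: H_hor[OF z a] horizontal_rate_def power2_eq_square)
qed

text \<open>On such vectors the metric is \<open>1 / (A t)\<close> times the fibre metric, and \<open>t\<close> is quadratic in the
  covector: tangent vectors of the fibre spheres keep their length along the radial flow.\<close>

lemma B_vertical:
  assumes z: "z \<in> V" and b: "r z \<bullet> b = 0"
  shows "rad.B z (join 0 b) = 0 *\<^sub>R join 0 b"
proof (rule rad.B_eigen[OF z])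
  fix v
  let ?X = "sharp (q_part z) b \<bullet> p_part v" and ?Y = "sharp (q_part z) b \<bullet> gamma0 z (q_part v)"
  have n: "t z \<noteq> 0" "A \<noteq> 0" using t_pos[OF z] A by auto
  have H_ver: "tm.H y (join 0 (k *\<^sub>R b)) v = k / (A * t y) * (sharp (q_part y) b \<bullet> dp y v)"
    if "y \<in> V" "r y \<bullet> b = 0" for y v k
    unfolding H_formula[OF that(1)] using that(2) by simp
  have eq: "(1 + s) / (A * ((1 + s)\<^sup>2 * t z)) * (?X - (1 + s) * ?Y)
     = tm.H (z + s *\<^sub>R E z) (join 0 b + s *\<^sub>R E (join 0 b)) v" if s: "s > -1" for s
  proof -
    have "join 0 b + s *\<^sub>R E (join 0 b) = join 0 ((1 + s) *\<^sub>R b)"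
      by (simp add: E_def join_add join_scaleR algebra_simps)
    then show ?thesis
      using H_ver[OF along_ray(1)[OF z s], of "1 + s" v] along_ray(2,4,5,7)[OF z s] b
      by (simp add: inner_simps del: parts_simps)
  qed
  have "((\<lambda>s. ?X / (A * t z) / (1 + s) - ?Y / (A * t z)) has_real_derivative - ?X / (A * t z)) (at 0)"
    by (auto intro!: derivative_eq_intros simp: n)
  moreover have "?X / (A * t z) / (1 + s) - ?Y / (A * t z) = (1 + s) / (A * ((1 + s)\<^sup>2 * t z)) * (?X - (1 + s) * ?Y)"
    if "s > -1" for s
  proof -
    have s: "1 + s \<noteq> 0" using that by simp
    then have "(1 + s) / (A * ((1 + s)\<^sup>2 * t z)) = 1 / (A * t z) / (1 + s)"
      by (simp add: power2_eq_square)
    then show ?thesis using s by (simp add: right_diff_distrib)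
  qed
  ultimately show "((\<lambda>s. tm.H (z + s *\<^sub>R E z) (join 0 b + s *\<^sub>R E (join 0 b)) v) has_real_derivative - ?X / (A * t z)) (at 0)"
    using deriv_at_0_cong eq by (metis (no_types, lifting))
  show "- ?X / (A * t z) + tm.H z (join 0 b) (E v) = 2 * 0 * tm.H z (join 0 b) v"
    using H_ver[OF z b, of 1 "E v"] by simp
qed

lemma radial_rate_t_differentiable: assumes y: "y \<in> V" shows "(\<lambda>z. radial_rate (t z)) differentiable (at y)"
  by (rule differentiable_compose[where f = radial_rate and g = t])
    (use y radial_rate_differentiable t_pos differentiable_t in auto)

text \<open>Flatness of the fibres in the radial direction: geometrically they are open parts of
  cylinders over spheres.\<close>

lemma curvature_vertical:
  assumes y: "y \<in> V" and b: "r y \<bullet> b = 0"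
  shows "tm.H y (tm.R y (E y) (join 0 b) (join 0 b)) (E y) = 0"
proof -
  have "tm.H y (tm.R y (E y) (join 0 b) (join 0 b)) (E y)
     = (radial_rate (t y) * 0 - 0\<^sup>2 - 0) * tm.H y (join 0 b) (join 0 b)"
  proof (rule rad.radial_curvature[where \<beta> = "\<lambda>s. 0", OF y B_radial radial_rate_t_differentiable[OF y]])
    show "tm.H y (E y) (join 0 b) = 0" by (simp add: H_E[OF y] b)
    show "((\<lambda>s. 0) has_real_derivative 0) (at (0::real))" by (rule DERIV_const)
    fix s :: real assume "\<bar>s\<bar> < 1"
    then have s: "s > -1" by simp
    have "join 0 b + s *\<^sub>R E (join 0 b) = join 0 ((1 + s) *\<^sub>R b)"
      by (simp add: E_def join_add join_scaleR algebra_simps)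
    then show "rad.B (y + s *\<^sub>R E y) (join 0 b + s *\<^sub>R E (join 0 b)) = 0 *\<^sub>R (join 0 b + s *\<^sub>R E (join 0 b))"
      using B_vertical[OF along_ray(1)[OF y s], of "(1 + s) *\<^sub>R b"] along_ray(4)[OF y s] b by simp
  qed simp
  then show ?thesis by simp
qed

lemma curvature_horizontal:
  assumes y: "y \<in> V" and a: "p_part y \<bullet> a = 0"
  shows "tm.H y (tm.R y (E y) (hor y a) (hor y a)) (E y)
    = t y * A\<^sup>2 * (S (t y))\<^sup>2 / D (t y) * tm.H y (hor y a) (hor y a)"
proof -
  have "tm.H y (tm.R y (E y) (hor y a) (hor y a)) (E y)
     = (radial_rate (t y) * horizontal_rate ((1 + 0)\<^sup>2 * t y) - (horizontal_rate ((1 + 0)\<^sup>2 * t y))\<^sup>2 - horizontal_rate' (t y) * (2 * t y)) * tm.H y (hor y a) (hor y a)"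
  proof (rule rad.radial_curvature[where \<beta> = "\<lambda>s. horizontal_rate ((1 + s)\<^sup>2 * t y)", OF y B_radial radial_rate_t_differentiable[OF y]])
    show "tm.H y (E y) (hor y a) = 0" by (simp add: H_E[OF y])
    show "((\<lambda>s. horizontal_rate ((1 + s)\<^sup>2 * t y)) has_real_derivative horizontal_rate' (t y) * (2 * t y)) (at 0)"
      by (rule scaling_deriv[OF horizontal_rate_deriv[OF t_pos[OF y]]])
    fix s :: real assume "\<bar>s\<bar> < 1"
    then have s: "s > -1" by simp
    have "hor y a + s *\<^sub>R E (hor y a) = hor (y + s *\<^sub>R E y) a"
      unfolding hor_def along_ray(6)[OF y s] by (simp add: E_def join_add join_scaleR algebra_simps)
    then show "rad.B (y + s *\<^sub>R E y) (hor y a + s *\<^sub>R E (hor y a)) = horizontal_rate ((1 + s)\<^sup>2 * t y) *\<^sub>R (hor y a + s *\<^sub>R E (hor y a))"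
      using B_horizontal[OF along_ray(1)[OF y s], of a] along_ray(3,5)[OF y s] a by simp
  qed
  moreover have "radial_rate (t y) * horizontal_rate ((1 + 0)\<^sup>2 * t y) - (horizontal_rate ((1 + 0)\<^sup>2 * t y))\<^sup>2 - horizontal_rate' (t y) * (2 * t y)
     = t y * A\<^sup>2 * (S (t y))\<^sup>2 / D (t y)"
    using curvature_function[OF t_pos[OF y]] by (simp add: mult_ac)
  ultimately show ?thesis by simp
qed

text \<open>Since \<open>u\<close> and \<open>J u\<close> are orthogonal of equal length, the denominator of the sectional curvature is
  the square of \<open>H y u u\<close>.\<close>

lemma constant_holomorphic_coords:
  assumes const: "\<And>P u. P \<in> fst \<Phi> \<Longrightarrow> u \<in> tangent_space (cotangent0_atlas \<A>) P \<Longrightarrow> u \<noteq> zero_vec \<Longrightarrow>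
      sectional_curvature (cotangent0_atlas \<A>) G \<Phi> P u (J P u) = k"
    and y: "y \<in> V"
  shows "tm.H y (tm.R y u (tm.J y u) (tm.J y u)) u = k * (tm.H y u u)\<^sup>2"
proof (cases "u = 0")
  case True
  then show ?thesis by simp
next
  case False
  obtain P where P: "P \<in> fst \<Phi>" "snd \<Phi> P = y" using y by auto
  let ?u = "tvec (cotangent0_atlas \<A>) \<Phi> P u"
  have met: "riemannian_metric (cotangent0_atlas \<A>) G" and ac: "almost_complex (cotangent0_atlas \<A>) J"
    using K by (auto simp: kaehler_structure_def)
  have Ju: "J P ?u = tvec (cotangent0_atlas \<A>) \<Phi> P (tm.J y u)"
    using endo_coords_tvec[OF atlas \<Phi> P(1) ac] by (simp add: tm.J_def P(2))
  have GH: "G P (tvec (cotangent0_atlas \<A>) \<Phi> P v) (tvec (cotangent0_atlas \<A>) \<Phi> P w) = tm.H y v w" for v w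
    using metric_coords_tvec[OF atlas \<Phi> P(1) met] by (simp add: tm.H_def P(2))
  have pos: "tm.H y u u > 0" using False by (rule tm.H_pos[OF y])
  have "tm.H y u (tm.J y u) = 0"
    using tm.H_J[OF y, of u u] tm.H_sym[OF y, of u "tm.J y u"] by simp
  then have "sectional_curvature (cotangent0_atlas \<A>) G \<Phi> P ?u (J P ?u)
     = tm.H y (tm.R y u (tm.J y u) (tm.J y u)) u / (tm.H y u u * tm.H y u u)"
    unfolding sectional_curvature_def Ju GH P(2) tm.riemann_form_H[OF y]
    by (simp add: tvec_self[OF atlas \<Phi> P(1)] tm.H_J_J[OF y])
  moreover have "sectional_curvature (cotangent0_atlas \<A>) G \<Phi> P ?u (J P ?u) = k"
    using tvec_zero_iff[OF atlas \<Phi> P(1)] False by (intro const P(1) tvec_in_tangent_space[OF atlas \<Phi>]) simp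
  ultimately show ?thesis using pos by (simp add: field_simps power2_eq_square)
qed

text \<open>The vectors are \<open>E\<close> and \<open>\<eta> = join 0 b\<close>; a covector \<open>b\<close> orthogonal to \<open>p\<close> exists because the dimension
  is at least 2. The plane of \<open>E, \<eta>\<close> is flat and the plane of \<open>E, J \<eta>\<close> is positively curved.\<close>

theorem not_constant_holomorphic:
  assumes n: "CARD('n) > 1" and ne: "fst \<phi> \<noteq> {}"
  shows "\<not> constant_holomorphic_sectional_curvature (cotangent0_atlas \<A>) G J"
proof
  assume "constant_holomorphic_sectional_curvature (cotangent0_atlas \<A>) G J"
  then obtain k where k: "\<And>P u. P \<in> fst \<Phi> \<Longrightarrow> u \<in> tangent_space (cotangent0_atlas \<A>) P \<Longrightarrow> u \<noteq> zero_vec \<Longrightarrow>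
      sectional_curvature (cotangent0_atlas \<A>) G \<Phi> P u (J P u) = k"
    using \<Phi> unfolding constant_holomorphic_sectional_curvature_def by meson
  obtain x where x: "x \<in> fst \<phi>" using ne by auto
  obtain p :: "real^'n" where p: "p \<noteq> 0" using vector_choose_size[of 1] by force
  define y where "y = join (snd \<phi> x) p"
  have y: "y \<in> V" unfolding V_iff y_def using x p by simp
  have q: "q_part y \<in> U" using y V_iff by blast
  have "DIM(real^'n) \<ge> 2" using n by simp
  then obtain b where b: "b \<noteq> 0" "r y \<bullet> b = 0"
    using orthogonal_to_vector_exists[of "r y"] unfolding orthogonal_def by auto
  have ty: "t y > 0" "A * t y * l (t y) > 0" using t_pos[OF y] A pos[of "t y"] by auto
  define a where "a = - (1 / (A * t y * l (t y))) *\<^sub>R sharp (q_part y) b"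
  have Jb: "tm.J y (join 0 b) = hor y a" unfolding a_def by (rule J_vertical[OF y b(2)])
  have "A * t y * l (t y) \<noteq> 0" using ty(2) by linarith
  then have "a \<noteq> 0" using sharp_pos(2)[OF q b(1)] by (simp add: a_def)
  have pa: "p_part y \<bullet> a = 0"
    using b(2) sharp_sym[OF q, of "p_part y" b] by (simp add: a_def r_def)
  have "hor y a \<noteq> 0" using \<open>a \<noteq> 0\<close> parts_join(1)[of a "gamma0 y a"] by (metis hor_def linear_0 linear_q_part)
  then have "tm.H y (hor y a) (hor y a) > 0" by (rule tm.H_pos[OF y])
  moreover have "t y * A\<^sup>2 * (S (t y))\<^sup>2 / D (t y) > 0" using ty A pos[of "t y"] by simp
  moreover have "tm.H y (tm.R y (E y) (join 0 b) (join 0 b)) (E y)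
      = tm.H y (tm.R y (E y) (hor y a) (hor y a)) (E y)"
    unfolding Jb[symmetric]
    by (rule tm.constant_holomorphic_curvature[OF y constant_holomorphic_coords[OF k y]])
      (simp_all add: Jb H_E[OF y] b(2))
  ultimately show False
    unfolding curvature_vertical[OF y b(2)] curvature_horizontal[OF y pa] by (metis mult_pos_pos less_irrefl)
qed

end


theorem mainTheorem2:
  fixes X :: "'m topology"
    and \<A> :: "('m, 'n::finite) chart set"
    and g :: "('m, 'n) metric"
    and c A :: real
    and l :: "real \<Rightarrow> real"
    and G :: "(('m, 'n) cotangent, 'n + 'n) metric"
    and J :: "(('m, 'n) cotangent, 'n + 'n) endo_field"
  assumes "smooth_manifold X \<A>"
    and "CARD('n) > 1"
    and "riemannian_metric \<A> g"
    and "c > 0"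
    and "constant_sectional_curvature \<A> g c"
    and "A > 0"
    and "smooth_on {0<..} l"
    and "\<And>t. t > 0 \<Longrightarrow> l t > 0"
    and "\<And>t. t > 0 \<Longrightarrow> 2 * c - A\<^sup>2 * t * (l t)\<^sup>2 > 0"
    and "\<And>t. t > 0 \<Longrightarrow> l t + 2 * t * deriv l t > 0"
    and "kaehler_structure (cotangent0_atlas \<A>) G J"
    and "given_J A c l \<A> g J"
    and "given_G A c l \<A> g G"
  shows "\<not> constant_holomorphic_sectional_curvature (cotangent0_atlas \<A>) G J"
proof -
  obtain x \<phi> where \<phi>_in: "\<phi> \<in> \<A>" and x: "x \<in> fst \<phi>"
    using assms(1) unfolding smooth_manifold_def by blast
  interpret cotangent_kaehler A c l X \<A> g G J \<phi>
    by unfold_locales (use assms \<phi>_in in auto)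
  show ?thesis using not_constant_holomorphic assms(2) x by blast
qed

end
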